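(* Let $(\mathcal{A}_j,\mathcal{H}_j,\mathfrak{D}_j,\overline{\mathfrak{D}}_j,\gamma_j,\star_j)$, $j=1,2$, be two $N=(1,1)$ spectral data, and put $\gamma:=\gamma_1\otimes\gamma_2$ and $\star:=\star_1\otimes\star_2$ on $\mathcal{H}_1\otimes\mathcal{H}_2$. Besides the choice $\mathfrak{D}=\mathfrak{D}_1\otimes1+\star_1\otimes\mathfrak{D}_2$, $\overline{\mathfrak{D}}=\overline{\mathfrak{D}}_1\otimes\star_2+\gamma_1\otimes\overline{\mathfrak{D}}_2$, each of the following choices of $(\mathfrak{D},\overline{\mathfrak{D}})$ also makes $(\mathcal{A}_1\otimes\mathcal{A}_2,\mathcal{H}_1\otimes\mathcal{H}_2,\mathfrak{D},\overline{\mathfrak{D}},\gamma,\star)$ an $N=(1,1)$ spectral data: 1. $\mathfrak{D}:=\mathfrak{D}_1\otimes1+\star_1\otimes\mathfrak{D}_2$ and $\overline{\mathfrak{D}}:=\overline{\mathfrak{D}}_1\otimes\gamma_2+\star_1\otimes\overline{\mathfrak{D}}_2$; 2. $\mathfrak{D}:=\mathfrak{D}_1\otimes\star_2+1\otimes\mathfrak{D}_2$ and $\overline{\mathfrak{D}}:=\overline{\mathfrak{D}}_1\otimes\gamma_2+\star_1\otimes\overline{\mathfrak{D}}_2$; 3. $\mathfrak{D}:=\mathfrak{D}_1\otimes\star_2+1\otimes\mathfrak{D}_2$ and $\overline{\mathfrak{D}}:=\overline{\mathfrak{D}}_1\otimes\star_2+\gamma_1\otimes\overline{\mathfrak{D}}_2$;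 4. $\mathfrak{D}:=\mathfrak{D}_1\otimes1+\gamma_1\otimes\mathfrak{D}_2$ and $\overline{\mathfrak{D}}:=\overline{\mathfrak{D}}_1\otimes1+\gamma_1\otimes\overline{\mathfrak{D}}_2$; 5. $\mathfrak{D}:=\mathfrak{D}_1\otimes\gamma_2+1\otimes\mathfrak{D}_2$ and $\overline{\mathfrak{D}}:=\overline{\mathfrak{D}}_1\otimes\gamma_2+1\otimes\overline{\mathfrak{D}}_2$.
   Context: An $N=(1,1)$ spectral data is a sextuple $(\mathcal{A},\mathcal{H},\mathfrak{D},\overline{\mathfrak{D}},\gamma,\star)$ where: $\mathcal{A}$ is a unital associative $*$-algebra represented faithfully on a separable Hilbert space $\mathcal{H}$ by bounded operators; $\mathfrak{D},\overline{\mathfrak{D}}$ are (essentially) self-adjoint operators on $\mathcal{H}$ ($\overline{\mathfrak{D}}$ is a second operator, not the closure of $\mathfrak{D}$) with $\mathfrak{D}^2=\overline{\mathfrak{D}}^2$ and $\{\mathfrak{D},\overline{\mathfrak{D}}\}=0$; for each $a\in\mathcal{A}$ the commutators $[\mathfrak{D},a]$ and $[\overline{\mathfrak{D}},a]$ extend to bounded operators; $\exp(-\varepsilon\mathfrak{D}^2)$ is trace class for all $\varepsilon>0$; $\gamma$ is a $\mathbb{Z}_2$-grading with $[\gamma,a]=0$ for all $a\in\mathcal{A}$ and $\{\gamma,\mathfrak{D}\}=\{\gamma,\overline{\mathfrak{D}}\}=0$; $\star$ is a self-adjoint unitary with $[\star,a]=0$ for all $a\in\mathcal{A}$, $[\star,\gamma]=0$,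 $\{\star,\mathfrak{D}\}=0$ and $[\star,\overline{\mathfrak{D}}]=0$. Tensor products of algebras are over $\mathbb{C}$ and tensor products of Hilbert spaces are Hilbert space tensor products. *)

theory Defs
  imports "HOL-Analysis.Analysis"
begin

section \<open>Complex vector spaces, *-algebras and Hilbert spaces\<close>

class complex_vector = ab_group_add +
  fixes scaleC :: "complex \<Rightarrow> 'a \<Rightarrow> 'a" (infixr "*\<^sub>C" 75)
  assumes scaleC_add_right: "c *\<^sub>C (x + y) = c *\<^sub>C x + c *\<^sub>C y"
    and scaleC_add_left: "(c + d) *\<^sub>C x = c *\<^sub>C x + d *\<^sub>C x"
    and scaleC_scaleC: "c *\<^sub>C (d *\<^sub>C x) = (c * d) *\<^sub>C x"
    and scaleC_one: "1 *\<^sub>C x = x"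

instantiation complex :: complex_vector
begin
definition scaleC_complex :: "complex \<Rightarrow> complex \<Rightarrow> complex" where
  "scaleC_complex c z = c * z"
instance
  by standard (simp_all add: scaleC_complex_def algebra_simps)
end

instantiation prod :: (complex_vector, complex_vector) complex_vector
begin
definition scaleC_prod :: "complex \<Rightarrow> 'a \<times> 'b \<Rightarrow> 'a \<times> 'b" where
  "scaleC_prod c p = (c *\<^sub>C fst p, c *\<^sub>C snd p)"
instance
  by standard
    (simp_all add: scaleC_prod_def scaleC_add_right scaleC_add_left scaleC_scaleC scaleC_one)
end

abbreviation csubspace :: "'a::complex_vector set \<Rightarrow> bool" where
  "csubspace \<equiv> module.subspace scaleC"

abbreviation cspan :: "'a::complex_vector set \<Rightarrow> 'a set" where
  "cspan \<equiv> module.span scaleC"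

abbreviation clinear :: "('a::complex_vector \<Rightarrow> 'b::complex_vector) \<Rightarrow> bool" where
  "clinear \<equiv> Vector_Spaces.linear scaleC scaleC"

definition cbilinear ::
  "('a::complex_vector \<Rightarrow> 'b::complex_vector \<Rightarrow> 'c::complex_vector) \<Rightarrow> bool" where
  "cbilinear f \<longleftrightarrow> (\<forall>x. clinear (f x)) \<and> (\<forall>y. clinear (\<lambda>x. f x y))"

text \<open>The class \<open>ring_1\<close> is not used, because it would exclude the zero algebra.\<close>

class complex_star_algebra = complex_vector + ring + monoid_mult +
  fixes star :: "'a \<Rightarrow> 'a"
  assumes mult_scaleC_left: "(c *\<^sub>C a) * b = c *\<^sub>C (a * b)"
    and mult_scaleC_right: "a * (c *\<^sub>C b) = c *\<^sub>C (a * b)"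
    and star_star: "star (star a) = a"
    and star_add: "star (a + b) = star a + star b"
    and star_scaleC: "star (c *\<^sub>C a) = cnj c *\<^sub>C star a"
    and star_mult: "star (a * b) = star b * star a"

text \<open>The inner product is linear in its second argument.\<close>

class complex_hilbert = banach + complex_vector +
  fixes cinner :: "'a \<Rightarrow> 'a \<Rightarrow> complex"
  assumes scaleR_scaleC: "r *\<^sub>R x = complex_of_real r *\<^sub>C x"
    and cinner_commute: "cinner x y = cnj (cinner y x)"
    and cinner_add_right: "cinner x (y + z) = cinner x y + cinner x z"
    and cinner_scaleC_right: "cinner x (c *\<^sub>C y) = c * cinner x y"
    and cinner_self: "cinner x x = complex_of_real ((norm x)\<^sup>2)"


section \<open>Bounded operators\<close>

definition bounded_clinear :: "('h::complex_hilbert \<Rightarrow> 'k::complex_hilbert) \<Rightarrow> bool" where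
  "bounded_clinear B \<longleftrightarrow> bounded_linear B \<and> clinear B"

definition bounded_self_adjoint :: "('h::complex_hilbert \<Rightarrow> 'h) \<Rightarrow> bool" where
  "bounded_self_adjoint B \<longleftrightarrow> bounded_clinear B \<and> (\<forall>x y. cinner (B x) y = cinner x (B y))"

definition orthogonal_projection :: "('h::complex_hilbert \<Rightarrow> 'h) \<Rightarrow> bool" where
  "orthogonal_projection P \<longleftrightarrow> bounded_self_adjoint P \<and> P \<circ> P = P"

definition self_adjoint_unitary :: "('h::complex_hilbert \<Rightarrow> 'h) \<Rightarrow> bool" where
  "self_adjoint_unitary U \<longleftrightarrow> bounded_self_adjoint U \<and> U \<circ> U = id"

definition positive_operator :: "('h::complex_hilbert \<Rightarrow> 'h) \<Rightarrow> bool" where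
  "positive_operator P \<longleftrightarrow>
     bounded_self_adjoint P \<and> (\<forall>x. 0 \<le> Re (cinner x (P x)))"

text \<open>\<open>P = (B\<^sup>* B)\<^bsup>1/2\<^esup>\<close>: the second condition says \<open>P\<^sup>2 = B\<^sup>* B\<close>.\<close>

definition is_absolute_value ::
  "('h::complex_hilbert \<Rightarrow> 'h) \<Rightarrow> ('h \<Rightarrow> 'h) \<Rightarrow> bool" where
  "is_absolute_value P B \<longleftrightarrow>
     positive_operator P \<and> (\<forall>x y. cinner x (P (P y)) = cinner (B x) (B y))"

definition orthonormal_basis :: "'h::complex_hilbert set \<Rightarrow> bool" where
  "orthonormal_basis S \<longleftrightarrow>
     (\<forall>e\<in>S. \<forall>f\<in>S. cinner e f = (if e = f then 1 else 0)) \<and> closure (cspan S) = UNIV"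

text \<open>The trace of a positive operator does not depend on the orthonormal basis.\<close>

definition trace_class :: "('h::complex_hilbert \<Rightarrow> 'h) \<Rightarrow> bool" where
  "trace_class B \<longleftrightarrow> bounded_clinear B \<and>
     (\<exists>P S. is_absolute_value P B \<and> orthonormal_basis S \<and>
            (\<lambda>e. Re (cinner e (P e))) summable_on S)"


section \<open>Unbounded operators\<close>

text \<open>
  An unbounded operator is given by its graph: the domain is \<open>Domain T\<close>, the closure
  of the operator is the topological \<open>closure\<close> of the graph in the product, and the composition
  \<open>x \<mapsto> T (S x)\<close> on its maximal domain is the relational composition \<open>S O T\<close>.
\<close>

type_synonym 'h unbounded_op = "('h \<times> 'h) set"

definition is_operator :: "'h::complex_hilbert unbounded_op \<Rightarrow> bool" where
  "is_operator T \<longleftrightarrow> csubspace T \<and> single_valued T"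

definition graph :: "('h \<Rightarrow> 'h) \<Rightarrow> 'h unbounded_op" where
  "graph B = {(x, B x) | x. True}"

text \<open>The sum has the intersection of the two domains as its domain.\<close>

definition op_plus ::
  "'h::complex_hilbert unbounded_op \<Rightarrow> 'h unbounded_op \<Rightarrow> 'h unbounded_op"
    (infixl "\<oplus>" 65) where
  "S \<oplus> T = {(x, y + z) | x y z. (x, y) \<in> S \<and> (x, z) \<in> T}"

definition adjoint :: "'h::complex_hilbert unbounded_op \<Rightarrow> 'h unbounded_op" where
  "adjoint T = {(y, z). \<forall>(x, x') \<in> T. cinner y x' = cinner z x}"

definition self_adjoint :: "'h::complex_hilbert unbounded_op \<Rightarrow> bool" where
  "self_adjoint T \<longleftrightarrow> is_operator T \<and> closure (Domain T) = UNIV \<and> adjoint T = T"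

definition essentially_self_adjoint :: "'h::complex_hilbert unbounded_op \<Rightarrow> bool" where
  "essentially_self_adjoint T \<longleftrightarrow>
     is_operator T \<and> closure (Domain T) = UNIV \<and> self_adjoint (closure T)"

text \<open>
  \<open>{S, T} = 0\<close> on the common domain of \<open>S T\<close> and \<open>T S\<close>. For self-adjoint \<open>S\<close>, \<open>T\<close> with
  \<open>S\<^sup>2 = T\<^sup>2\<close> the domains of \<open>S\<close> and \<open>T\<close> coincide (both are the domain of \<open>\<bar>S\<bar> = \<bar>T\<bar>\<close>),
  so this common domain is the domain of \<open>S\<^sup>2\<close>.
\<close>

definition anticommute :: "'h::complex_hilbert unbounded_op \<Rightarrow> 'h unbounded_op \<Rightarrow> bool" where
  "anticommute S T \<longleftrightarrow> (\<forall>(x, y) \<in> (S O T) \<oplus> (T O S). y = 0)"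

text \<open>
  In the following three definitions the bounded operator is required to map the domain
  of \<open>T\<close> into itself. The operator \<open>C\<close> is the bounded extension of \<open>[T, B]\<close>.
\<close>

definition commutes_with :: "('h::complex_hilbert \<Rightarrow> 'h) \<Rightarrow> 'h unbounded_op \<Rightarrow> bool" where
  "commutes_with B T \<longleftrightarrow> (\<forall>(x, y) \<in> T. (B x, B y) \<in> T)"

definition anticommutes_with :: "('h::complex_hilbert \<Rightarrow> 'h) \<Rightarrow> 'h unbounded_op \<Rightarrow> bool" where
  "anticommutes_with B T \<longleftrightarrow> (\<forall>(x, y) \<in> T. (B x, - B y) \<in> T)"

definition bounded_commutator :: "'h::complex_hilbert unbounded_op \<Rightarrow> ('h \<Rightarrow> 'h) \<Rightarrow> bool" where
  "bounded_commutator T B \<longleftrightarrow>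
     (\<exists>C. bounded_clinear C \<and> (\<forall>(x, y) \<in> T. (B x, B y + C x) \<in> T))"


section \<open>Functional calculus\<close>

definition spectral_measure :: "(real set \<Rightarrow> 'h::complex_hilbert \<Rightarrow> 'h) \<Rightarrow> bool" where
  "spectral_measure E \<longleftrightarrow>
     (\<forall>S\<in>sets borel. orthogonal_projection (E S)) \<and>
     E UNIV = id \<and>
     (\<forall>S\<in>sets borel. \<forall>T\<in>sets borel. E (S \<inter> T) = E S \<circ> E T) \<and>
     (\<forall>A::nat \<Rightarrow> real set. range A \<subseteq> sets borel \<longrightarrow> disjoint_family A \<longrightarrow>
        (\<forall>x. (\<lambda>n. E (A n) x) sums E (\<Union>n. A n) x))"

definition scalar_measure ::
  "(real set \<Rightarrow> 'h::complex_hilbert \<Rightarrow> 'h) \<Rightarrow> 'h \<Rightarrow> real measure" where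
  "scalar_measure E x =
     measure_of UNIV (sets borel) (\<lambda>S. ennreal (Re (cinner x (E S x))))"

text \<open>
  \<open>T = \<integral> s dE(s)\<close>. The quadratic form on the domain determines \<open>T\<close> by polarization.
\<close>

definition spectral_resolution ::
  "'h::complex_hilbert unbounded_op \<Rightarrow> (real set \<Rightarrow> 'h \<Rightarrow> 'h) \<Rightarrow> bool" where
  "spectral_resolution T E \<longleftrightarrow>
     spectral_measure E \<and>
     Domain T = {x. integrable (scalar_measure E x) (\<lambda>s. s\<^sup>2)} \<and>
     (\<forall>(x, y) \<in> T. cinner x y = complex_of_real (\<integral>s. s \<partial>scalar_measure E x))"

text \<open>
  \<open>B = f(T) = \<integral> f(s) dE(s)\<close> for self-adjoint \<open>T\<close> and bounded Borel \<open>f\<close>. By the spectral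
  theorem exactly one such \<open>B\<close> exists.
\<close>

definition is_functional_calculus ::
  "'h::complex_hilbert unbounded_op \<Rightarrow> (real \<Rightarrow> real) \<Rightarrow> ('h \<Rightarrow> 'h) \<Rightarrow> bool" where
  "is_functional_calculus T f B \<longleftrightarrow> bounded_clinear B \<and>
     (\<exists>E. spectral_resolution T E \<and>
          (\<forall>x. cinner x (B x) = complex_of_real (\<integral>s. f s \<partial>scalar_measure E x)))"


section \<open>Spectral data\<close>

definition faithful_star_representation ::
  "('a::complex_star_algebra \<Rightarrow> 'h::complex_hilbert \<Rightarrow> 'h) \<Rightarrow> bool" where
  "faithful_star_representation \<pi> \<longleftrightarrow>
     (\<forall>a. bounded_clinear (\<pi> a)) \<and>
     (\<forall>x. clinear (\<lambda>a. \<pi> a x)) \<and>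
     (\<forall>a b. \<pi> (a * b) = \<pi> a \<circ> \<pi> b) \<and>
     \<pi> 1 = id \<and>
     (\<forall>a x y. cinner (\<pi> (star a) x) y = cinner x (\<pi> a y)) \<and>
     inj \<pi>"

text \<open>
  The algebra and the Hilbert space are the types \<open>'a\<close> and \<open>'h\<close>. The operators \<open>D\<close> and \<open>D'\<close>
  (the latter is the second operator of the data) may be given on a domain of essential
  self-adjointness; all relations are those of their self-adjoint closures.
\<close>

locale N11_spectral_data =
  fixes \<pi> :: "'a::complex_star_algebra \<Rightarrow> 'h::complex_hilbert \<Rightarrow> 'h"
    and D D' :: "'h unbounded_op"
    and \<gamma> st :: "'h \<Rightarrow> 'h"
  assumes separable: "separable_space (euclidean :: 'h topology)"
    and representation: "faithful_star_representation \<pi>"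
    and D_self_adjoint: "essentially_self_adjoint D"
    and D'_self_adjoint: "essentially_self_adjoint D'"
    and squares: "closure D O closure D = closure D' O closure D'"
    and D_D': "anticommute (closure D) (closure D')"
    and commutator_D: "bounded_commutator (closure D) (\<pi> a)"
    and commutator_D': "bounded_commutator (closure D') (\<pi> a)"
    and heat_trace_class: "\<epsilon> > 0 \<Longrightarrow>
      \<exists>B. is_functional_calculus (closure D) (\<lambda>s. exp (- \<epsilon> * s\<^sup>2)) B \<and> trace_class B"
    and grading: "self_adjoint_unitary \<gamma>"
    and grading_algebra: "\<gamma> \<circ> \<pi> a = \<pi> a \<circ> \<gamma>"
    and grading_D: "anticommutes_with \<gamma> (closure D)"
    and grading_D': "anticommutes_with \<gamma> (closure D')"
    and star_unitary: "self_adjoint_unitary st"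
    and star_algebra: "st \<circ> \<pi> a = \<pi> a \<circ> st"
    and star_grading: "st \<circ> \<gamma> = \<gamma> \<circ> st"
    and star_D: "anticommutes_with st (closure D)"
    and star_D': "commutes_with st (closure D')"


section \<open>Tensor products\<close>

text \<open>
  Tensor products are described up to unique isomorphism. For algebras, spanning together with
  the factorization of \<open>\<complex>\<close>-valued bilinear forms is equivalent to the universal
  property for arbitrary target spaces.
\<close>

definition algebra_tensor ::
  "('a::complex_star_algebra \<Rightarrow> 'b::complex_star_algebra \<Rightarrow> 'c::complex_star_algebra) \<Rightarrow> bool" where
  "algebra_tensor t \<longleftrightarrow>
     cbilinear t \<and>
     cspan {t a b | a b. True} = UNIV \<and>
     (\<forall>\<phi> :: 'a \<Rightarrow> 'b \<Rightarrow> complex. cbilinear \<phi> \<longrightarrow>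
        (\<exists>f. clinear f \<and> (\<forall>a b. f (t a b) = \<phi> a b))) \<and>
     (\<forall>a b a' b'. t a b * t a' b' = t (a * a') (b * b')) \<and>
     t 1 1 = 1 \<and>
     (\<forall>a b. star (t a b) = t (star a) (star b))"

definition hilbert_tensor ::
  "('h::complex_hilbert \<Rightarrow> 'k::complex_hilbert \<Rightarrow> 'l::complex_hilbert) \<Rightarrow> bool" where
  "hilbert_tensor t \<longleftrightarrow>
     cbilinear t \<and>
     (\<forall>x y x' y'. cinner (t x y) (t x' y') = cinner x x' * cinner y y') \<and>
     closure (cspan {t x y | x y. True}) = UNIV"

text \<open>
  \<open>S \<otimes> T\<close> on the algebraic tensor product of the domains of \<open>S\<close> and \<open>T\<close>.
\<close>

definition op_tensor ::
  "'h unbounded_op \<Rightarrow> ('h::complex_hilbert \<Rightarrow> 'k::complex_hilbert \<Rightarrow> 'l::complex_hilbert) \<Rightarrow>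
   'k unbounded_op \<Rightarrow> 'l unbounded_op" ("(_ \<otimes>\<^bsub>_\<^esub> _)" [71, 0, 71] 70) where
  "S \<otimes>\<^bsub>t\<^esub> T = cspan {(t x y, t x' y') | x y x' y'. (x, x') \<in> S \<and> (y, y') \<in> T}"

definition bounded_tensor ::
  "('h::complex_hilbert \<Rightarrow> 'k::complex_hilbert \<Rightarrow> 'l::complex_hilbert) \<Rightarrow>
   ('h \<Rightarrow> 'h) \<Rightarrow> ('k \<Rightarrow> 'k) \<Rightarrow> 'l \<Rightarrow> 'l" where
  "bounded_tensor t S T =
     (THE B. bounded_clinear B \<and> (\<forall>x y. B (t x y) = t (S x) (T y)))"

text \<open>
  The linear map \<open>\<pi>\<close> with \<open>\<pi> (a \<otimes> b) = \<pi>\<^sub>1 a \<otimes> \<pi>\<^sub>2 b\<close>.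
\<close>

definition representation_tensor ::
  "('a1::complex_star_algebra \<Rightarrow> 'a2::complex_star_algebra \<Rightarrow> 'a::complex_star_algebra) \<Rightarrow>
   ('h1::complex_hilbert \<Rightarrow> 'h2::complex_hilbert \<Rightarrow> 'h::complex_hilbert) \<Rightarrow>
   ('a1 \<Rightarrow> 'h1 \<Rightarrow> 'h1) \<Rightarrow> ('a2 \<Rightarrow> 'h2 \<Rightarrow> 'h2) \<Rightarrow> 'a \<Rightarrow> 'h \<Rightarrow> 'h" where
  "representation_tensor tA tH \<pi>\<^sub>1 \<pi>\<^sub>2 =
     (THE \<pi>. (\<forall>x. clinear (\<lambda>u. \<pi> u x)) \<and>
              (\<forall>a b. \<pi> (tA a b) = bounded_tensor tH (\<pi>\<^sub>1 a) (\<pi>\<^sub>2 b)))"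

end

(*
  All choices are of the form D = D1 (x) alpha + beta (x) D2, where alpha and beta are 1, the grading or
  the involution, and commute or anticommute with the operators. The signs are such that on
  eigenvectors e of D1 and f of D2 the operators D and D' both square to the sum of the squared
  eigenvalues, and anticommute. The analysis rests on the trace class condition: it forces D1 and D2 to have
  orthonormal bases of eigenvectors, because a vector orthogonal to all eigenvectors would have
  an atomless spectral measure. The products of these eigenvectors form a basis that diagonalizes
  D^2 = D'^2. A symmetric operator with such a diagonal square is, after closure, itself diagonal: on
  each vector v of the basis, v + Dv/r and v - Dv/r are eigenvectors, where r^2 is the eigenvalue
  of D^2 (and Dv = 0 if r = 0). Hence its closure is self-adjoint, the domain of its square and the
  anticommutation relation can be read off from the basis, and the heat trace is the product
  of those of the factors.
*)
theory Submission
  imports Defs "HOL-Probability.Probability"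
begin

section \<open>Complex vector spaces\<close>

text \<open>The obstacle is domains. The given operators are only cores of their closures, so a
  product of eigenvectors need not lie in the domain of the algebraic sum. All computations
  therefore take place in a larger set \<open>K\<close> of pairs inside the closure of the sum; that
  \<open>K\<close> spans a core follows afterwards, because a self-adjoint operator has no proper
  symmetric extension. Neither the second operator of a factor nor a product operator need be
  diagonal in the basis at hand, only its square is. Both product operators share the basis
  \<open>V\<close> and the eigenvalue function \<open>\<kappa>\<close> of the square, and these two
  determine the square completely; this yields equal squares, domains included, without a comparison
  of the domains of the operators themselves. The functional calculus describes an operator only by
  a quadratic form, and each \<epsilon> brings its own spectral measure. Hence eigenvectors are
  recovered by polarization, and each of these measures has to be compared with the eigenbasis found
  at \<epsilon> = 1.\<close>

interpretation cvs: vector_space "scaleC :: complex \<Rightarrow> 'a \<Rightarrow> 'a::complex_vector"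
  by standard (simp_all add: scaleC_add_right scaleC_add_left scaleC_scaleC scaleC_one)

lemma clinear_iff:
  fixes f :: "'a::complex_vector \<Rightarrow> 'b::complex_vector"
  shows "clinear f \<longleftrightarrow> (\<forall>x y. f (x + y) = f x + f y) \<and> (\<forall>c x. f (c *\<^sub>C x) = c *\<^sub>C f x)"
  by (simp add: Vector_Spaces.linear_iff cvs.vector_space_axioms)

lemma clinear_add: "clinear f \<Longrightarrow> f (x + y) = f x + f y"
  and clinear_scaleC: "clinear f \<Longrightarrow> f (c *\<^sub>C x) = c *\<^sub>C f x"
  by (simp_all add: clinear_iff)

lemma clinear_0: "clinear f \<Longrightarrow> f 0 = 0"
  using clinear_scaleC[of f 0 0] by simp

lemma clinear_minus: "clinear f \<Longrightarrow> f (- x) = - f x"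
  using clinear_scaleC[of f "-1" x] by simp

lemma clinear_diff: "clinear f \<Longrightarrow> f (x - y) = f x - f y"
  using clinear_add[of f x "- y"] clinear_minus[of f y] by simp

lemma clinear_sum: "clinear f \<Longrightarrow> f (\<Sum>i\<in>A. g i) = (\<Sum>i\<in>A. f (g i))"
  by (induction A rule: infinite_finite_induct) (simp_all add: clinear_0 clinear_add)

lemma csubspace_iff:
  "csubspace S \<longleftrightarrow> 0 \<in> S \<and> (\<forall>x\<in>S. \<forall>y\<in>S. x + y \<in> S) \<and> (\<forall>c. \<forall>x\<in>S. c *\<^sub>C x \<in> S)"
  by (auto simp: cvs.subspace_def)

lemma scaleC_prod_simps [simp]:
  "c *\<^sub>C (x, y) = (c *\<^sub>C x, c *\<^sub>C y)" "fst (c *\<^sub>C p) = c *\<^sub>C fst p" "snd (c *\<^sub>C p) = c *\<^sub>C snd p"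
  by (simp_all add: scaleC_prod_def)

lemma cspan_induct [consumes 1, case_names zero add scale base]:
  assumes "x \<in> cspan S"
    and "P 0" "\<And>x y. P x \<Longrightarrow> P y \<Longrightarrow> P (x + y)" "\<And>c x. P x \<Longrightarrow> P (c *\<^sub>C x)"
    and "\<And>x. x \<in> S \<Longrightarrow> P x"
  shows "P x"
  by (rule cvs.span_induct[OF assms(1), where P=P])
    (use assms in \<open>auto simp: csubspace_iff\<close>)


section \<open>Complex Hilbert spaces\<close>

lemma cinner_add_left: "cinner (x + y) z = cinner x z + cinner y z"
  by (metis cinner_add_right cinner_commute complex_cnj_add)

lemma cinner_scaleC_left: "cinner (c *\<^sub>C x) y = cnj c * cinner x y"
  by (metis cinner_scaleC_right cinner_commute complex_cnj_mult)

lemma cinner_zero_right [simp]: "cinner x 0 = 0"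
  using cinner_scaleC_right[of x 0 0] by simp

lemma cinner_zero_left [simp]: "cinner 0 x = 0"
  using cinner_scaleC_left[of 0 x x] by simp

lemma cinner_minus_right [simp]: "cinner x (- y) = - cinner x y"
  using cinner_scaleC_right[of x "-1" y] by simp

lemma cinner_minus_left [simp]: "cinner (- x) y = - cinner x y"
  using cinner_scaleC_left[of "-1" x y] by simp

lemma cnj_cinner: "cnj (cinner x y) = cinner y x"
  by (metis cinner_commute)

lemma cinner_diff_right:
  fixes x :: "'h::complex_hilbert"
  shows "cinner x (y - z) = cinner x y - cinner x z"
  using cinner_add_right[of x y "- z"] by simp

lemma cinner_diff_left:
  fixes x :: "'h::complex_hilbert"
  shows "cinner (x - y) z = cinner x z - cinner y z"
  using cinner_add_left[of x "- y" z] by simp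

lemmas cinner_algebra = cinner_add_left cinner_add_right cinner_diff_left cinner_diff_right
  cinner_scaleC_left cinner_scaleC_right

lemma cinner_sum_right: "cinner x (\<Sum>i\<in>A. g i) = (\<Sum>i\<in>A. cinner x (g i :: 'h::complex_hilbert))"
  by (induction A rule: infinite_finite_induct) (simp_all add: cinner_add_right)

lemma cinner_sum_left: "cinner (\<Sum>i\<in>A. g i) x = (\<Sum>i\<in>A. cinner (g i :: 'h::complex_hilbert) x)"
  by (induction A rule: infinite_finite_induct) (simp_all add: cinner_add_left)

lemma cinner_self_eq_0: "cinner x x = 0 \<longleftrightarrow> (x :: 'h::complex_hilbert) = 0"
  by (simp add: cinner_self)

lemma norm_sq_cinner: "(norm (x :: 'h::complex_hilbert))\<^sup>2 = Re (cinner x x)"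
  by (simp add: cinner_self)

lemma norm_scaleC: "norm (c *\<^sub>C (x :: 'h::complex_hilbert)) = cmod c * norm x"
proof -
  have "complex_of_real ((norm (c *\<^sub>C x))\<^sup>2) = c * cnj c * complex_of_real ((norm x)\<^sup>2)"
    by (simp only: cinner_self[symmetric] cinner_scaleC_left cinner_scaleC_right mult_ac)
  also have "\<dots> = complex_of_real ((cmod c * norm x)\<^sup>2)"
    by (simp add: complex_norm_square[symmetric] power_mult_distrib)
  finally have "(norm (c *\<^sub>C x))\<^sup>2 = (cmod c * norm x)\<^sup>2"
    using of_real_eq_iff by blast
  then show ?thesis by simp
qed

lemma pythagoras:
  "cinner x y = 0 \<Longrightarrow> (norm (x + y :: 'h::complex_hilbert))\<^sup>2 = (norm x)\<^sup>2 + (norm y)\<^sup>2"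
  using cnj_cinner[of x y] by (simp add: norm_sq_cinner cinner_algebra)

lemma Cauchy_Schwarz: "cmod (cinner x y) \<le> norm x * norm (y :: 'h::complex_hilbert)"
proof (cases "x = 0")
  case False
  \<comment> \<open>\<open>c *\<^sub>C x\<close> is the orthogonal projection of \<open>y\<close>
    onto the line through \<open>x\<close>; the inequality says that projecting does not increase
    the norm.\<close>
  define c where "c = cinner x y / cinner x x"
  have "cinner (c *\<^sub>C x) (y - c *\<^sub>C x) = 0"
    using False by (simp add: c_def cinner_algebra cinner_self_eq_0)
  from pythagoras[OF this] have "(norm (c *\<^sub>C x))\<^sup>2 \<le> (norm y)\<^sup>2"
    by simp
  then have "cmod c * norm x \<le> norm y"
    by (simp add: norm_scaleC)
  moreover have "cmod c = cmod (cinner x y) / (norm x)\<^sup>2"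
    by (simp add: c_def cinner_self norm_divide norm_power)
  ultimately show ?thesis
    using False by (simp add: divide_simps power2_eq_square mult_ac)
qed simp

lemma bounded_bilinear_cinner: "bounded_bilinear (cinner :: 'h::complex_hilbert \<Rightarrow> 'h \<Rightarrow> complex)"
proof (unfold_locales, goal_cases)
  case 5
  show ?case
    by (rule exI[of _ 1]) (simp add: Cauchy_Schwarz)
qed (simp_all add: cinner_algebra scaleR_scaleC scaleR_conv_of_real)

lemma bounded_bilinear_scaleC:
  "bounded_bilinear (scaleC :: complex \<Rightarrow> 'h::complex_hilbert \<Rightarrow> 'h)"
proof (unfold_locales, goal_cases)
  case 5
  show ?case
    by (rule exI[of _ 1]) (simp add: norm_scaleC)
qed (simp_all add: scaleC_add_left scaleC_add_right scaleR_scaleC scaleC_scaleC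
      scaleR_conv_of_real mult.commute)

lemmas tendsto_cinner [tendsto_intros] = bounded_bilinear.tendsto[OF bounded_bilinear_cinner]
lemmas tendsto_scaleC [tendsto_intros] = bounded_bilinear.tendsto[OF bounded_bilinear_scaleC]
lemmas bounded_linear_cinner_right = bounded_bilinear.bounded_linear_right[OF bounded_bilinear_cinner]
lemmas continuous_on_cinner [continuous_intros] =
  bounded_bilinear.continuous_on[OF bounded_bilinear_cinner]
lemmas continuous_on_scaleC [continuous_intros] =
  bounded_bilinear.continuous_on[OF bounded_bilinear_scaleC]

lemma cinner_eqI: "(\<And>x. cinner x y = cinner x z) \<Longrightarrow> y = (z :: 'h::complex_hilbert)"
  using cinner_self_eq_0[of "y - z"] by (simp add: cinner_diff_right)

lemma csubspace_orthogonal: "csubspace {x :: 'h::complex_hilbert. cinner z x = 0}"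
  by (simp add: csubspace_iff cinner_algebra)

lemma orthogonal_closure_cspan:
  assumes "\<And>v. v \<in> S \<Longrightarrow> cinner z v = 0" "x \<in> closure (cspan S)"
  shows "cinner z (x :: 'h::complex_hilbert) = 0"
proof -
  have "cspan S \<subseteq> {x. cinner z x = 0}"
    by (rule cvs.span_minimal) (use assms(1) in \<open>auto simp: csubspace_orthogonal\<close>)
  moreover have "closed {x. cinner z x = 0}"
    by (intro closed_Collect_eq continuous_intros)
  ultimately show ?thesis
    using assms(2) closure_minimal by blast
qed

lemma total_imp_zero:
  assumes "closure (cspan S) = (UNIV :: 'h::complex_hilbert set)" "\<And>v. v \<in> S \<Longrightarrow> cinner v z = 0"
  shows "z = 0"
proof -
  have "cinner z v = 0" if "v \<in> S" for v
    using assms(2)[OF that] cnj_cinner[of v z] by simp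
  then have "cinner z z = 0"
    using orthogonal_closure_cspan[of S z z] assms(1) by auto
  then show ?thesis by (simp add: cinner_self_eq_0)
qed

lemma closureI_sequence:
  fixes S :: "'v::first_countable_topology set"
  assumes "\<And>n. f n \<in> S" "f \<longlonglongrightarrow> x" shows "x \<in> closure S"
  using assms unfolding closure_sequential by blast

text \<open>Continuity of scaling is a hypothesis so that the lemma covers vectors as well as
  graphs, which live in a product type.\<close>

lemma csubspace_closure_continuous:
  fixes S :: "'v::{complex_vector, real_normed_vector} set"
  assumes S: "csubspace S" and cont: "\<And>c. continuous_on UNIV (\<lambda>x::'v. c *\<^sub>C x)"
  shows "csubspace (closure S)"
  unfolding csubspace_iff
proof (intro conjI ballI allI)
  show "0 \<in> closure S" using S by (meson closure_subset csubspace_iff subsetD)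
  fix x y assume "x \<in> closure S" "y \<in> closure S"
  then obtain f g where f: "\<And>n. f n \<in> S" "f \<longlonglongrightarrow> x" and g: "\<And>n. g n \<in> S" "g \<longlonglongrightarrow> y"
    unfolding closure_sequential by metis
  show "x + y \<in> closure S"
    by (rule closureI_sequence[of "\<lambda>n. f n + g n"])
      (use f g S in \<open>auto simp: csubspace_iff intro: tendsto_add\<close>)
next
  fix c x assume "x \<in> closure S"
  moreover have "(\<lambda>x. c *\<^sub>C x) ` closure S \<subseteq> closure S"
    by (rule image_closure_subset[OF continuous_on_subset[OF cont]])
      (use S closure_subset[of S] in \<open>auto simp: csubspace_iff subset_iff\<close>)
  ultimately show "c *\<^sub>C x \<in> closure S" by blast
qed

lemma csubspace_closure: "csubspace S \<Longrightarrow> csubspace (closure (S :: 'h::complex_hilbert set))"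
  by (rule csubspace_closure_continuous, assumption) (intro continuous_intros)

lemma csubspace_closure_prod:
  "csubspace S \<Longrightarrow> csubspace (closure (S :: ('h::complex_hilbert \<times> 'k::complex_hilbert) set))"
  by (rule csubspace_closure_continuous, assumption) (auto simp: scaleC_prod_def intro!: continuous_intros)

subsection \<open>Orthonormal sets\<close>

definition orthonormal :: "'h::complex_hilbert set \<Rightarrow> bool" where
  "orthonormal S \<longleftrightarrow> (\<forall>e\<in>S. \<forall>f\<in>S. cinner e f = (if e = f then 1 else 0))"

lemma orthonormal_norm: "orthonormal S \<Longrightarrow> e \<in> S \<Longrightarrow> norm e = 1"
  using norm_sq_cinner[of e] by (simp add: orthonormal_def power2_eq_1_iff)
    (smt (verit) norm_ge_zero)

lemma cinner_orthonormal_sum: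
  assumes "orthonormal S" "finite F" "F \<subseteq> S" "e \<in> S"
  shows "cinner e (\<Sum>f\<in>F. c f *\<^sub>C f) = (if e \<in> F then c e else 0)"
proof -
  have "cinner e (\<Sum>f\<in>F. c f *\<^sub>C f) = (\<Sum>f\<in>F. if e = f then c f else 0)"
    unfolding cinner_sum_right
    by (rule sum.cong) (use assms in \<open>auto simp: cinner_algebra orthonormal_def\<close>)
  then show ?thesis using assms by (simp add: sum.delta)
qed

lemma norm_orthonormal_sum:
  assumes "orthonormal S" "finite F" "F \<subseteq> S"
  shows "(norm (\<Sum>f\<in>F. c f *\<^sub>C f))\<^sup>2 = (\<Sum>f\<in>F. (cmod (c f))\<^sup>2)"
proof -
  have "cinner (\<Sum>f\<in>F. c f *\<^sub>C f) (\<Sum>f\<in>F. c f *\<^sub>C f) = (\<Sum>f\<in>F. cnj (c f) * c f)"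
    unfolding cinner_sum_left[of _ F]
    by (rule sum.cong)
      (use assms in \<open>auto simp: cinner_scaleC_left cinner_orthonormal_sum[OF assms] subset_iff\<close>)
  also have "\<dots> = of_real (\<Sum>f\<in>F. (cmod (c f))\<^sup>2)"
    by (simp add: complex_norm_square mult.commute del: of_real_power)
  finally show ?thesis
    by (metis Re_complex_of_real norm_sq_cinner)
qed

lemma Bessel_finite:
  assumes "orthonormal S" "finite F" "F \<subseteq> S"
  shows "(\<Sum>e\<in>F. (cmod (cinner e x))\<^sup>2) \<le> (norm x)\<^sup>2"
proof -
  define y where "y = (\<Sum>e\<in>F. cinner e x *\<^sub>C e)"
  have "cinner e (x - y) = 0" if "e \<in> F" for e
    using cinner_orthonormal_sum[OF assms, of e "\<lambda>e. cinner e x"] assms that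
    by (auto simp: cinner_diff_right y_def)
  then have "cinner y (x - y) = 0"
    by (subst y_def) (simp add: cinner_sum_left cinner_scaleC_left)
  from pythagoras[OF this] show ?thesis
    using norm_orthonormal_sum[OF assms, of "\<lambda>e. cinner e x"] by (simp add: y_def)
qed

lemma Bessel_summable:
  assumes "orthonormal S" shows "(\<lambda>e. (cmod (cinner e x))\<^sup>2) summable_on S"
  by (rule nonneg_bdd_above_summable_on)
    (auto simp: bdd_above_def intro!: exI[of _ "(norm x)\<^sup>2"] Bessel_finite[OF assms])

text \<open>The index set may be uncountable, so the sum is a limit along finite subsets. Finite
  sets \<open>F n\<close> that capture the total of squares up to \<open>(1 / Suc n)\<^sup>2\<close>
  have partial sums within \<open>1 / Suc n\<close> of those of every larger finite set, by
  Pythagoras. This makes the sequence Cauchy and carries its limit over to the whole net.\<close>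

lemma Riesz_Fischer:
  fixes S :: "'h::complex_hilbert set"
  assumes S: "orthonormal S" and c: "(\<lambda>e. (cmod (c e))\<^sup>2) summable_on S"
  shows "(\<lambda>e. c e *\<^sub>C e) summable_on S"
proof -
  define a where "a = infsum (\<lambda>e. (cmod (c e))\<^sup>2) S"
  define s where "s F = (\<Sum>e\<in>F. c e *\<^sub>C e)" for F
  have "((\<lambda>e. (cmod (c e))\<^sup>2) has_sum a) S"
    using c by (simp add: a_def)
  then have "\<exists>F. finite F \<and> F \<subseteq> S \<and> dist (\<Sum>e\<in>F. (cmod (c e))\<^sup>2) a \<le> (1 / real (Suc n))\<^sup>2" for n
    by (metis has_sum_finite_approximation of_nat_0_less_iff zero_less_Suc zero_less_divide_1_iff zero_less_power)
  then obtain F where F: "\<And>n. finite (F n)" "\<And>n. F n \<subseteq> S"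
      and Fa: "\<And>n. dist (\<Sum>e\<in>F n. (cmod (c e))\<^sup>2) a \<le> (1 / real (Suc n))\<^sup>2"
    by metis
  have near: "norm (s G - s (F n)) \<le> 1 / real (Suc n)" if "finite G" "F n \<subseteq> G" "G \<subseteq> S" for G n
  proof -
    have "s G - s (F n) = s (G - F n)"
      using that by (simp add: s_def sum_diff)
    then have "(norm (s G - s (F n)))\<^sup>2 = (\<Sum>e\<in>G - F n. (cmod (c e))\<^sup>2)"
      using norm_orthonormal_sum[OF S, of "G - F n" c] that by (auto simp: s_def)
    also have "\<dots> = (\<Sum>e\<in>G. (cmod (c e))\<^sup>2) - (\<Sum>e\<in>F n. (cmod (c e))\<^sup>2)"
      using that by (simp add: sum_diff)
    also have "\<dots> \<le> a - (\<Sum>e\<in>F n. (cmod (c e))\<^sup>2)"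
      using finite_sum_le_infsum[OF c \<open>finite G\<close> \<open>G \<subseteq> S\<close>] by (simp add: a_def)
    also have "\<dots> \<le> (1 / real (Suc n))\<^sup>2"
      using Fa[of n] by (simp add: dist_real_def)
    finally show ?thesis
      by (rule power2_le_imp_le) simp
  qed
  have "Cauchy (\<lambda>n. s (F n))"
  proof (rule metric_CauchyI)
    fix e :: real assume "e > 0"
    then obtain N where N: "1 / real (Suc N) < e / 2"
      using nat_approx_posE[of "e/2"] by auto
    have small: "1 / real (Suc n) < e / 2" if "n \<ge> N" for n
      using that N by (smt (verit) Suc_le_mono divide_left_mono mult_pos_pos of_nat_0_less_iff of_nat_le_iff zero_less_Suc)
    have "dist (s (F m)) (s (F n)) < e" if "m \<ge> N" "n \<ge> N" for m n
    proof -
      have "norm (s (F m \<union> F n) - s (F m)) \<le> 1 / real (Suc m)" "norm (s (F m \<union> F n) - s (F n)) \<le> 1 / real (Suc n)"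
        by (rule near; use F in auto)+
      then show ?thesis
        using small[OF that(1)] small[OF that(2)] dist_triangle3[of "s (F m)" "s (F n)" "s (F m \<union> F n)"]
        by (simp add: dist_norm)
    qed
    then show "\<exists>M. \<forall>m\<ge>M. \<forall>n\<ge>M. dist (s (F m)) (s (F n)) < e" by blast
  qed
  then obtain x where x: "(\<lambda>n. s (F n)) \<longlonglongrightarrow> x"
    using Cauchy_convergent_iff convergent_def by blast
  have "((\<lambda>e. c e *\<^sub>C e) has_sum x) S"
    unfolding has_sum_def tendsto_iff eventually_finite_subsets_at_top
  proof (intro allI impI)
    fix e :: real assume "e > 0"
    obtain N where N: "1 / real (Suc N) < e / 2"
      using nat_approx_posE[of "e/2"] \<open>e > 0\<close> by auto
    obtain M where M: "\<And>n. n \<ge> M \<Longrightarrow> dist (s (F n)) x < e / 2"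
      using x \<open>e > 0\<close> by (metis half_gt_zero metric_LIMSEQ_D)
    define n where "n = max M N"
    have *: "1 / real (Suc n) < e / 2"
      using N by (smt (verit) n_def max.cobounded2 Suc_le_mono divide_left_mono mult_pos_pos of_nat_0_less_iff of_nat_le_iff zero_less_Suc)
    have "dist (s G) x < e" if "finite G \<and> F n \<subseteq> G \<and> G \<subseteq> S" for G
      using near[of G n] that * M[of n] dist_triangle[of "s G" x "s (F n)"] by (simp add: n_def dist_norm)
    then show "\<exists>X. finite X \<and> X \<subseteq> S \<and> (\<forall>Y. finite Y \<and> X \<subseteq> Y \<and> Y \<subseteq> S \<longrightarrow> dist (\<Sum>e\<in>Y. c e *\<^sub>C e) x < e)"
      using F by (intro exI[of _ "F n"]) (auto simp: s_def)
  qed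
  then show ?thesis by (rule has_sum_imp_summable)
qed

lemma has_sum_cinner:
  "(f has_sum x) A \<Longrightarrow> ((\<lambda>i. cinner z (f i)) has_sum cinner z (x :: 'h::complex_hilbert)) A"
  using has_sum_bounded_linear[OF bounded_linear_cinner_right] by blast

lemma cinner_orthonormal_has_sum:
  assumes S: "orthonormal S" and x: "((\<lambda>e. c e *\<^sub>C e) has_sum x) A" and "A \<subseteq> S" "e \<in> S"
  shows "cinner e x = (if e \<in> A then c e else 0)"
proof -
  have "((\<lambda>f. if f = e then c e else 0) has_sum cinner e x) A"
    by (rule has_sum_cong[THEN iffD1, OF _ has_sum_cinner[OF x, of e]])
      (use assms in \<open>auto simp: cinner_algebra orthonormal_def\<close>)
  moreover have "((\<lambda>f. if f = e then c e else 0) has_sum (if e \<in> A then c e else 0)) A"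
    by (rule has_sum_finite_neutralI[of "A \<inter> {e}"]) auto
  ultimately show ?thesis
    by (rule has_sum_unique)
qed

lemma has_sum_in_closure:
  fixes f :: "'i \<Rightarrow> 'v::{topological_comm_monoid_add,t2_space}"
  assumes "(f has_sum x) A" "\<And>F. finite F \<Longrightarrow> F \<subseteq> A \<Longrightarrow> sum f F \<in> S"
  shows "x \<in> closure S"
proof -
  have "eventually (\<lambda>F. sum f F \<in> S) (finite_subsets_at_top A)"
    using assms(2) by (intro eventually_finite_subsets_at_top_weakI) auto
  then show ?thesis
    by (intro Lim_in_closed_set[OF closed_closure _ _ assms(1)[unfolded has_sum_def]])
      (use closure_subset in \<open>auto elim!: eventually_mono\<close>)
qed

text \<open>Bessel and Riesz--Fischer supply some sum \<open>y\<close>; the difference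
  \<open>x - y\<close> is orthogonal to \<open>S\<close>, and completeness removes it.\<close>

lemma complete_orthonormal_has_sum:
  assumes S: "orthonormal S" and complete: "\<And>x. (\<And>e. e \<in> S \<Longrightarrow> cinner e x = 0) \<Longrightarrow> x = 0"
  shows "((\<lambda>e. cinner e x *\<^sub>C e) has_sum x) S"
proof -
  obtain y where y: "((\<lambda>e. cinner e x *\<^sub>C e) has_sum y) S"
    using Riesz_Fischer[OF S Bessel_summable[OF S]] summable_iff_has_sum_infsum by blast
  have "x - y = 0"
    by (rule complete) (use cinner_orthonormal_has_sum[OF S y] in \<open>simp add: cinner_diff_right\<close>)
  then show ?thesis using y by simp
qed

text \<open>Triviality of the orthogonal complement is the form in which completeness can be
  verified later. It implies density of the span through the Fourier expansion.\<close>

lemma orthonormal_basis_iff: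
  "orthonormal_basis S \<longleftrightarrow> orthonormal S \<and> (\<forall>x. (\<forall>e\<in>S. cinner e x = 0) \<longrightarrow> x = 0)"
proof
  assume "orthonormal_basis S"
  then show "orthonormal S \<and> (\<forall>x. (\<forall>e\<in>S. cinner e x = 0) \<longrightarrow> x = 0)"
    using total_imp_zero[of S] by (auto simp: orthonormal_basis_def orthonormal_def)
next
  assume *: "orthonormal S \<and> (\<forall>x. (\<forall>e\<in>S. cinner e x = 0) \<longrightarrow> x = 0)"
  then have "((\<lambda>e. cinner e x *\<^sub>C e) has_sum x) S" for x
    using complete_orthonormal_has_sum by blast
  then have "x \<in> closure (cspan S)" for x
    by (rule has_sum_in_closure[where S="cspan S"])
      (intro cvs.span_sum cvs.span_scale cvs.span_base, blast)
  with * show "orthonormal_basis S"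
    by (auto simp: orthonormal_basis_def orthonormal_def)
qed

lemma orthonormal_basis_orthonormal: "orthonormal_basis S \<Longrightarrow> orthonormal S"
  by (simp add: orthonormal_basis_iff)

lemma orthonormal_basis_eqI:
  assumes "orthonormal_basis S" "\<And>e. e \<in> S \<Longrightarrow> cinner e x = cinner e y"
  shows "x = y"
proof -
  have "x - y = 0"
    using assms unfolding orthonormal_basis_iff by (metis cinner_diff_right right_minus_eq)
  then show ?thesis by simp
qed

lemma orthonormal_basis_has_sum:
  "orthonormal_basis S \<Longrightarrow> ((\<lambda>e. cinner e x *\<^sub>C e) has_sum x) S"
  by (rule complete_orthonormal_has_sum) (auto simp: orthonormal_basis_iff)

lemma Parseval:
  assumes "orthonormal_basis S" shows "((\<lambda>e. cinner x e * cinner e y) has_sum cinner x y) S"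
  using has_sum_cinner[OF orthonormal_basis_has_sum[OF assms], of x y]
  by (simp add: cinner_scaleC_right mult.commute)

lemma Parseval_norm:
  assumes "orthonormal_basis S" shows "((\<lambda>e. (cmod (cinner e x))\<^sup>2) has_sum (norm x)\<^sup>2) S"
proof -
  have "cinner x e * cinner e x = of_real ((cmod (cinner e x))\<^sup>2)" for e
    by (metis cinner_commute complex_norm_square mult.commute)
  then show ?thesis
    using has_sum_Re[OF Parseval[OF assms, of x x]] by (simp add: cinner_self)
qed

lemma bounded_linear_closure_eq:
  fixes f g :: "'v::real_normed_vector \<Rightarrow> 'w::real_normed_vector"
  assumes "bounded_linear f" "bounded_linear g" "\<And>x. x \<in> S \<Longrightarrow> f x = g x" "x \<in> closure S"
  shows "f x = g x"
proof -
  have "closed {x. f x = g x}"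
    by (intro closed_Collect_eq linear_continuous_on assms(1,2))
  then show ?thesis
    using closure_minimal[of S "{x. f x = g x}"] assms by blast
qed

lemma bounded_clinear_eqI:
  assumes "bounded_clinear f" "bounded_clinear g" "closure (cspan S) = UNIV" "\<And>x. x \<in> S \<Longrightarrow> f x = g x"
  shows "f = g"
proof
  fix x
  have *: "f x = g x" if "x \<in> cspan S" for x
    using that
    by (induction rule: cspan_induct)
      (use assms in \<open>auto simp: bounded_clinear_def clinear_0 clinear_add clinear_scaleC\<close>)
  show "f x = g x"
    by (rule bounded_linear_closure_eq[where S="cspan S"]) (use assms * in \<open>auto simp: bounded_clinear_def\<close>)
qed

section \<open>Diagonal operators\<close>

text \<open>Nonnegativity turns iterated summability into summability over the product, where the
  order can be exchanged. This serves to carry a heat trace from one orthonormal basis to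
  another.\<close>

lemma has_sum_Tonelli:
  fixes f :: "'a \<Rightarrow> 'b \<Rightarrow> real"
  assumes f: "\<And>x. x \<in> A \<Longrightarrow> (f x has_sum g x) B" and g: "(g has_sum S) A"
    and nonneg: "\<And>x y. x \<in> A \<Longrightarrow> y \<in> B \<Longrightarrow> 0 \<le> f x y"
  shows "((\<lambda>y. infsum (\<lambda>x. f x y) A) has_sum S) B"
    and "y \<in> B \<Longrightarrow> (\<lambda>x. f x y) summable_on A"
proof -
  have sm: "(\<lambda>(x, y). f x y) summable_on A \<times> B"
    by (rule summable_on_SigmaI[where g=g]) (use assms in \<open>auto dest: has_sum_imp_summable\<close>)
  have "((\<lambda>(x, y). f x y) has_sum S) (A \<times> B)"
    by (rule has_sum_SigmaI[where g=g]) (use assms sm in auto)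
  then have sw: "((\<lambda>(y, x). f x y) has_sum S) (B \<times> A)"
    by (subst (asm) has_sum_swap) simp
  show *: "(\<lambda>x. f x y) summable_on A" if "y \<in> B" for y
    using summable_on_SigmaD1[where f="\<lambda>y x. f x y", OF has_sum_imp_summable[OF sw]] that by simp
  show "((\<lambda>y. infsum (\<lambda>x. f x y) A) has_sum S) B"
    by (rule has_sum_SigmaD[OF sw]) (use * in simp)
qed

lemma has_sum_of_realD:
  assumes "((\<lambda>i. complex_of_real (f i)) has_sum z) A"
  shows "(f has_sum Re z) A" and "z = complex_of_real (Re z)"
  using has_sum_Re[OF assms] has_sum_unique[OF has_sum_Im[OF assms], of 0] by (simp_all add: complex_eq_iff)

section \<open>Symmetric relations and orthonormal bases of eigenvectors\<close>

lemma csubspace_Domain: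
  assumes "csubspace T" shows "csubspace (Domain T)"
  unfolding csubspace_iff
proof (intro conjI ballI allI)
  show "0 \<in> Domain T"
    using cvs.subspace_0[OF assms] by (auto simp: zero_prod_def)
  show "x + y \<in> Domain T" if "x \<in> Domain T" "y \<in> Domain T" for x y
    using that cvs.subspace_add[OF assms] by fastforce
  show "c *\<^sub>C x \<in> Domain T" if "x \<in> Domain T" for c x
    using that cvs.subspace_scale[OF assms, of _ c] by fastforce
qed

text \<open>Formulated for arbitrary relations, so that it passes to subsets, spans and closures;
  single-valuedness then follows from a dense domain.\<close>

definition symmetric_op :: "'h::complex_hilbert unbounded_op \<Rightarrow> bool" where
  "symmetric_op T \<longleftrightarrow> (\<forall>(x, x') \<in> T. \<forall>(y, y') \<in> T. cinner x y' = cinner x' y)"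

lemma symmetric_opD:
  "symmetric_op T \<Longrightarrow> (x, x') \<in> T \<Longrightarrow> (y, y') \<in> T \<Longrightarrow> cinner x y' = cinner x' y"
  unfolding symmetric_op_def by blast

lemma symmetric_op_closure:
  assumes "symmetric_op T" shows "symmetric_op (closure T)"
proof -
  have 1: "cinner (fst p) (snd q) = cinner (snd p) (fst q)" if p: "p \<in> T" and q: "q \<in> closure T" for p q
  proof -
    have "closed {q. cinner (fst p) (snd q) = cinner (snd p) (fst q)}"
      by (intro closed_Collect_eq continuous_intros)
    then have "closure T \<subseteq> {q. cinner (fst p) (snd q) = cinner (snd p) (fst q)}"
      by (intro closure_minimal) (use symmetric_opD[OF assms, of "fst p" "snd p"] p in auto)
    with q show ?thesis by blast
  qed
  have "cinner (fst p) (snd q) = cinner (snd p) (fst q)" if p: "p \<in> closure T" and q: "q \<in> closure T" for p q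
  proof -
    have "closed {p. cinner (fst p) (snd q) = cinner (snd p) (fst q)}"
      by (intro closed_Collect_eq continuous_intros)
    then have "closure T \<subseteq> {p. cinner (fst p) (snd q) = cinner (snd p) (fst q)}"
      by (intro closure_minimal) (use q 1 in auto)
    with p show ?thesis by blast
  qed
  then show ?thesis unfolding symmetric_op_def by fastforce
qed

lemma self_adjoint_symmetric: "self_adjoint T \<Longrightarrow> symmetric_op T"
  unfolding symmetric_op_def self_adjoint_def adjoint_def
  by (metis (no_types, lifting) cnj_cinner case_prodD case_prodI mem_Collect_eq case_prodI2)

text \<open>Two values at one point have the same inner products with the whole dense
  domain.\<close>

lemma symmetric_op_single_valued:
  assumes "symmetric_op T" "closure (Domain T) = UNIV"
  shows "single_valued T"
proof (rule single_valuedI)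
  fix x y z assume xy: "(x, y) \<in> T" and xz: "(x, z) \<in> T"
  have "cinner v (y - z) = 0" if "v \<in> Domain T" for v
  proof -
    from that obtain v' where "(v, v') \<in> T" by blast
    then have "cinner v y = cinner v' x" "cinner v z = cinner v' x"
      using symmetric_opD[OF assms(1)] xy xz by blast+
    then show ?thesis by (simp add: cinner_diff_right)
  qed
  moreover have "closure (cspan (Domain T)) = UNIV"
    using assms(2) closure_mono[OF cvs.span_superset] by blast
  ultimately have "y - z = 0"
    using total_imp_zero by blast
  then show "y = z" by simp
qed

lemma symmetric_eigenvectors_orthogonal:
  assumes "symmetric_op T" "(v, complex_of_real r *\<^sub>C v) \<in> T" "(w, complex_of_real s *\<^sub>C w) \<in> T" "r \<noteq> s"
  shows "cinner v w = 0"
  using symmetric_opD[OF assms(1-3)] assms(4) by (simp add: cinner_algebra)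

lemma has_sum_Pair:
  assumes "(f has_sum x) A" "(g has_sum y) A"
  shows "((\<lambda>i. (f i, g i)) has_sum (x, y)) A"
proof -
  have "sum (\<lambda>i. (f i, g i)) = (\<lambda>F. (sum f F, sum g F))"
    by (rule ext) (simp add: prod_eq_iff fst_sum snd_sum)
  then show ?thesis
    using tendsto_Pair[OF assms[unfolded has_sum_def]] by (simp add: has_sum_def)
qed

lemma closed_csubspace_has_sum:
  fixes T :: "('h::complex_hilbert) unbounded_op"
  assumes "closed T" "csubspace T" "(f has_sum p) A" "\<And>i. i \<in> A \<Longrightarrow> f i \<in> T"
  shows "p \<in> T"
proof -
  have "p \<in> closure T"
    by (rule has_sum_in_closure[OF assms(3)], rule cvs.subspace_sum[OF assms(2)], rule assms(4)) blast
  then show ?thesis using assms(1) by simp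
qed

text \<open>Zorn's lemma gives a maximal orthonormal set \<open>M\<close> of eigenvectors. For an
  eigenvector \<open>v\<close> with eigenvalue \<open>r\<close>, the terms of its expansion in
  \<open>M\<close> vanish where \<open>s e \<noteq> r\<close>, so the expansion \<open>y\<close> is
  again an eigenvector for \<open>r\<close>, as \<open>T\<close> is closed. A nonzero remainder
  \<open>v - y\<close> could be normalized and added to \<open>M\<close>. Hence \<open>M\<close>
  spans all eigenvectors, and a vector orthogonal to \<open>M\<close> is orthogonal to all of
  them.\<close>

lemma exists_orthonormal_eigenbasis:
  fixes T :: "'h::complex_hilbert unbounded_op"
  assumes T: "csubspace T" "closed T" "symmetric_op T"
    and total: "\<And>w. (\<And>r v. (v, complex_of_real r *\<^sub>C v) \<in> T \<Longrightarrow> cinner v w = 0) \<Longrightarrow> w = 0"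
  obtains M s where "orthonormal_basis M" "\<And>e. e \<in> M \<Longrightarrow> (e, complex_of_real (s e) *\<^sub>C e) \<in> T"
proof -
  define \<A> where "\<A> = {M. orthonormal M \<and> (\<forall>e\<in>M. \<exists>r. (e, complex_of_real r *\<^sub>C e) \<in> T)}"
  have "\<exists>M\<in>\<A>. \<forall>X\<in>\<A>. M \<subseteq> X \<longrightarrow> X = M"
  proof (rule subset_Zorn')
    fix C assume C: "subset.chain \<A> C"
    have "cinner e f = (if e = f then 1 else 0)" if "e \<in> \<Union>C" "f \<in> \<Union>C" for e f
    proof -
      from that obtain X Y where "X \<in> C" "Y \<in> C" "e \<in> X" "f \<in> Y" by blast
      then have "\<exists>Z\<in>C. e \<in> Z \<and> f \<in> Z"
        using subset.chain_total[OF C, of X Y] by blast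
      then show ?thesis
        using C unfolding subset.chain_def \<A>_def orthonormal_def by blast
    qed
    then show "\<Union>C \<in> \<A>"
      using C by (auto simp: \<A>_def orthonormal_def subset.chain_def)
  qed
  then obtain M where M: "M \<in> \<A>" and maximal: "\<And>X. X \<in> \<A> \<Longrightarrow> M \<subseteq> X \<Longrightarrow> X = M" by blast
  then have orth: "orthonormal M" and "\<forall>e\<in>M. \<exists>r. (e, complex_of_real r *\<^sub>C e) \<in> T"
    by (auto simp: \<A>_def)
  then obtain s where s: "\<And>e. e \<in> M \<Longrightarrow> (e, complex_of_real (s e) *\<^sub>C e) \<in> T"
    by metis
  have in_span: "((\<lambda>e. cinner e v *\<^sub>C e) has_sum v) M" if v: "(v, complex_of_real r *\<^sub>C v) \<in> T" for r v
  proof -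
    obtain y where y: "((\<lambda>e. cinner e v *\<^sub>C e) has_sum y) M"
      using Riesz_Fischer[OF orth Bessel_summable[OF orth]] summable_iff_has_sum_infsum by blast
    have "((\<lambda>e. complex_of_real r *\<^sub>C (cinner e v *\<^sub>C e)) has_sum complex_of_real r *\<^sub>C y) M"
      using has_sum_bounded_linear[OF bounded_bilinear.bounded_linear_right[OF bounded_bilinear_scaleC] y] .
    then have sum: "((\<lambda>e. (cinner e v *\<^sub>C e, complex_of_real r *\<^sub>C (cinner e v *\<^sub>C e))) has_sum
        (y, complex_of_real r *\<^sub>C y)) M"
      by (rule has_sum_Pair[OF y])
    have "(y, complex_of_real r *\<^sub>C y) \<in> T"
    proof (rule closed_csubspace_has_sum[OF T(2,1) sum])
      fix e assume e: "e \<in> M"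
      show "(cinner e v *\<^sub>C e, complex_of_real r *\<^sub>C (cinner e v *\<^sub>C e)) \<in> T"
      proof (cases "r = s e")
        case True
        then show ?thesis
          using cvs.subspace_scale[OF T(1) s[OF e], of "cinner e v"] by (simp add: mult.commute)
      next
        case False
        then have "cinner e v = 0"
          using symmetric_eigenvectors_orthogonal[OF T(3) s[OF e] v] by simp
        then show ?thesis
          using cvs.subspace_0[OF T(1)] by (simp add: zero_prod_def)
      qed
    qed
    define w where "w = v - y"
    have w: "(w, complex_of_real r *\<^sub>C w) \<in> T"
      using cvs.subspace_diff[OF T(1) v \<open>(y, complex_of_real r *\<^sub>C y) \<in> T\<close>]
      by (simp add: w_def cvs.scale_right_diff_distrib)
    have w_orth: "cinner e w = 0" if "e \<in> M" for e
      using cinner_orthonormal_has_sum[OF orth y order_refl that] that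
      by (simp add: w_def cinner_diff_right)
    have "w = 0"
    proof (rule ccontr)
      assume "w \<noteq> 0"
      define u where "u = complex_of_real (1 / norm w) *\<^sub>C w"
      have "cinner u u = 1"
        using \<open>w \<noteq> 0\<close> by (simp add: u_def cinner_algebra cinner_self[of w] power2_eq_square)
      moreover have "cinner e u = 0 \<and> cinner u e = 0" if "e \<in> M" for e
        using w_orth[OF that] cnj_cinner[of e u] by (simp add: u_def cinner_algebra)
      ultimately have "orthonormal (insert u M)"
        using orth unfolding orthonormal_def by auto
      moreover have "(u, complex_of_real r *\<^sub>C u) \<in> T"
        using cvs.subspace_scale[OF T(1) w, of "complex_of_real (1 / norm w)"]
        by (simp add: u_def mult.commute)
      ultimately have "insert u M \<in> \<A>"
        using s by (auto simp: \<A>_def)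
      then have "u \<in> M"
        using maximal by blast
      then show False
        using \<open>cinner u u = 1\<close> \<open>\<And>e. e \<in> M \<Longrightarrow> cinner e u = 0 \<and> cinner u e = 0\<close> by force
    qed
    with y show ?thesis by (simp add: w_def)
  qed
  have "w = 0" if w: "\<forall>e\<in>M. cinner e w = 0" for w
  proof (rule total)
    fix r v assume v: "(v, complex_of_real r *\<^sub>C v) \<in> T"
    have "((\<lambda>e. cinner w (cinner e v *\<^sub>C e)) has_sum cinner w v) M"
      by (rule has_sum_cinner[OF in_span[OF v]])
    moreover have "cinner w (cinner e v *\<^sub>C e) = 0" if "e \<in> M" for e
      using w that cnj_cinner[of e w] by (simp add: cinner_algebra)
    ultimately have "cinner w v = 0"
      by (metis (no_types, lifting) has_sum_0 has_sum_unique)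
    then show "cinner v w = 0"
      using cnj_cinner[of w v] by simp
  qed
  then have "orthonormal_basis M"
    using orth orthonormal_basis_iff by blast
  then show ?thesis using that s by blast
qed

section \<open>Scalar measures of a spectral measure\<close>

lemma emeasure_scalar_measure:
  assumes E: "spectral_measure E" and A: "A \<in> sets borel"
  shows "emeasure (scalar_measure E x) A = ennreal ((norm (E A x))\<^sup>2)"
proof -
  have form: "cinner x (E B x) = complex_of_real ((norm (E B x))\<^sup>2)" if "B \<in> sets borel" for B
  proof -
    have P: "orthogonal_projection (E B)"
      using E that by (auto simp: spectral_measure_def)
    then have "cinner (E B x) (E B x) = cinner x ((E B \<circ> E B) x)"
      unfolding orthogonal_projection_def bounded_self_adjoint_def o_def by metis
    also have "(E B \<circ> E B) x = E B x"
      using P by (simp add: orthogonal_projection_def del: o_apply)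
    finally show ?thesis by (simp add: cinner_self)
  qed
  \<comment> \<open>\<open>measure_of\<close> falls back to the value 0 unless the prescribed set
    function is a measure, so positivity and countable additivity come before any
    computation.\<close>
  have *: "emeasure (scalar_measure E x) A = ennreal (Re (cinner x (E A x)))"
    unfolding scalar_measure_def
  proof (rule emeasure_measure_of_sigma[OF _ _ _ A])
    show "sigma_algebra UNIV (sets (borel :: real measure))"
      using sets.sigma_algebra_axioms[of "borel :: real measure"] by simp
    \<comment> \<open>The constant sequence of empty sets is disjoint, and the terms of the
      resulting convergent series are constant, hence zero.\<close>
    have "E {} x = 0"
    proof -
      have "(\<lambda>n. E {} x) sums E {} x"
        using E unfolding spectral_measure_def
        by (auto dest!: spec[of _ "\<lambda>_. {}"] simp: disjoint_family_on_def)
      then have "(\<lambda>n::nat. E {} x) \<longlonglongrightarrow> 0"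
        using sums_summable summable_LIMSEQ_zero by blast
      then show ?thesis by (simp add: LIMSEQ_const_iff)
    qed
    then show "positive (sets borel) (\<lambda>S. ennreal (Re (cinner x (E S x))))"
      by (simp add: positive_def)
    show "countably_additive (sets borel) (\<lambda>S. ennreal (Re (cinner x (E S x))))"
    proof (rule countably_additiveI)
      fix B :: "nat \<Rightarrow> real set"
      assume B: "range B \<subseteq> sets borel" "disjoint_family B"
      then have "(\<lambda>n. E (B n) x) sums E (\<Union>n. B n) x"
        using E by (auto simp: spectral_measure_def)
      then have "(\<lambda>n. Re (cinner x (E (B n) x))) sums Re (cinner x (E (\<Union>n. B n) x))"
        by (intro bounded_linear.sums[OF bounded_linear_Re]
            bounded_linear.sums[OF bounded_linear_cinner_right])
      then show "(\<Sum>n. ennreal (Re (cinner x (E (B n) x)))) = ennreal (Re (cinner x (E (\<Union>n. B n) x)))"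
        using B form by (intro sums_unique[symmetric]) (subst sums_ennreal, auto simp: subset_eq)
    qed
  qed
  then show ?thesis using form[OF A] by simp
qed

lemma sets_scalar_measure [simp]: "sets (scalar_measure E x) = sets borel"
  unfolding scalar_measure_def
  by (metis sets.sets_measure_of_eq sets.sigma_sets_eq sets.space_closed sets_measure_of space_borel)

lemma space_scalar_measure [simp]: "space (scalar_measure E x) = UNIV"
  using sets_eq_imp_space_eq[OF sets_scalar_measure] by simp

lemma finite_borel_scalar_measure:
  assumes "spectral_measure E" shows "finite_borel_measure (scalar_measure E x)"
proof (intro finite_borel_measure.intro finite_borel_measure_axioms.intro finite_measureI)
  show "emeasure (scalar_measure E x) (space (scalar_measure E x)) \<noteq> \<infinity>"
    using emeasure_scalar_measure[OF assms, of UNIV x] by simp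
qed simp

lemma measure_scalar_measure:
  assumes "spectral_measure E" "A \<in> sets borel"
  shows "measure (scalar_measure E x) A = (norm (E A x))\<^sup>2"
  using emeasure_scalar_measure[OF assms] by (simp add: measure_def)


section \<open>Multiplication operators in an orthonormal basis\<close>

lemma bounded_clinearI:
  assumes "\<And>x y. f (x + y) = f x + f y" "\<And>c x. f (c *\<^sub>C x) = c *\<^sub>C f x" "\<And>x. norm (f x) \<le> norm x * K"
  shows "bounded_clinear f"
  unfolding bounded_clinear_def clinear_iff
  using assms by (auto intro!: bounded_linear_intro[where K=K] simp: scaleR_scaleC)

text \<open>For unbounded \<open>g\<close> the series may diverge, and \<open>infsum\<close> then
  returns 0; a bound on \<open>g\<close> over \<open>M\<close> accompanies every use.\<close>

definition multiplier :: "'h::complex_hilbert set \<Rightarrow> ('h \<Rightarrow> complex) \<Rightarrow> 'h \<Rightarrow> 'h" where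
  "multiplier M g x = infsum (\<lambda>e. (g e * cinner e x) *\<^sub>C e) M"

context
  fixes M :: "'h::complex_hilbert set" and g :: "'h \<Rightarrow> complex" and K :: real
  assumes M: "orthonormal_basis M" and K: "\<And>e. e \<in> M \<Longrightarrow> cmod (g e) \<le> K"
begin

lemma multiplier_summand_le:
  "e \<in> M \<Longrightarrow> (cmod (g e * cinner e x))\<^sup>2 \<le> K\<^sup>2 * (cmod (cinner e x))\<^sup>2"
  using K by (auto simp: norm_mult power_mult_distrib intro!: mult_right_mono power_mono)

lemma multiplier_has_sum: "((\<lambda>e. (g e * cinner e x) *\<^sub>C e) has_sum multiplier M g x) M"
  unfolding multiplier_def
proof (rule has_sum_infsum, rule Riesz_Fischer)
  show "orthonormal M" using M by (rule orthonormal_basis_orthonormal)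
  show "(\<lambda>e. (cmod (g e * cinner e x))\<^sup>2) summable_on M"
    by (rule summable_on_comparison_test[OF summable_on_cmult_right[OF Bessel_summable]])
      (use M orthonormal_basis_orthonormal multiplier_summand_le in auto)
qed

lemma cinner_multiplier: "e \<in> M \<Longrightarrow> cinner e (multiplier M g x) = g e * cinner e x"
  using cinner_orthonormal_has_sum[OF orthonormal_basis_orthonormal[OF M] multiplier_has_sum order_refl]
  by simp

lemma bounded_clinear_multiplier: "bounded_clinear (multiplier M g)"
proof (rule bounded_clinearI)
  show "multiplier M g (x + y) = multiplier M g x + multiplier M g y" for x y
    by (rule orthonormal_basis_eqI[OF M]) (simp add: cinner_multiplier cinner_algebra algebra_simps)
  show "multiplier M g (c *\<^sub>C x) = c *\<^sub>C multiplier M g x" for c x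
    by (rule orthonormal_basis_eqI[OF M]) (simp add: cinner_multiplier cinner_algebra)
  fix x
  \<comment> \<open>In the trivial space the basis is empty and \<open>K\<close> may be negative;
    hence the absolute value.\<close>
  have "(norm (multiplier M g x))\<^sup>2 \<le> \<bar>K\<bar>\<^sup>2 * (norm x)\<^sup>2"
    by (rule has_sum_mono[OF Parseval_norm[OF M] has_sum_cmult_right[OF Parseval_norm[OF M]]])
      (use multiplier_summand_le cinner_multiplier in auto)
  then show "norm (multiplier M g x) \<le> norm x * \<bar>K\<bar>"
    by (simp add: power_mult_distrib[symmetric] mult.commute abs_le_square_iff[symmetric] abs_mult)
qed

lemma multiplier_self_adjoint:
  assumes "\<And>e. e \<in> M \<Longrightarrow> cnj (g e) = g e"
  shows "cinner (multiplier M g x) y = cinner x (multiplier M g y)"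
proof (rule has_sum_unique)
  show "((\<lambda>e. cinner x e * cinner e (multiplier M g y)) has_sum cinner x (multiplier M g y)) M"
    by (rule Parseval[OF M])
  have eq: "cinner (multiplier M g x) e * cinner e y = cinner x e * cinner e (multiplier M g y)" if "e \<in> M" for e
  proof -
    have "cinner (multiplier M g x) e = g e * cinner x e"
      by (metis assms cinner_multiplier cnj_cinner complex_cnj_mult that)
    then show ?thesis by (simp add: cinner_multiplier that)
  qed
  show "((\<lambda>e. cinner x e * cinner e (multiplier M g y)) has_sum cinner (multiplier M g x) y) M"
    by (rule has_sum_cong[THEN iffD1, OF eq Parseval[OF M]])
qed

end

section \<open>Spectral resolution and functional calculus of a diagonal operator\<close>

locale diagonal_operator =
  fixes T :: "'h::complex_hilbert unbounded_op" and M :: "'h set" and s :: "'h \<Rightarrow> real"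
  assumes subspace: "csubspace T" and closed: "closed T" and symmetric: "symmetric_op T"
    and basis: "orthonormal_basis M" and eigen: "e \<in> M \<Longrightarrow> (e, complex_of_real (s e) *\<^sub>C e) \<in> T"
begin

text \<open>The pair \<open>(x, y)\<close> is a sum of multiples of the eigenpairs, which lie in the
  closed subspace \<open>T\<close>. Membership in the adjoint provides exactly this hypothesis, so
  self-adjointness follows as well.\<close>

lemma mem_iff_adjoint:
  assumes "\<And>e. e \<in> M \<Longrightarrow> cinner e y = s e * cinner e x"
  shows "(x, y) \<in> T"
proof (rule closed_csubspace_has_sum[OF closed subspace])
  show "((\<lambda>e. (cinner e x *\<^sub>C e, cinner e y *\<^sub>C e)) has_sum (x, y)) M"
    by (intro has_sum_Pair orthonormal_basis_has_sum basis)
  fix e assume "e \<in> M"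
  then show "(cinner e x *\<^sub>C e, cinner e y *\<^sub>C e) \<in> T"
    using cvs.subspace_scale[OF subspace eigen, of e "cinner e x"] assms by (simp add: mult.commute)
qed

lemma mem_iff: "(x, y) \<in> T \<longleftrightarrow> (\<forall>e\<in>M. cinner e y = s e * cinner e x)"
proof
  assume "(x, y) \<in> T"
  then show "\<forall>e\<in>M. cinner e y = s e * cinner e x"
    using symmetric_opD[OF symmetric eigen] by (simp add: cinner_algebra)
qed (use mem_iff_adjoint in blast)

lemma dense_domain: "closure (Domain T) = UNIV"
proof -
  have "M \<subseteq> Domain T" using eigen by blast
  moreover have "csubspace (Domain T)"
    using subspace by (rule csubspace_Domain)
  ultimately have "cspan M \<subseteq> Domain T"
    by (rule cvs.span_minimal)
  then have "closure (cspan M) \<subseteq> closure (Domain T)"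
    by (rule closure_mono)
  then show ?thesis
    using basis by (auto simp: orthonormal_basis_def)
qed

lemma self_adjoint: "self_adjoint T"
  unfolding self_adjoint_def is_operator_def
proof (intro conjI)
  show "single_valued T"
    using symmetric dense_domain by (rule symmetric_op_single_valued)
  have "(x, y) \<in> T" if "(x, y) \<in> adjoint T" for x y
  proof (rule mem_iff_adjoint)
    fix e assume "e \<in> M"
    then have "cinner x (complex_of_real (s e) *\<^sub>C e) = cinner y e"
      using that eigen unfolding adjoint_def by blast
    then show "cinner e y = s e * cinner e x"
      by (metis cinner_commute cinner_scaleC_right complex_cnj_complex_of_real complex_cnj_mult)
  qed
  moreover have "(x, y) \<in> adjoint T" if "(x, y) \<in> T" for x y
    using that symmetric by (auto simp: adjoint_def symmetric_op_def)
  ultimately show "adjoint T = T" by auto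
qed (use subspace dense_domain in auto)

text \<open>The projection onto the closed span of the eigenvectors with eigenvalue in
  \<open>A\<close>.\<close>

definition E :: "real set \<Rightarrow> 'h \<Rightarrow> 'h" where
  "E A = multiplier M (\<lambda>e. of_bool (s e \<in> A))"

lemma cinner_E: "e \<in> M \<Longrightarrow> cinner e (E A x) = of_bool (s e \<in> A) * cinner e x"
  unfolding E_def by (rule cinner_multiplier[OF basis, of _ 1]) auto

lemma E_has_sum: "((\<lambda>e. cinner e x *\<^sub>C e) has_sum E A x) {e\<in>M. s e \<in> A}"
proof -
  have "((\<lambda>e. (of_bool (s e \<in> A) * cinner e x) *\<^sub>C e) has_sum E A x) M"
    unfolding E_def by (rule multiplier_has_sum[OF basis, of _ 1]) auto
  then show ?thesis
    by (rule has_sum_cong_neutral[THEN iffD1, rotated -1]) auto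
qed

lemma spectral_measure_E: "spectral_measure E"
  unfolding spectral_measure_def
proof (intro conjI ballI allI impI)
  show "E UNIV = id"
    by (rule ext, rule orthonormal_basis_eqI[OF basis]) (simp add: cinner_E)
  show "E (A \<inter> B) = E A \<circ> E B" for A B
    by (rule ext, rule orthonormal_basis_eqI[OF basis]) (simp add: cinner_E)
  show "orthogonal_projection (E A)" for A
    unfolding orthogonal_projection_def bounded_self_adjoint_def
  proof (intro conjI allI)
    show "bounded_clinear (E A)"
      unfolding E_def by (rule bounded_clinear_multiplier[OF basis, of _ 1]) auto
    show "cinner (E A x) y = cinner x (E A y)" for x y
      unfolding E_def by (rule multiplier_self_adjoint[OF basis, of _ 1]) auto
    show "E A \<circ> E A = E A"
      by (rule ext, rule orthonormal_basis_eqI[OF basis]) (simp add: cinner_E)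
  qed
  fix A :: "nat \<Rightarrow> real set" and x :: 'h
  assume "disjoint_family A"
  \<comment> \<open>Countable additivity is a regrouping: a basis vector with eigenvalue in the
    union belongs to exactly one \<open>A n\<close>, so the expansion over the union is a sum over
    pairs \<open>(n, e)\<close>.\<close>
  have inj: "inj_on snd (SIGMA n:UNIV. {e\<in>M. s e \<in> A n})"
    using \<open>disjoint_family A\<close> by (auto simp: inj_on_def disjoint_family_on_def)
  have image: "snd ` (SIGMA n:UNIV. {e\<in>M. s e \<in> A n}) = {e\<in>M. s e \<in> (\<Union>n. A n)}"
    by force
  have "((\<lambda>e. cinner e x *\<^sub>C e) has_sum E (\<Union>n. A n) x) (snd ` (SIGMA n:UNIV. {e\<in>M. s e \<in> A n}))"
    unfolding image by (rule E_has_sum)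
  then have "((\<lambda>p. cinner (snd p) x *\<^sub>C snd p) has_sum E (\<Union>n. A n) x) (SIGMA n:UNIV. {e\<in>M. s e \<in> A n})"
    by (subst (asm) has_sum_reindex[OF inj]) (simp add: o_def)
  then have "((\<lambda>n. E (A n) x) has_sum E (\<Union>n. A n) x) UNIV"
    by (rule has_sum_SigmaD) (simp add: E_has_sum)
  then show "(\<lambda>n. E (A n) x) sums E (\<Union>n. A n) x"
    by (rule has_sum_imp_sums)
qed

text \<open>Parseval for \<open>E A x\<close> exhibits the scalar measure as the image under
  \<open>s\<close> of the Fourier weights of \<open>x\<close>. Integrals against it thereby become
  sums over \<open>M\<close>.\<close>

lemma scalar_measure_E:
  "scalar_measure E x = distr (density (count_space M) (\<lambda>e. ennreal ((cmod (cinner e x))\<^sup>2))) borel s"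
proof (rule measure_eqI)
  fix A assume "A \<in> sets (scalar_measure E x)"
  then have A: "A \<in> sets borel" by simp
  have "(\<lambda>e. (cmod (cinner e (E A x)))\<^sup>2) summable_on M"
    using Parseval_norm[OF basis] has_sum_imp_summable by blast
  then have sm: "Infinite_Set_Sum.abs_summable_on (\<lambda>e. (cmod (cinner e (E A x)))\<^sup>2) M"
    by (simp add: abs_summable_equivalent[symmetric])
  have "emeasure (distr (density (count_space M) (\<lambda>e. ennreal ((cmod (cinner e x))\<^sup>2))) borel s) A
      = (\<integral>\<^sup>+ e. ennreal ((cmod (cinner e x))\<^sup>2) * indicator (s -` A \<inter> M) e \<partial>count_space M)"
    using A by (simp add: emeasure_distr emeasure_density)
  also have "\<dots> = (\<integral>\<^sup>+ e. ennreal ((cmod (cinner e (E A x)))\<^sup>2) \<partial>count_space M)"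
    by (intro nn_integral_cong) (simp add: cinner_E indicator_def)
  also have "\<dots> = ennreal (infsum (\<lambda>e. (cmod (cinner e (E A x)))\<^sup>2) M)"
    using sm by (simp add: nn_integral_conv_infsetsum infsetsum_infsum)
  also have "\<dots> = ennreal ((norm (E A x))\<^sup>2)"
    using infsumI[OF Parseval_norm[OF basis]] by simp
  finally show "emeasure (scalar_measure E x) A =
      emeasure (distr (density (count_space M) (\<lambda>e. ennreal ((cmod (cinner e x))\<^sup>2))) borel s) A"
    by (simp add: emeasure_scalar_measure[OF spectral_measure_E A])
qed simp

lemma integrable_scalar_measure_E:
  fixes g :: "real \<Rightarrow> real"
  assumes [measurable]: "g \<in> borel_measurable borel"
  shows "integrable (scalar_measure E x) g \<longleftrightarrow> (\<lambda>e. (cmod (cinner e x))\<^sup>2 * g (s e)) summable_on M"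
    and "integral\<^sup>L (scalar_measure E x) g = infsetsum (\<lambda>e. (cmod (cinner e x))\<^sup>2 * g (s e)) M"
proof -
  have "integrable (scalar_measure E x) g \<longleftrightarrow> Infinite_Set_Sum.abs_summable_on (\<lambda>e. (cmod (cinner e x))\<^sup>2 * g (s e)) M"
    by (simp add: scalar_measure_E integrable_distr_eq integrable_density abs_summable_on_def)
  then show "integrable (scalar_measure E x) g \<longleftrightarrow> (\<lambda>e. (cmod (cinner e x))\<^sup>2 * g (s e)) summable_on M"
    by (simp only: abs_summable_equivalent[symmetric] summable_on_iff_abs_summable_on_real[symmetric])
  show "integral\<^sup>L (scalar_measure E x) g = infsetsum (\<lambda>e. (cmod (cinner e x))\<^sup>2 * g (s e)) M"
    by (simp add: scalar_measure_E integral_distr integral_density infsetsum_def)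
qed

lemma integral_scalar_measure_E:
  fixes g :: "real \<Rightarrow> real"
  assumes "g \<in> borel_measurable borel" "((\<lambda>e. (cmod (cinner e x))\<^sup>2 * g (s e)) has_sum S) M"
  shows "integral\<^sup>L (scalar_measure E x) g = S"
proof -
  have "Infinite_Set_Sum.abs_summable_on (\<lambda>e. (cmod (cinner e x))\<^sup>2 * g (s e)) M"
    using has_sum_imp_summable[OF assms(2)]
    by (simp only: abs_summable_equivalent[symmetric] summable_on_iff_abs_summable_on_real[symmetric])
  then show ?thesis
    using integrable_scalar_measure_E(2)[OF assms(1)] infsumI[OF assms(2)] by (simp add: infsetsum_infsum)
qed

text \<open>Square integrability of the identity means that the coefficients
  \<open>s e * cinner e x\<close> are square summable; Riesz--Fischer then constructs the value of
  \<open>T\<close> at \<open>x\<close>.\<close>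

lemma spectral_resolution_E: "spectral_resolution T E"
  unfolding spectral_resolution_def
proof (intro conjI)
  show "spectral_measure E" by (rule spectral_measure_E)
  have sq: "(cmod (complex_of_real (s e) * cinner e x))\<^sup>2 = (cmod (cinner e x))\<^sup>2 * (s e)\<^sup>2" for e x
    by (simp add: norm_mult power_mult_distrib)
  show "Domain T = {x. integrable (scalar_measure E x) (\<lambda>r. r\<^sup>2)}"
  proof (intro set_eqI iffI)
    fix x assume "x \<in> Domain T"
    then obtain y where y: "(x, y) \<in> T" by blast
    have "(\<lambda>e. (cmod (cinner e x))\<^sup>2 * (s e)\<^sup>2) summable_on M"
      using has_sum_imp_summable[OF Parseval_norm[OF basis, of y]] y
      by (subst summable_on_cong[where g="\<lambda>e. (cmod (cinner e y))\<^sup>2"]) (simp_all add: mem_iff sq)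
    then show "x \<in> {x. integrable (scalar_measure E x) (\<lambda>r. r\<^sup>2)}"
      by (simp add: integrable_scalar_measure_E)
  next
    fix x assume "x \<in> {x. integrable (scalar_measure E x) (\<lambda>r. r\<^sup>2)}"
    then have "(\<lambda>e. (cmod (complex_of_real (s e) * cinner e x))\<^sup>2) summable_on M"
      by (simp add: integrable_scalar_measure_E sq)
    from Riesz_Fischer[OF orthonormal_basis_orthonormal[OF basis] this]
    obtain y where y: "((\<lambda>e. (complex_of_real (s e) * cinner e x) *\<^sub>C e) has_sum y) M"
      using summable_iff_has_sum_infsum by blast
    have "(x, y) \<in> T"
      unfolding mem_iff
      using cinner_orthonormal_has_sum[OF orthonormal_basis_orthonormal[OF basis] y order_refl] by simp
    then show "x \<in> Domain T" by blast
  qed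
  show "\<forall>(x, y)\<in>T. cinner x y = complex_of_real (\<integral>r. r \<partial>scalar_measure E x)"
  proof safe
    fix x y assume xy: "(x, y) \<in> T"
    have eq: "cinner x e * cinner e y = complex_of_real ((cmod (cinner e x))\<^sup>2 * s e)" if "e \<in> M" for e
      using xy that cnj_cinner[of e x] complex_norm_square[of "cinner e x"]
      by (simp add: mem_iff mult_ac)
    have sum: "((\<lambda>e. complex_of_real ((cmod (cinner e x))\<^sup>2 * s e)) has_sum cinner x y) M"
      by (rule has_sum_cong[THEN iffD1, OF eq Parseval[OF basis]])
    then have "(\<integral>r. r \<partial>scalar_measure E x) = Re (cinner x y)"
      by (intro integral_scalar_measure_E has_sum_of_realD(1)) auto
    then show "cinner x y = complex_of_real (\<integral>r. r \<partial>scalar_measure E x)"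
      using has_sum_of_realD(2)[OF sum] by simp
  qed
qed

text \<open>Since \<open>f\<close> is nonnegative, the multiplication operator by
  \<open>f (s e)\<close> is positive and its own absolute value, and its trace in the basis
  \<open>M\<close> is the given sum.\<close>

lemma trace_class_heat:
  fixes f :: "real \<Rightarrow> real"
  assumes f: "f \<in> borel_measurable borel" "\<And>r. 0 \<le> f r" "\<And>r. f r \<le> K"
    and summable: "(\<lambda>e. f (s e)) summable_on M"
  shows "\<exists>B. is_functional_calculus T f B \<and> trace_class B"
proof -
  define B where "B = multiplier M (\<lambda>e. complex_of_real (f (s e)))"
  have K: "cmod (complex_of_real (f (s e))) \<le> K" for e
    using f(2,3) by simp
  have B: "bounded_clinear B"
    unfolding B_def by (rule bounded_clinear_multiplier[OF basis K])
  have cinner_B: "cinner e (B x) = f (s e) * cinner e x" if "e \<in> M" for e x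
    unfolding B_def using that by (rule cinner_multiplier[OF basis K])
  have sym: "cinner (B x) y = cinner x (B y)" for x y
    unfolding B_def by (rule multiplier_self_adjoint[OF basis K]) auto
  have form: "cinner x (B x) = complex_of_real (\<integral>r. f r \<partial>scalar_measure E x)" for x
  proof -
    have eq: "cinner x e * cinner e (B x) = complex_of_real ((cmod (cinner e x))\<^sup>2 * f (s e))" if "e \<in> M" for e
      using that cnj_cinner[of e x] complex_norm_square[of "cinner e x"]
      by (simp add: cinner_B mult_ac)
    have sum: "((\<lambda>e. complex_of_real ((cmod (cinner e x))\<^sup>2 * f (s e))) has_sum cinner x (B x)) M"
      by (rule has_sum_cong[THEN iffD1, OF eq Parseval[OF basis]])
    then have "(\<integral>r. f r \<partial>scalar_measure E x) = Re (cinner x (B x))"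
      by (intro integral_scalar_measure_E f has_sum_of_realD(1))
    then show ?thesis
      using has_sum_of_realD(2)[OF sum] by simp
  qed
  have "is_functional_calculus T f B"
    unfolding is_functional_calculus_def using B spectral_resolution_E form by blast
  moreover have "is_absolute_value B B"
    unfolding is_absolute_value_def positive_operator_def bounded_self_adjoint_def
    using B sym form f(2) by simp
  moreover have "(\<lambda>e. Re (cinner e (B e))) summable_on M"
  proof -
    have "Re (cinner e (B e)) = f (s e)" if "e \<in> M" for e
      using that basis by (simp add: cinner_B orthonormal_basis_def)
    then show ?thesis using summable summable_on_cong by force
  qed
  ultimately show ?thesis
    using B basis unfolding trace_class_def by blast
qed

end

section \<open>Operators with trace class heat semigroup\<close>

lemma spectral_measure_projection: "spectral_measure E \<Longrightarrow> A \<in> sets borel \<Longrightarrow> orthogonal_projection (E A)"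
  by (simp add: spectral_measure_def)

lemma spectral_measure_Int:
  assumes "spectral_measure E" "A \<in> sets borel" "B \<in> sets borel"
  shows "E A (E B x) = E (A \<inter> B) x"
  using assms unfolding spectral_measure_def by (metis comp_apply)

lemma spectral_measure_symmetric:
  assumes "spectral_measure E" "A \<in> sets borel"
  shows "cinner (E A x) y = cinner x (E A y)"
  using spectral_measure_projection[OF assms]
  unfolding orthogonal_projection_def bounded_self_adjoint_def by blast

lemma spectral_measure_clinear:
  assumes "spectral_measure E" "A \<in> sets borel"
  shows "clinear (E A)"
  using spectral_measure_projection[OF assms]
  unfolding orthogonal_projection_def bounded_self_adjoint_def bounded_clinear_def by blast

lemma spectral_measure_empty:
  assumes "spectral_measure E" shows "E {} x = 0"
proof -
  have "emeasure (scalar_measure E x) {} = 0" by simp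
  then show ?thesis
    using emeasure_scalar_measure[OF assms, of "{}" x] by simp
qed

lemma borel_measurable_scalar_measure [simp]:
  "borel_measurable (scalar_measure E x) = borel_measurable borel"
  by (rule measurable_cong_sets) simp_all

lemma scalar_measure_projection:
  assumes "spectral_measure E" "A \<in> sets borel"
  shows "scalar_measure E (E A x) = density (scalar_measure E x) (\<lambda>s. ennreal (indicator A s))"
proof (rule measure_eqI)
  fix B assume "B \<in> sets (scalar_measure E (E A x))"
  then have B: "B \<in> sets borel" by simp
  then show "emeasure (scalar_measure E (E A x)) B = emeasure (density (scalar_measure E x) (\<lambda>s. ennreal (indicator A s))) B"
    using assms emeasure_restricted[of A "scalar_measure E x" B]
    by (simp add: emeasure_scalar_measure spectral_measure_Int Int_commute ennreal_indicator)
qed simp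

lemma norm_add_scaleC_sq:
  "(norm (x + c *\<^sub>C y))\<^sup>2 = (norm x)\<^sup>2 + 2 * Re (c * cinner x y) + (cmod c)\<^sup>2 * (norm y)\<^sup>2"
proof -
  have "cinner y x = cnj (cinner x y)" by (simp add: cnj_cinner)
  moreover have "cinner y y = complex_of_real ((norm y)\<^sup>2)" by (rule cinner_self)
  ultimately show ?thesis
    by (simp add: norm_sq_cinner[of "x + _"] norm_sq_cinner[of x] cinner_algebra)
      (simp only: cmod_power2, simp add: power2_eq_square algebra_simps)
qed

text \<open>A spectral resolution determines \<open>T\<close> only through its domain and its
  quadratic form. The scalar measure of \<open>x\<close> sits at the point \<open>r\<close>, which
  puts \<open>x\<close> into the domain; the value of \<open>T\<close> there is then extracted by
  polarizing against an arbitrary \<open>y\<close> in the domain.\<close>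

lemma spectral_resolution_eigenvector:
  assumes T: "csubspace T" "symmetric_op T" "closure (Domain T) = UNIV"
    and E: "spectral_resolution T E" and x: "E {r} x = x"
  shows "(x, complex_of_real r *\<^sub>C x) \<in> T"
proof -
  have sp: "spectral_measure E" and dom: "\<And>y. y \<in> Domain T \<longleftrightarrow> integrable (scalar_measure E y) (\<lambda>s. s\<^sup>2)"
    and form: "\<And>y y'. (y, y') \<in> T \<Longrightarrow> cinner y y' = complex_of_real (\<integral>s. s \<partial>scalar_measure E y)"
    using E unfolding spectral_resolution_def by (blast, blast, blast)
  interpret finite_borel_measure "scalar_measure E y" for y
    by (rule finite_borel_scalar_measure[OF sp])
  have "integrable (scalar_measure E x) (\<lambda>s. s\<^sup>2)"
  proof -
    have "integrable (scalar_measure E x) (\<lambda>s. indicator {r} s *\<^sub>R s\<^sup>2)"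
    proof (rule integrable_const_bound[where B="r\<^sup>2"])
      show "(\<lambda>s. indicator {r} s *\<^sub>R s\<^sup>2) \<in> borel_measurable (scalar_measure E x)"
        unfolding borel_measurable_scalar_measure by measurable
    qed (auto simp: indicator_def)
    then have "integrable (scalar_measure E (E {r} x)) (\<lambda>s. s\<^sup>2)"
      by (subst scalar_measure_projection[OF sp]) (simp, subst integrable_density, auto)
    then show ?thesis by (simp add: x)
  qed
  then obtain x' where x': "(x, x') \<in> T"
    using dom by blast
  \<comment> \<open>\<open>h (E (-{r}) y)\<close> is the contribution to the form at
    \<open>y\<close> from outside \<open>{r}\<close>.\<close>
  define h where "h z = (\<integral>s. s \<partial>scalar_measure E z)" for z
  have split: "Re (cinner y y') = r * (norm (E {r} y))\<^sup>2 + h (E (-{r}) y)" if y: "(y, y') \<in> T" for y y'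
  proof -
    have "integrable (scalar_measure E y) (\<lambda>s. s\<^sup>2)"
      using y dom by blast
    then have int: "integrable (scalar_measure E y) (\<lambda>s. s)"
      by (rule square_integrable_imp_integrable[rotated]) simp
    have "Re (cinner y y') = (\<integral>s. s \<partial>scalar_measure E y)"
      using form[OF y] by simp
    also have "\<dots> = (\<integral>s. r * indicator {r} s + indicator (-{r}) s *\<^sub>R s \<partial>scalar_measure E y)"
      by (rule Bochner_Integration.integral_cong) (auto simp: indicator_def)
    also have "\<dots> = (\<integral>s. r * indicator {r} s \<partial>scalar_measure E y) + (\<integral>s. indicator (-{r}) s *\<^sub>R s \<partial>scalar_measure E y)"
      by (rule Bochner_Integration.integral_add[OF _ integrable_mult_indicator[OF _ int]])
        (auto intro!: integrable_mult_right simp: emeasure_eq_measure)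
    also have "(\<integral>s. r * indicator {r} s \<partial>scalar_measure E y) = r * (norm (E {r} y))\<^sup>2"
      using measure_scalar_measure[OF sp, of "{r}" y] by simp
    also have "(\<integral>s. indicator (-{r}) s *\<^sub>R s \<partial>scalar_measure E y) = h (E (-{r}) y)"
      unfolding h_def
      by (subst scalar_measure_projection[OF sp]) (simp, subst integral_density, auto)
    finally show ?thesis .
  qed
  have inner: "cinner y x' = r * cinner y x" if y: "(y, y') \<in> T" for y y'
  proof -
    have val: "Re (c * cinner y x') = r * Re (c * cinner y x)" for c
    proof -
      \<comment> \<open>The \<open>h\<close> term does not depend on \<open>c\<close>, because
        \<open>E (-{r}) x = 0\<close>. Subtracting the identities for \<open>c\<close> and
        \<open>- c\<close> therefore leaves only what is linear in \<open>c\<close>.\<close>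
      have *: "Re (cinner (y + c *\<^sub>C x) (y' + c *\<^sub>C x')) = r * (norm (E {r} y + c *\<^sub>C x))\<^sup>2 + h (E (-{r}) y)" for c
      proof -
        have "E (-{r}) x = 0"
          by (subst x[symmetric]) (simp add: spectral_measure_Int[OF sp] spectral_measure_empty[OF sp])
        then have "E (-{r}) (y + c *\<^sub>C x) = E (-{r}) y" "E {r} (y + c *\<^sub>C x) = E {r} y + c *\<^sub>C x"
          using spectral_measure_clinear[OF sp] x by (simp_all add: clinear_add clinear_scaleC)
        moreover have "(y + c *\<^sub>C x, y' + c *\<^sub>C x') \<in> T"
          using cvs.subspace_add[OF T(1) y cvs.subspace_scale[OF T(1) x']] by simp
        ultimately show ?thesis
          using split by metis
      qed
      have "cinner (E {r} y) x = cinner y x"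
        using spectral_measure_symmetric[OF sp] x by simp
      then have R: "(norm (E {r} y + c *\<^sub>C x))\<^sup>2 - (norm (E {r} y + (-c) *\<^sub>C x))\<^sup>2 = 4 * Re (c * cinner y x)"
        unfolding norm_add_scaleC_sq by simp
      have xy: "cinner x y' = cnj (cinner y x')"
        using symmetric_opD[OF T(2) x' y] by (simp add: cnj_cinner)
      have "Re (cinner (y + c *\<^sub>C x) (y' + c *\<^sub>C x')) - Re (cinner (y + (-c) *\<^sub>C x) (y' + (-c) *\<^sub>C x'))
          = 4 * Re (c * cinner y x')"
        by (simp add: cinner_algebra xy) (simp add: algebra_simps)
      then have "4 * Re (c * cinner y x') =
          r * ((norm (E {r} y + c *\<^sub>C x))\<^sup>2 - (norm (E {r} y + (-c) *\<^sub>C x))\<^sup>2)"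
        unfolding *[of c] *[of "-c"] by (simp only: right_diff_distrib)
      then show ?thesis
        unfolding R by linarith
    qed
    \<comment> \<open>\<open>c = 1\<close> and \<open>c = \<i>\<close> give the real and the
      imaginary part.\<close>
    show ?thesis
      using val[of 1] val[of \<i>] by (simp add: complex_eq_iff)
  qed
  have "x' - complex_of_real r *\<^sub>C x = 0"
  proof (rule total_imp_zero)
    show "closure (cspan (Domain T)) = UNIV"
      using T(3) closure_mono[OF cvs.span_superset] by blast
    show "cinner y (x' - complex_of_real r *\<^sub>C x) = 0" if "y \<in> Domain T" for y
      using that inner by (auto simp: cinner_algebra)
  qed
  with x' show ?thesis by simp
qed

text \<open>The scalar measure of \<open>y\<close> lives on \<open>A\<close>, where \<open>f\<close>
  is at least \<open>c\<close>; so the form at \<open>y\<close> is at least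
  \<open>c * (norm y)\<^sup>2\<close>, and Cauchy--Schwarz turns this into a bound on
  \<open>B y\<close>.\<close>

lemma spectral_lower_bound:
  assumes sp: "spectral_measure E" and A: "A \<in> sets borel" "E A y = y"
    and f: "f \<in> borel_measurable borel" "\<And>s. 0 \<le> f s" "\<And>s. f s \<le> K" "\<And>s. s \<in> A \<Longrightarrow> c \<le> f s"
    and B: "cinner y (B y) = complex_of_real (\<integral>s. f s \<partial>scalar_measure E y)"
  shows "c * norm y \<le> norm (B y)"
proof -
  interpret finite_borel_measure "scalar_measure E y"
    by (rule finite_borel_scalar_measure[OF sp])
  have "c * (norm y)\<^sup>2 = (\<integral>s. c * indicator A s \<partial>scalar_measure E y)"
    using measure_scalar_measure[OF sp A(1), of y] A by simp
  also have "\<dots> \<le> (\<integral>s. f s \<partial>scalar_measure E y)"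
  proof (rule integral_mono)
    show "integrable (scalar_measure E y) (\<lambda>s. c * indicator A s)"
      using A by (auto intro!: integrable_mult_right simp: emeasure_eq_measure)
    show "integrable (scalar_measure E y) f"
      by (rule integrable_const_bound[where B=K]) (use f in auto)
    show "c * indicator A s \<le> f s" for s
      using f by (simp add: indicator_def)
  qed
  also have "\<dots> \<le> norm y * norm (B y)"
    using Cauchy_Schwarz[of y "B y"] B abs_ge_self[of "\<integral>s. f s \<partial>scalar_measure E y"] by simp
  finally have "norm y * (c * norm y) \<le> norm y * norm (B y)"
    by (simp add: power2_eq_square mult_ac)
  then show ?thesis
    by (cases "norm y = 0") (use mult_le_cancel_left_pos[of "norm y"] in auto)
qed

text \<open>Positivity of the form at \<open>x - P x / K\<close>, where \<open>K\<close> bounds the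
  norm of \<open>P\<close>. With this step length the quadratic term cancels at most half of the
  linear one. The inequality takes the place of an argument with the square root of
  \<open>P\<close>.\<close>

lemma positive_operator_norm_sq:
  assumes P: "positive_operator P"
  obtains K where "\<And>x. (norm (P x))\<^sup>2 \<le> K * Re (cinner x (P x))"
proof -
  have sym: "\<And>x y. cinner (P x) y = cinner x (P y)" and lin: "clinear P" and bl: "bounded_linear P"
    and pos: "\<And>x. 0 \<le> Re (cinner x (P x))"
    using P unfolding positive_operator_def bounded_self_adjoint_def bounded_clinear_def by blast+
  obtain K where K: "K > 0" "\<And>x. norm (P x) \<le> norm x * K"
    using bounded_linear.pos_bounded[OF bl] by blast
  have "(norm (P x))\<^sup>2 \<le> K * Re (cinner x (P x))" for x
  proof -
    define t where "t = complex_of_real (1 / K)"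
    have "cinner (x - t *\<^sub>C P x) (P (x - t *\<^sub>C P x))
        = cinner x (P x) - 2 * t * cinner (P x) (P x) + t * t * cinner (P x) (P (P x))"
      by (simp add: clinear_diff[OF lin] clinear_scaleC[OF lin] cinner_algebra sym t_def diff_divide_distrib)
    then have "0 \<le> Re (cinner x (P x)) - 2 / K * (norm (P x))\<^sup>2 + 1 / K\<^sup>2 * Re (cinner (P x) (P (P x)))"
      using pos[of "x - t *\<^sub>C P x"] by (simp add: cinner_self t_def power2_eq_square)
    also have "Re (cinner (P x) (P (P x))) \<le> norm (P x) * (norm (P x) * K)"
      using complex_Re_le_cmod[of "cinner (P x) (P (P x))"] Cauchy_Schwarz[of "P x" "P (P x)"]
        mult_left_mono[OF K(2)[of "P x"], of "norm (P x)"] by simp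
    then have "1 / K\<^sup>2 * Re (cinner (P x) (P (P x))) \<le> 1 / K * (norm (P x))\<^sup>2"
      using K(1) by (simp add: field_simps power2_eq_square)
    finally have "(norm (P x))\<^sup>2 / K \<le> Re (cinner x (P x))"
      by simp
    then show ?thesis
      using K(1) by (simp add: field_simps)
  qed
  then show ?thesis using that by blast
qed

text \<open>\<open>B e\<close> and \<open>P e\<close> have equal norms, and positivity bounds their
  square by a multiple of the trace summand. Sums of squared norms are what can be compared with
  other orthonormal systems.\<close>

lemma trace_class_Hilbert_Schmidt:
  assumes "trace_class B"
  obtains S where "orthonormal_basis S" "(\<lambda>e. (norm (B e))\<^sup>2) summable_on S"
proof -
  obtain P S where P: "is_absolute_value P B" and S: "orthonormal_basis S"
    and sm: "(\<lambda>e. Re (cinner e (P e))) summable_on S"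
    using assms unfolding trace_class_def by blast
  have pos: "positive_operator P" and "\<And>x y. cinner x (P (P y)) = cinner (B x) (B y)"
    using P unfolding is_absolute_value_def by blast+
  then have "cinner (P x) (P x) = cinner (B x) (B x)" for x
    unfolding positive_operator_def bounded_self_adjoint_def by metis
  then have eq: "(norm (B x))\<^sup>2 = (norm (P x))\<^sup>2" for x
    by (simp add: norm_sq_cinner)
  obtain K where K: "\<And>x. (norm (P x))\<^sup>2 \<le> K * Re (cinner x (P x))"
    using positive_operator_norm_sq[OF pos] by blast
  have "(\<lambda>e. (norm (B e))\<^sup>2) summable_on S"
    by (rule summable_on_comparison_test[OF summable_on_cmult_right[OF sm, of K]]) (use K eq in auto)
  with S show ?thesis using that by blast
qed

text \<open>Expand every \<open>B u\<close> in the basis \<open>S\<close>, move \<open>B\<close>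
  onto the basis vector by symmetry, and apply Bessel's inequality for \<open>F\<close> to each
  \<open>B e\<close>.\<close>

lemma Hilbert_Schmidt_bound:
  assumes S: "orthonormal_basis S" "(\<lambda>e. (norm (B e))\<^sup>2) summable_on S"
    and sym: "\<And>x y. cinner (B x) y = cinner x (B y)"
    and F: "orthonormal F" "finite F"
  shows "(\<Sum>u\<in>F. (norm (B u))\<^sup>2) \<le> infsum (\<lambda>e. (norm (B e))\<^sup>2) S"
proof -
  have "((\<lambda>e. \<Sum>u\<in>G. (cmod (cinner e (B u)))\<^sup>2) has_sum (\<Sum>u\<in>G. (norm (B u))\<^sup>2)) S" if "finite G" for G
    using that by induction (auto intro: has_sum_add Parseval_norm[OF S(1)])
  from this[OF F(2)] show ?thesis
  proof (rule has_sum_mono)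
    show "((\<lambda>e. (norm (B e))\<^sup>2) has_sum infsum (\<lambda>e. (norm (B e))\<^sup>2) S) S"
      using S(2) by simp
    fix e assume "e \<in> S"
    have "(cmod (cinner e (B u)))\<^sup>2 = (cmod (cinner u (B e)))\<^sup>2" for u
      by (metis cnj_cinner complex_mod_cnj sym)
    then show "(\<Sum>u\<in>F. (cmod (cinner e (B u)))\<^sup>2) \<le> (norm (B e))\<^sup>2"
      using Bessel_finite[OF F(1,2) order_refl, of "B e"] by simp
  qed
qed

text \<open>Polarization at \<open>c = 1\<close> and \<open>c = \<i>\<close>. The functional
  calculus specifies a heat operator only through a real quadratic form, and its symmetry is
  recovered here.\<close>

lemma real_form_symmetric:
  assumes "clinear B" and real: "\<And>x. cinner x (B x) \<in> \<real>"
  shows "cinner (B x) y = cinner x (B y)"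
proof -
  have "Im (c * cinner x (B y) + cnj c * cinner y (B x)) = 0" for c
  proof -
    have "Im (cinner (x + c *\<^sub>C y) (B (x + c *\<^sub>C y))) = 0"
      using real complex_is_Real_iff by blast
    moreover have "Im (cinner x (B x)) = 0" "Im (cinner y (B y)) = 0"
      using real complex_is_Real_iff by blast+
    ultimately show ?thesis
      by (simp add: clinear_add[OF assms(1)] clinear_scaleC[OF assms(1)] cinner_algebra)
        (simp add: algebra_simps)
  qed
  from this[of 1] this[of \<i>] have "cinner x (B y) = cnj (cinner y (B x))"
    by (simp add: complex_eq_iff)
  then show ?thesis by (simp add: cnj_cinner)
qed

lemma power2_mono_neg: "p \<le> s \<Longrightarrow> s \<le> 0 \<Longrightarrow> s\<^sup>2 \<le> (p::real)\<^sup>2"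
  by (simp add: abs_le_square_iff[symmetric])

text \<open>A vector orthogonal to all eigenvectors has an atomless scalar measure, so that a bounded
  interval splits into any number of pieces of positive measure. These give
  orthonormal systems of any size on which \<open>B\<close> is bounded below, although \<open>B\<close> is Hilbert--Schmidt.\<close>

lemma heat_operator_eigenvectors_total:
  fixes w :: "'h::complex_hilbert"
  assumes sp: "spectral_measure E" and B: "trace_class B"
    and form: "\<And>x. cinner x (B x) = complex_of_real (\<integral>s. exp (- \<epsilon> * s\<^sup>2) \<partial>scalar_measure E x)"
    and "\<epsilon> > 0" and w: "\<And>r. E {r} w = 0"
  shows "w = 0"
proof (rule ccontr)
  assume "w \<noteq> 0"
  interpret finite_borel_measure "scalar_measure E w"
    by (rule finite_borel_scalar_measure[OF sp])
  define F where "F = cdf (scalar_measure E w)"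
  have mono: "mono F"
    unfolding F_def by (rule monoI) (rule cdf_nondecreasing)
  have "isCont F r" for r
    unfolding F_def isCont_cdf using measure_scalar_measure[OF sp, of "{r}" w] w by simp
  then have cont: "continuous_on {p..q} F" for p q
    by (simp add: continuous_at_imp_continuous_on)
  have "(F \<longlongrightarrow> (norm w)\<^sup>2) at_top"
    using cdf_lim_at_top measure_scalar_measure[OF sp, of UNIV w] sp
    by (simp add: F_def spectral_measure_def)
  then have "eventually (\<lambda>q. (norm w)\<^sup>2 / 2 < F q) at_top"
    by (rule order_tendstoD) (use \<open>w \<noteq> 0\<close> in simp)
  moreover have "eventually (\<lambda>p. F p < (norm w)\<^sup>2 / 2) at_bot"
    using cdf_lim_at_bot unfolding F_def by (rule order_tendstoD) (use \<open>w \<noteq> 0\<close> in simp)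
  ultimately obtain p q where pq: "F p < F q"
    by (metis eventually_at_bot_linorder eventually_at_top_linorder less_trans order_refl)
  then have "p < q"
    using mono by (metis leD linorder_not_less monoD)
  obtain S where S: "orthonormal_basis S" "(\<lambda>e. (norm (B e))\<^sup>2) summable_on S"
    using trace_class_Hilbert_Schmidt[OF B] by blast
  have "clinear B"
    using B by (auto simp: trace_class_def bounded_clinear_def)
  then have sym: "cinner (B x) y = cinner x (B y)" for x y
    by (rule real_form_symmetric) (simp add: form)
  \<comment> \<open>\<open>c\<close> bounds the heat function from below on the interval from
    \<open>p\<close> to \<open>q\<close>; the maximum of the squares accounts for endpoints of
    either sign.\<close>
  define c where "c = exp (- \<epsilon> * max (p\<^sup>2) (q\<^sup>2))"
  define C where "C = infsum (\<lambda>e. (norm (B e))\<^sup>2) S"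
  have "c > 0" by (simp add: c_def)
  have bound: "real K * c\<^sup>2 \<le> C" if "K > 0" for K :: nat
  proof -
    \<comment> \<open>The interval is cut at points where the continuous function \<open>F\<close>
      has risen by a multiple of \<open>d\<close>, so that each of the \<open>K\<close> pieces has
      mass \<open>d\<close>.\<close>
    define d where "d = (F q - F p) / K"
    have "d > 0" using pq \<open>K > 0\<close> by (simp add: d_def)
    have "\<exists>r. p \<le> r \<and> r \<le> q \<and> F r = F p + k * d" if "k \<le> K" for k :: nat
    proof (rule IVT')
      have "k * d \<le> K * d" using that \<open>d > 0\<close> by simp
      then show "F p + k * d \<le> F q" using \<open>K > 0\<close> by (simp add: d_def)
    qed (use \<open>d > 0\<close> \<open>p < q\<close> cont in auto)
    then obtain r where r: "\<And>k::nat. k \<le> K \<Longrightarrow> p \<le> r k \<and> r k \<le> q \<and> F (r k) = F p + k * d"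
      by metis
    have r_less: "r j < r k" if "j < k" "k \<le> K" for j k
    proof -
      have "F (r j) < F (r k)" using r[of j] r[of k] that \<open>d > 0\<close> by simp
      then show ?thesis by (metis leD linorder_not_less mono monoD)
    qed
    define A where "A k = {r k <.. r (Suc k)}" for k
    have A_borel: "A k \<in> sets borel" for k by (simp add: A_def)
    have norm_EA: "(norm (E (A k) w))\<^sup>2 = d" if "k < K" for k
    proof -
      have "measure (scalar_measure E w) (A k) = F (r (Suc k)) - F (r k)"
        unfolding A_def F_def by (rule cdf_diff_eq[symmetric]) (use r_less that in auto)
      then show ?thesis
        using r[of k] r[of "Suc k"] that measure_scalar_measure[OF sp A_borel] by (simp add: algebra_simps)
    qed
    define u where "u k = complex_of_real (1 / sqrt d) *\<^sub>C E (A k) w" for k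
    have Eu: "E (A k) (u k) = u k" for k
      using spectral_measure_clinear[OF sp A_borel] by (simp add: u_def clinear_scaleC spectral_measure_Int[OF sp] A_borel)
    have norm_u: "norm (u k) = 1" if "k < K" for k
    proof -
      have "norm (E (A k) w) = sqrt d"
        using norm_EA[OF that] by (metis norm_ge_zero real_sqrt_unique)
      then show ?thesis using \<open>d > 0\<close> by (simp add: u_def norm_scaleC norm_divide)
    qed
    have orth: "cinner (u j) (u k) = 0" if "j < k" "k < K" for j k
    proof -
      have "r (Suc j) \<le> r k"
        using r_less[of "Suc j" k] that by (cases "Suc j = k") auto
      then have "A j \<inter> A k = {}" by (auto simp: A_def)
      then have "E (A j) (E (A k) w) = 0"
        by (simp add: spectral_measure_Int[OF sp] A_borel spectral_measure_empty[OF sp])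
      then show ?thesis
        by (simp add: u_def cinner_algebra spectral_measure_symmetric[OF sp A_borel])
    qed
    have inner_u: "cinner (u j) (u k) = (if j = k then 1 else 0)" if "j < K" "k < K" for j k
      using orth[of j k] orth[of k j] that norm_u[of k] cinner_self[of "u k"] cnj_cinner[of "u k" "u j"]
      by (cases j k rule: linorder_cases) auto
    then have inj: "inj_on u {..<K}"
      by (metis inj_onI lessThan_iff zero_neq_one)
    have "orthonormal (u ` {..<K})"
      using inner_u inj by (auto simp: orthonormal_def inj_on_eq_iff)
    from Hilbert_Schmidt_bound[OF S sym this] have "(\<Sum>k<K. (norm (B (u k)))\<^sup>2) \<le> C"
      by (simp add: sum.reindex[OF inj] C_def)
    moreover have "c\<^sup>2 \<le> (norm (B (u k)))\<^sup>2" if "k < K" for k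
    proof -
      have "c * norm (u k) \<le> norm (B (u k))"
      proof (rule spectral_lower_bound[OF sp A_borel Eu, of "\<lambda>s. exp (- \<epsilon> * s\<^sup>2)" 1])
        show "c \<le> exp (- \<epsilon> * s\<^sup>2)" if "s \<in> A k" for s
        proof -
          have "p \<le> s" "s \<le> q"
            using that r[of k] r[of "Suc k"] \<open>k < K\<close> by (auto simp: A_def)
          then have "s\<^sup>2 \<le> max (p\<^sup>2) (q\<^sup>2)"
            by (cases "0 \<le> s") (auto simp: le_max_iff_disj intro: power_mono power2_mono_neg)
          then show ?thesis using \<open>\<epsilon> > 0\<close> by (simp add: c_def)
        qed
      qed (use \<open>\<epsilon> > 0\<close> form in auto)
      then show ?thesis
        using norm_u[OF that] \<open>c > 0\<close> by (simp add: power_mono)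
    qed
    then have "(\<Sum>k<K. c\<^sup>2) \<le> (\<Sum>k<K. (norm (B (u k)))\<^sup>2)"
      by (intro sum_mono) auto
    ultimately show ?thesis by simp
  qed
  \<comment> \<open>The lower bound grows linearly with the number of pieces while \<open>C\<close>
    is fixed; \<open>Suc K\<close> keeps that number positive.\<close>
  obtain K :: nat where "C / c\<^sup>2 < real K"
    using reals_Archimedean2 by blast
  then have "C < real (Suc K) * c\<^sup>2"
    using \<open>c > 0\<close> by (simp add: divide_less_eq algebra_simps) (smt (verit) zero_less_power)
  with bound[of "Suc K"] show False by simp
qed

lemma orthonormal_subset: "orthonormal M \<Longrightarrow> F \<subseteq> M \<Longrightarrow> orthonormal F"
  unfolding orthonormal_def by blast

text \<open>The heat operator at \<epsilon> = 1 provides the eigenbasis. For any other \<epsilon>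
  the hypothesis supplies an unrelated spectral measure; the basis vectors are first shown to be
  fixed by its point projections, and only then is its heat operator bounded below on them.\<close>

lemma heat_trace_class_diagonal:
  fixes T :: "'h::complex_hilbert unbounded_op"
  assumes T: "self_adjoint T" "closed T"
    and heat: "\<And>\<epsilon>. \<epsilon> > 0 \<Longrightarrow> \<exists>B. is_functional_calculus T (\<lambda>s. exp (- \<epsilon> * s\<^sup>2)) B \<and> trace_class B"
  obtains M s where "diagonal_operator T M s" "\<And>\<epsilon>. \<epsilon> > 0 \<Longrightarrow> (\<lambda>e. exp (- \<epsilon> * (s e)\<^sup>2)) summable_on M"
proof -
  have sub: "csubspace T" and sym: "symmetric_op T" and dense: "closure (Domain T) = UNIV"
    using T self_adjoint_symmetric by (auto simp: self_adjoint_def is_operator_def)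
  have total: "w = 0"
    if E: "spectral_resolution T E" and B: "trace_class B" "\<epsilon> > 0"
      "\<And>x. cinner x (B x) = complex_of_real (\<integral>s. exp (- \<epsilon> * s\<^sup>2) \<partial>scalar_measure E x)"
      and w: "\<And>r v. E {r} v = v \<Longrightarrow> cinner v w = 0" for E B \<epsilon> w
  proof -
    have sp: "spectral_measure E" using E by (simp add: spectral_resolution_def)
    have "E {r} w = 0" for r
    proof -
      have "E {r} (E {r} w) = E {r} w" by (simp add: spectral_measure_Int[OF sp])
      then have "cinner (E {r} w) w = 0" "cinner (E {r} w) (E {r} w) = cinner (E {r} w) w"
        using w spectral_measure_symmetric[OF sp, of "{r}" "E {r} w" w] by simp_all
      then show ?thesis by (simp add: cinner_self_eq_0)
    qed
    then show ?thesis
      using heat_operator_eigenvectors_total[OF sp B(1,3,2)] by blast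
  qed
  obtain B E where "trace_class B" "spectral_resolution T E"
      "\<And>x. cinner x (B x) = complex_of_real (\<integral>s. exp (- 1 * s\<^sup>2) \<partial>scalar_measure E x)"
    using heat[of 1] unfolding is_functional_calculus_def by auto
  note BE = this
  obtain M s where M: "orthonormal_basis M" and s: "\<And>e. e \<in> M \<Longrightarrow> (e, complex_of_real (s e) *\<^sub>C e) \<in> T"
  proof (rule exists_orthonormal_eigenbasis[OF sub T(2) sym])
    fix w assume w: "\<And>r v. (v, complex_of_real r *\<^sub>C v) \<in> T \<Longrightarrow> cinner v w = 0"
    show "w = 0"
      by (rule total[OF BE(2,1) zero_less_one BE(3)])
        (use w spectral_resolution_eigenvector[OF sub sym dense BE(2)] in blast)
  qed blast
  have "(\<lambda>e. exp (- \<epsilon> * (s e)\<^sup>2)) summable_on M" if "\<epsilon> > 0" for \<epsilon>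
  proof -
    \<comment> \<open>The Hilbert--Schmidt property controls squared norms, so the heat operator at
      \<open>\<epsilon> / 2\<close> gives summability at \<open>\<epsilon>\<close>.\<close>
    have "\<epsilon> / 2 > 0" using that by simp
    from heat[OF this] obtain B E where E: "spectral_resolution T E" and B: "trace_class B"
      and form: "\<And>x. cinner x (B x) = complex_of_real (\<integral>s. exp (- (\<epsilon> / 2) * s\<^sup>2) \<partial>scalar_measure E x)"
      unfolding is_functional_calculus_def by blast
    have sp: "spectral_measure E" using E by (simp add: spectral_resolution_def)
    \<comment> \<open>The remainder \<open>z = e - E {r} e\<close> is orthogonal to every vector
      fixed by some \<open>E {r'}\<close>: for \<open>r' = r\<close> since
      \<open>E {r} z = 0\<close>, and for \<open>r' \<noteq> r\<close> since \<open>z\<close> is an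
      eigenvector of \<open>T\<close> for \<open>r\<close>.\<close>
    have eig: "E {r} e = e" if e: "(e, complex_of_real r *\<^sub>C e) \<in> T" for e r
    proof -
      define z where "z = e - E {r} e"
      have idem: "E {r} (E {r} e) = E {r} e" by (simp add: spectral_measure_Int[OF sp])
      then have Ez: "E {r} z = 0"
        using spectral_measure_clinear[OF sp, of "{r}"] by (simp add: z_def clinear_diff)
      have z: "(z, complex_of_real r *\<^sub>C z) \<in> T"
        using cvs.subspace_diff[OF sub e spectral_resolution_eigenvector[OF sub sym dense E idem]]
        by (simp add: z_def cvs.scale_right_diff_distrib)
      have "z = 0"
      proof (rule total[OF E B \<open>\<epsilon> / 2 > 0\<close> form])
        fix r' v assume v: "E {r'} v = v"
        show "cinner v z = 0"
        proof (cases "r' = r")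
          case True
          then have "cinner v z = cinner v (E {r} z)"
            using spectral_measure_symmetric[OF sp, of "{r}" v z] v by simp
          then show ?thesis by (simp add: Ez)
        next
          case False
          then show ?thesis
            using symmetric_eigenvectors_orthogonal[OF sym
                spectral_resolution_eigenvector[OF sub sym dense E v] z] by simp
        qed
      qed
      then show ?thesis by (simp add: z_def)
    qed
    obtain S where S: "orthonormal_basis S" "(\<lambda>e. (norm (B e))\<^sup>2) summable_on S"
      using trace_class_Hilbert_Schmidt[OF B] by blast
    have "clinear B"
      using B by (auto simp: trace_class_def bounded_clinear_def)
    then have symB: "cinner (B x) y = cinner x (B y)" for x y
      by (rule real_form_symmetric) (simp add: form)
    have le: "exp (- \<epsilon> * (s e)\<^sup>2) \<le> (norm (B e))\<^sup>2" if "e \<in> M" for e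
    proof -
      have "exp (- (\<epsilon> / 2) * (s e)\<^sup>2) * norm e \<le> norm (B e)"
        by (rule spectral_lower_bound[OF sp _ eig[OF s[OF that]], of "\<lambda>s. exp (- (\<epsilon> / 2) * s\<^sup>2)" 1])
          (use form \<open>\<epsilon> > 0\<close> in auto)
      then have "exp (- (\<epsilon> / 2) * (s e)\<^sup>2) \<le> norm (B e)"
        using orthonormal_norm[OF orthonormal_basis_orthonormal[OF M] that] by simp
      then have "(exp (- (\<epsilon> / 2) * (s e)\<^sup>2))\<^sup>2 \<le> (norm (B e))\<^sup>2"
        by (intro power_mono) auto
      then show ?thesis by (simp add: power2_eq_square exp_add[symmetric])
    qed
    show ?thesis
    proof (rule nonneg_bdd_above_summable_on)
      show "bdd_above (sum (\<lambda>e. exp (- \<epsilon> * (s e)\<^sup>2)) ` {F. F \<subseteq> M \<and> finite F})"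
        unfolding bdd_above_def
      proof (intro exI ballI, safe)
        fix F assume F: "F \<subseteq> M" "finite F"
        have "(\<Sum>e\<in>F. exp (- \<epsilon> * (s e)\<^sup>2)) \<le> (\<Sum>e\<in>F. (norm (B e))\<^sup>2)"
          using le F by (intro sum_mono) auto
        also have "\<dots> \<le> infsum (\<lambda>e. (norm (B e))\<^sup>2) S"
          by (rule Hilbert_Schmidt_bound[OF S symB])
            (use F orthonormal_subset[OF orthonormal_basis_orthonormal[OF M]] in auto)
        finally show "(\<Sum>e\<in>F. exp (- \<epsilon> * (s e)\<^sup>2)) \<le> infsum (\<lambda>e. (norm (B e))\<^sup>2) S" .
      qed
    qed simp
  qed
  moreover have "diagonal_operator T M s"
    by unfold_locales (use sub T sym M s in auto)
  ultimately show ?thesis using that by blast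
qed

section \<open>Symmetric operators with a diagonal square\<close>

text \<open>The vectors of \<open>V\<close> need not be eigenvectors of \<open>T\<close>. This is
  the situation of the second operator of the data in an eigenbasis of the first.\<close>

locale diagonal_square =
  fixes T :: "'h::complex_hilbert unbounded_op" and V :: "'h set" and \<kappa> :: "'h \<Rightarrow> real"
  assumes subspace: "csubspace T" and closed: "closed T" and symmetric: "symmetric_op T"
    and basis: "orthonormal_basis V"
    and square: "v \<in> V \<Longrightarrow> \<exists>w. (v, w) \<in> T \<and> (w, complex_of_real (\<kappa> v) *\<^sub>C v) \<in> T"
begin

lemma eigenvectors_total:
  assumes z: "\<And>r v. (v, complex_of_real r *\<^sub>C v) \<in> T \<Longrightarrow> cinner v z = 0"
  shows "z = 0"
proof (rule orthonormal_basis_eqI[OF basis])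
  fix v assume "v \<in> V"
  then obtain w where w: "(v, w) \<in> T" "(w, complex_of_real (\<kappa> v) *\<^sub>C v) \<in> T"
    using square by blast
  \<comment> \<open>Symmetry makes \<open>\<kappa> v\<close> the square of
    \<open>r = norm w\<close>, so \<open>r\<close> and \<open>- r\<close> are both available as
    eigenvalues; in the sum of the two resulting orthogonality relations \<open>w\<close>
    cancels.\<close>
  have "cinner v (complex_of_real (\<kappa> v) *\<^sub>C v) = cinner w w"
    using symmetric_opD[OF symmetric w] .
  then have \<kappa>: "\<kappa> v = (norm w)\<^sup>2"
    using orthonormal_norm[OF orthonormal_basis_orthonormal[OF basis] \<open>v \<in> V\<close>]
    by (simp add: cinner_scaleC_right cinner_self del: of_real_power)
  define r where "r = norm w"
  show "cinner v z = cinner v 0"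
  proof (cases "r = 0")
    case True
    then have "(v, complex_of_real 0 *\<^sub>C v) \<in> T"
      using w by (simp add: r_def)
    from z[OF this] show ?thesis by simp
  next
    case False
    have eig: "(v + complex_of_real (1/a) *\<^sub>C w, complex_of_real a *\<^sub>C (v + complex_of_real (1/a) *\<^sub>C w)) \<in> T"
      if "a\<^sup>2 = \<kappa> v" "a \<noteq> 0" for a
    proof -
      have "complex_of_real (1/a) *\<^sub>C complex_of_real (\<kappa> v) *\<^sub>C v = complex_of_real a *\<^sub>C v"
        using that(2) by (simp add: that(1)[symmetric] power2_eq_square)
      moreover have "complex_of_real a *\<^sub>C complex_of_real (1/a) *\<^sub>C w = w"
        using that(2) by simp
      ultimately show ?thesis
        using cvs.subspace_add[OF subspace w(1) cvs.subspace_scale[OF subspace w(2), of "complex_of_real (1/a)"]]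
        by (simp only: scaleC_prod_simps add_Pair scaleC_add_right add.commute)
    qed
    have "cinner (v + complex_of_real (1/r) *\<^sub>C w) z = 0" "cinner (v + complex_of_real (1/(-r)) *\<^sub>C w) z = 0"
      using z[OF eig[of r]] z[OF eig[of "-r"]] False by (simp_all add: \<kappa> r_def)
    then have "cinner v z + cinner v z = 0"
      by (simp add: cinner_algebra)
    then show ?thesis by simp
  qed
qed

text \<open>The second clause says that \<open>m\<close> and \<open>v\<close> are orthogonal unless
  \<open>(s m)\<^sup>2 = \<kappa> v\<close>. It is the bridge between the eigenbasis
  \<open>M\<close> of \<open>T\<close> and the given basis \<open>V\<close>.\<close>

lemma obtain_diagonal:
  obtains M s where "diagonal_operator T M s"
    and "\<And>m v. m \<in> M \<Longrightarrow> v \<in> V \<Longrightarrow> complex_of_real (\<kappa> v) * cinner m v = complex_of_real ((s m)\<^sup>2) * cinner m v"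
proof -
  obtain M s where M: "orthonormal_basis M" and s: "\<And>e. e \<in> M \<Longrightarrow> (e, complex_of_real (s e) *\<^sub>C e) \<in> T"
    using exists_orthonormal_eigenbasis[OF subspace closed symmetric eigenvectors_total] by blast
  have diag: "diagonal_operator T M s"
    by unfold_locales (use subspace closed symmetric M s in auto)
  have eq: "complex_of_real (\<kappa> v) * cinner m v = complex_of_real ((s m)\<^sup>2) * cinner m v"
    if m: "m \<in> M" and v: "v \<in> V" for m v
  proof -
    obtain w where w: "(v, w) \<in> T" "(w, complex_of_real (\<kappa> v) *\<^sub>C v) \<in> T"
      using square[OF v] by blast
    then show ?thesis
      using diagonal_operator.mem_iff[OF diag] m by (simp add: cinner_scaleC_right power2_eq_square)
  qed
  show ?thesis
    by (rule that[OF diag eq])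
qed

lemma self_adjoint: "self_adjoint T"
  by (rule obtain_diagonal) (rule diagonal_operator.self_adjoint)

text \<open>The right-hand side mentions only \<open>V\<close> and \<open>\<kappa>\<close>, so
  operators sharing these have the same square, domains included. The forward direction is symmetry;
  for the converse the intermediate vector \<open>y\<close> is built in the eigenbasis of
  \<open>T\<close>.\<close>

lemma square_iff: "(x, z) \<in> T O T \<longleftrightarrow> (\<forall>v\<in>V. cinner v z = \<kappa> v * cinner v x)"
proof
  assume "(x, z) \<in> T O T"
  then obtain y where y: "(x, y) \<in> T" "(y, z) \<in> T" by blast
  show "\<forall>v\<in>V. cinner v z = \<kappa> v * cinner v x"
  proof
    fix v assume "v \<in> V"
    then obtain w where w: "(v, w) \<in> T" "(w, complex_of_real (\<kappa> v) *\<^sub>C v) \<in> T"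
      using square by blast
    have "cinner v z = cinner w y" "cinner w y = cinner (complex_of_real (\<kappa> v) *\<^sub>C v) x"
      using symmetric_opD[OF symmetric] w y by blast+
    then show "cinner v z = \<kappa> v * cinner v x"
      by (simp add: cinner_scaleC_left)
  qed
next
  assume z: "\<forall>v\<in>V. cinner v z = \<kappa> v * cinner v x"
  obtain M s where diag: "diagonal_operator T M s"
    and \<kappa>: "\<And>m v. m \<in> M \<Longrightarrow> v \<in> V \<Longrightarrow> complex_of_real (\<kappa> v) * cinner m v = complex_of_real ((s m)\<^sup>2) * cinner m v"
    using obtain_diagonal by blast
  interpret diag: diagonal_operator T M s by (rule diag)
  have mz: "cinner m z = complex_of_real ((s m)\<^sup>2) * cinner m x" if "m \<in> M" for m
  proof (rule has_sum_unique)
    show "((\<lambda>v. cinner m v * cinner v z) has_sum cinner m z) V"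
      by (rule Parseval[OF basis])
    have eq: "complex_of_real ((s m)\<^sup>2) * (cinner m v * cinner v x) = cinner m v * cinner v z" if "v \<in> V" for v
      using \<kappa>[OF \<open>m \<in> M\<close> that] z that by (metis mult.assoc mult.commute)
    show "((\<lambda>v. cinner m v * cinner v z) has_sum complex_of_real ((s m)\<^sup>2) * cinner m x) V"
      by (rule has_sum_cong[THEN iffD1, OF eq has_sum_cmult_right[OF Parseval[OF basis]]])
  qed
  have "(\<lambda>m. (cmod (complex_of_real (s m) * cinner m x))\<^sup>2) summable_on M"
  proof (rule summable_on_comparison_test)
    show "(\<lambda>m. (cmod (cinner m x))\<^sup>2 + (cmod (cinner m z))\<^sup>2) summable_on M"
      using Parseval_norm[OF diag.basis] has_sum_imp_summable by (intro summable_on_add) blast+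
    fix m assume m: "m \<in> M"
    \<comment> \<open>This bounds the coefficients of the prospective \<open>y\<close> by those of
      \<open>x\<close> and \<open>z\<close>, which puts \<open>x\<close> into the domain of
      \<open>T\<close>.\<close>
    have "(s m)\<^sup>2 \<le> 1 + ((s m)\<^sup>2)\<^sup>2"
      using sum_squares_bound[of 1 "(s m)\<^sup>2", unfolded power_one mult_1_right] zero_le_power2[of "s m"] by linarith
    from mult_right_mono[OF this, of "(cmod (cinner m x))\<^sup>2"]
    show "(cmod (complex_of_real (s m) * cinner m x))\<^sup>2 \<le> (cmod (cinner m x))\<^sup>2 + (cmod (cinner m z))\<^sup>2"
      by (simp add: mz[OF m] norm_mult norm_power power_mult_distrib algebra_simps)
  qed simp
  from Riesz_Fischer[OF orthonormal_basis_orthonormal[OF diag.basis] this]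
  obtain y where y: "((\<lambda>m. (complex_of_real (s m) * cinner m x) *\<^sub>C m) has_sum y) M"
    using summable_iff_has_sum_infsum by blast
  have "cinner m y = s m * cinner m x" if "m \<in> M" for m
    using cinner_orthonormal_has_sum[OF orthonormal_basis_orthonormal[OF diag.basis] y order_refl that] that by simp
  then have "(x, y) \<in> T" "(y, z) \<in> T"
    using mz by (auto simp: diag.mem_iff power2_eq_square)
  then show "(x, z) \<in> T O T" by blast
qed

text \<open>The weights \<open>f v m\<close> are summed in both orders. Over \<open>m\<close> they
  give \<open>exp (- \<epsilon> * \<kappa> v)\<close>, as \<open>v\<close> is a unit vector; over
  \<open>v\<close> they give \<open>exp (- \<epsilon> * (s m)\<^sup>2)\<close>, as only those
  \<open>v\<close> contribute for which \<open>\<kappa> v = (s m)\<^sup>2\<close>.\<close>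

lemma trace_class_heat:
  assumes "\<epsilon> > 0" and summable: "(\<lambda>v. exp (- \<epsilon> * \<kappa> v)) summable_on V"
  shows "\<exists>B. is_functional_calculus T (\<lambda>s. exp (- \<epsilon> * s\<^sup>2)) B \<and> trace_class B"
proof -
  obtain M s where diag: "diagonal_operator T M s"
    and \<kappa>: "\<And>m v. m \<in> M \<Longrightarrow> v \<in> V \<Longrightarrow> complex_of_real (\<kappa> v) * cinner m v = complex_of_real ((s m)\<^sup>2) * cinner m v"
    using obtain_diagonal by blast
  interpret diag: diagonal_operator T M s by (rule diag)
  define f where "f v m = (cmod (cinner m v))\<^sup>2 * exp (- \<epsilon> * \<kappa> v)" for v m
  have "(f v has_sum exp (- \<epsilon> * \<kappa> v)) M" if "v \<in> V" for v
    unfolding f_def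
    using has_sum_cmult_left[OF Parseval_norm[OF diag.basis, of v], where c="exp (- \<epsilon> * \<kappa> v)"]
      orthonormal_norm[OF orthonormal_basis_orthonormal[OF basis] that] by simp
  moreover have "((\<lambda>v. exp (- \<epsilon> * \<kappa> v)) has_sum infsum (\<lambda>v. exp (- \<epsilon> * \<kappa> v)) V) V"
    using summable by simp
  ultimately have "((\<lambda>m. infsum (\<lambda>v. f v m) V) has_sum infsum (\<lambda>v. exp (- \<epsilon> * \<kappa> v)) V) M"
    by (rule has_sum_Tonelli(1)) (simp_all add: f_def)
  then have f_summable: "(\<lambda>m. infsum (\<lambda>v. f v m) V) summable_on M"
    by (rule has_sum_imp_summable)
  have f_sum: "infsum (\<lambda>v. f v m) V = exp (- \<epsilon> * (s m)\<^sup>2)" if m: "m \<in> M" for m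
  proof (rule infsumI)
    have sum: "((\<lambda>v. (cmod (cinner v m))\<^sup>2 * exp (- \<epsilon> * (s m)\<^sup>2)) has_sum exp (- \<epsilon> * (s m)\<^sup>2)) V"
      using has_sum_cmult_left[OF Parseval_norm[OF basis, of m], where c="exp (- \<epsilon> * (s m)\<^sup>2)"]
        orthonormal_norm[OF orthonormal_basis_orthonormal[OF diag.basis] m] by simp
    have eq: "(cmod (cinner v m))\<^sup>2 * exp (- \<epsilon> * (s m)\<^sup>2) = f v m" if "v \<in> V" for v
    proof -
      have "cmod (cinner v m) = cmod (cinner m v)"
        by (metis cnj_cinner complex_mod_cnj)
      moreover have "\<kappa> v = (s m)\<^sup>2" if "cinner m v \<noteq> 0"
        using \<kappa>[OF m \<open>v \<in> V\<close>] that by (simp only: mult_cancel_right of_real_eq_iff) simp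
      ultimately show ?thesis by (auto simp: f_def)
    qed
    show "((\<lambda>v. f v m) has_sum exp (- \<epsilon> * (s m)\<^sup>2)) V"
      by (rule has_sum_cong[THEN iffD1, OF eq sum])
  qed
  have "(\<lambda>m. exp (- \<epsilon> * (s m)\<^sup>2)) summable_on M"
    by (rule summable_on_cong[THEN iffD1, OF f_sum f_summable])
  then show ?thesis
    by (intro diag.trace_class_heat[where K=1]) (use \<open>\<epsilon> > 0\<close> in auto)
qed

end

section \<open>Tensor products\<close>

text \<open>An eigenbasis of the zero operator, for which every vector is an eigenvector.\<close>

lemma exists_orthonormal_basis:
  obtains M :: "'h::complex_hilbert set" where "orthonormal_basis M"
proof -
  define T :: "'h unbounded_op" where "T = UNIV \<times> {0}"
  have "csubspace T" "symmetric_op T" "closed T"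
    by (auto simp: T_def csubspace_iff zero_prod_def symmetric_op_def intro: closed_Times)
  moreover have "w = 0" if "\<And>r v. (v, complex_of_real r *\<^sub>C v) \<in> T \<Longrightarrow> cinner v w = 0" for w
    using that[of w 0] by (simp add: T_def cinner_self_eq_0)
  ultimately show ?thesis
    using exists_orthonormal_eigenbasis[of T] that by metis
qed

text \<open>The bound at \<open>u = 0\<close> makes the closure of \<open>G\<close> single-valued,
  and completeness makes it total. Stated for relations, so that values prescribed on elementary
  tensors need not be shown to be well defined beforehand.\<close>

lemma bounded_clinear_extension:
  fixes G :: "('h::complex_hilbert \<times> 'k::complex_hilbert) set"
  assumes G: "csubspace G" "closure (Domain G) = UNIV"
    and K: "\<And>u w. (u, w) \<in> G \<Longrightarrow> norm w \<le> K * norm u"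
  shows "\<exists>B. bounded_clinear B \<and> (\<forall>(u, w)\<in>G. B u = w)"
proof -
  have sub: "csubspace (closure G)"
    using G(1) by (rule csubspace_closure_prod)
  have "closure G \<subseteq> {p. norm (snd p) \<le> K * norm (fst p)}"
    by (rule closure_minimal) (use K in \<open>auto intro!: closed_Collect_le continuous_intros\<close>)
  then have bound: "norm w \<le> K * norm u" if "(u, w) \<in> closure G" for u w
    using that by auto
  have unique: "w = w'" if "(u, w) \<in> closure G" "(u, w') \<in> closure G" for u w w'
    using bound[of 0 "w - w'"] cvs.subspace_diff[OF sub that] by simp
  have "\<exists>w. (u, w) \<in> closure G" for u
  proof -
    have "u \<in> closure (Domain G)" using G(2) by simp
    then obtain f where f: "\<And>n. f n \<in> Domain G" "f \<longlonglongrightarrow> u"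
      unfolding closure_sequential by blast
    then have "\<forall>n. \<exists>w. (f n, w) \<in> G" by blast
    then obtain g where g: "\<And>n. (f n, g n) \<in> G"
      by metis
    have "Cauchy g"
    proof (rule metric_CauchyI)
      fix e :: real assume "e > 0"
      \<comment> \<open>\<open>K\<close> need not be positive; the enlarged Lipschitz constant can
        be divided by.\<close>
      then have "e / (\<bar>K\<bar> + 1) > 0" by simp
      moreover have "Cauchy f"
        using f(2) by (rule LIMSEQ_imp_Cauchy)
      ultimately obtain N where N: "\<And>m n. m \<ge> N \<Longrightarrow> n \<ge> N \<Longrightarrow> dist (f m) (f n) < e / (\<bar>K\<bar> + 1)"
        by (meson metric_CauchyD)
      have "dist (g m) (g n) < e" if "m \<ge> N" "n \<ge> N" for m n
      proof -
        have "dist (g m) (g n) \<le> K * dist (f m) (f n)"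
          using K[of "f m - f n" "g m - g n"] cvs.subspace_diff[OF G(1) g[of m] g[of n]]
          by (simp add: dist_norm)
        also have "\<dots> \<le> (\<bar>K\<bar> + 1) * dist (f m) (f n)"
          by (intro mult_right_mono) auto
        also have "\<dots> < e"
          using N[OF that] by (simp add: field_simps)
        finally show ?thesis .
      qed
      then show "\<exists>M. \<forall>m\<ge>M. \<forall>n\<ge>M. dist (g m) (g n) < e" by blast
    qed
    then obtain w where "g \<longlonglongrightarrow> w"
      using Cauchy_convergent_iff convergent_def by blast
    then have "(\<lambda>n. (f n, g n)) \<longlonglongrightarrow> (u, w)"
      using f(2) by (intro tendsto_Pair)
    then have "(u, w) \<in> closure G"
      unfolding closure_sequential
      by (intro exI[of _ "\<lambda>n. (f n, g n)"] conjI allI g)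
    then show ?thesis by blast
  qed
  then obtain B where B: "\<And>u. (u, B u) \<in> closure G" by metis
  have "bounded_clinear B"
  proof (rule bounded_clinearI)
    show "B (x + y) = B x + B y" for x y
      using unique[OF B] cvs.subspace_add[OF sub B[of x] B[of y]] by simp
    show "B (c *\<^sub>C x) = c *\<^sub>C B x" for c x
      using unique[OF B] cvs.subspace_scale[OF sub B[of x], of c] by simp
    show "norm (B x) \<le> norm x * K" for x
      using bound[OF B] by (simp add: mult.commute)
  qed
  moreover have "B u = w" if "(u, w) \<in> G" for u w
    using unique[OF B] that closure_subset by blast
  ultimately show ?thesis by blast
qed

lemma cbilinear_simps:
  assumes "cbilinear t"
  shows "t (x + x') y = t x y + t x' y" "t x (y + y') = t x y + t x y'"
    "t (c *\<^sub>C x) y = c *\<^sub>C t x y" "t x (c *\<^sub>C y) = c *\<^sub>C t x y"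
    "t (- x) y = - t x y" "t x (- y) = - t x y" "t 0 y = 0" "t x 0 = 0"
  using assms clinear_minus[of "t x" y] clinear_minus[of "\<lambda>x. t x y" x] clinear_0[of "t x"]
    clinear_0[of "\<lambda>x. t x y"]
  by (auto simp: cbilinear_def clinear_iff)

lemma cbilinear_iff:
  "cbilinear t \<longleftrightarrow> (\<forall>x x' y. t (x + x') y = t x y + t x' y) \<and> (\<forall>x y y'. t x (y + y') = t x y + t x y') \<and>
     (\<forall>c x y. t (c *\<^sub>C x) y = c *\<^sub>C t x y) \<and> (\<forall>c x y. t x (c *\<^sub>C y) = c *\<^sub>C t x y)"
  by (auto simp: cbilinear_def clinear_iff)

lemma bounded_clinear_add: "bounded_clinear B \<Longrightarrow> B (x + y) = B x + B y"
  and bounded_clinear_scaleC: "bounded_clinear B \<Longrightarrow> B (c *\<^sub>C x) = c *\<^sub>C B x"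
  and bounded_clinear_0: "bounded_clinear B \<Longrightarrow> B 0 = 0"
  and bounded_clinear_bounded_linear: "bounded_clinear B \<Longrightarrow> bounded_linear B"
  by (simp_all add: bounded_clinear_def clinear_add clinear_scaleC clinear_0)

lemma bounded_clinear_compose: "bounded_clinear A \<Longrightarrow> bounded_clinear B \<Longrightarrow> bounded_clinear (\<lambda>x. A (B x))"
  by (auto simp: bounded_clinear_def clinear_iff intro: bounded_linear_compose)

lemma bounded_clinear_id: "bounded_clinear (\<lambda>x. x)" "bounded_clinear id"
  by (auto simp: bounded_clinear_def clinear_iff id_def)

lemma bounded_clinear_plus: "bounded_clinear A \<Longrightarrow> bounded_clinear B \<Longrightarrow> bounded_clinear (\<lambda>x. A x + B x)"
  by (auto simp: bounded_clinear_def clinear_iff scaleC_add_right intro: bounded_linear_add)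

lemma bounded_clinear_scale: "bounded_clinear A \<Longrightarrow> bounded_clinear (\<lambda>x. c *\<^sub>C A x)"
  by (auto simp: bounded_clinear_def clinear_iff scaleC_add_right mult.commute
      intro: bounded_linear_compose[OF bounded_bilinear.bounded_linear_right[OF bounded_bilinear_scaleC]])

lemma bounded_clinear_zero: "bounded_clinear (\<lambda>x. 0)"
  by (auto simp: bounded_clinear_def clinear_iff)

section \<open>Orthonormal bases and bounded operators on a Hilbert space tensor product\<close>

locale hilbert_tensor_product =
  fixes t :: "'h::complex_hilbert \<Rightarrow> 'k::complex_hilbert \<Rightarrow> 'l::complex_hilbert"
  assumes tensor: "hilbert_tensor t"
begin

lemma bilinear: "cbilinear t"
  using tensor by (simp add: hilbert_tensor_def)

lemmas tensor_simps = cbilinear_simps[OF bilinear]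

lemma cinner_tensor: "cinner (t x y) (t x' y') = cinner x x' * cinner y y'"
  using tensor by (simp add: hilbert_tensor_def)

lemma total: "closure (cspan {t x y | x y. True}) = UNIV"
  using tensor by (simp add: hilbert_tensor_def)

lemma norm_tensor: "norm (t x y) = norm x * norm y"
proof -
  have "complex_of_real ((norm (t x y))\<^sup>2) = complex_of_real ((norm x * norm y)\<^sup>2)"
    by (simp only: cinner_self[symmetric] cinner_tensor) (simp add: cinner_self power_mult_distrib)
  then have "(norm (t x y))\<^sup>2 = (norm x * norm y)\<^sup>2"
    using of_real_eq_iff by blast
  then show ?thesis by simp
qed

lemma bounded_bilinear_tensor: "bounded_bilinear t"
proof (unfold_locales, goal_cases)
  case 5
  show ?case
    by (rule exI[of _ 1]) (simp add: norm_tensor)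
qed (simp_all add: tensor_simps scaleR_scaleC)

lemma bounded_clinear_tensor_left: "bounded_clinear (\<lambda>x. t x y)"
  and bounded_clinear_tensor_right: "bounded_clinear (t x)"
  by (auto simp: bounded_clinear_def clinear_iff tensor_simps
      intro: bounded_bilinear.bounded_linear_left[OF bounded_bilinear_tensor]
        bounded_bilinear.bounded_linear_right[OF bounded_bilinear_tensor])

lemma tensor_induct:
  assumes "csubspace S" "closed S" "\<And>x y. t x y \<in> S"
  shows "u \<in> S"
proof -
  have "cspan {t x y | x y. True} \<subseteq> S"
    by (rule cvs.span_minimal) (use assms in auto)
  then have "closure (cspan {t x y | x y. True}) \<subseteq> S"
    using assms(2) by (rule closure_minimal)
  then show ?thesis using total by blast
qed

lemma orthonormal_basis_tensor:
  assumes M: "orthonormal_basis M" and N: "orthonormal_basis N"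
  shows "orthonormal_basis (case_prod t ` (M \<times> N))" and "inj_on (case_prod t) (M \<times> N)"
proof -
  have inner: "cinner (t e f) (t e' f') = (if (e, f) = (e', f') then 1 else 0)"
    if "e \<in> M" "f \<in> N" "e' \<in> M" "f' \<in> N" for e f e' f'
    using that M N by (auto simp: cinner_tensor orthonormal_basis_def)
  then show inj: "inj_on (case_prod t) (M \<times> N)"
    by (auto simp: inj_on_def) (metis Pair_inject zero_neq_one)+
  show "orthonormal_basis (case_prod t ` (M \<times> N))"
    unfolding orthonormal_basis_iff
  proof (intro conjI allI impI)
    show "orthonormal (case_prod t ` (M \<times> N))"
      unfolding orthonormal_def
    proof safe
      fix e f e' f' assume *: "e \<in> M" "f \<in> N" "e' \<in> M" "f' \<in> N"
      then have "t e f = t e' f' \<longleftrightarrow> (e, f) = (e', f')"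
        using inj_on_eq_iff[OF inj, of "(e, f)" "(e', f')"] by simp
      with inner[OF *] show "cinner (t e f) (t e' f') = (if t e f = t e' f' then 1 else 0)"
        by simp
    qed
    fix z assume z: "\<forall>v\<in>case_prod t ` (M \<times> N). cinner v z = 0"
    \<comment> \<open>Orthogonality to the values of a bounded map passes from a basis to all
      arguments. It is applied first in the right and then in the left factor.\<close>
    have zero: "cinner z (A x) = 0" if "bounded_clinear A" "orthonormal_basis L" "\<And>e. e \<in> L \<Longrightarrow> cinner z (A e) = 0"
      for A :: "'m::complex_hilbert \<Rightarrow> 'l" and L x
    proof -
      have "((\<lambda>e. A (cinner e x *\<^sub>C e)) has_sum A x) L"
        by (rule has_sum_bounded_linear[OF bounded_clinear_bounded_linear[OF that(1)] orthonormal_basis_has_sum[OF that(2)]])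
      then have "((\<lambda>e. cinner z (A (cinner e x *\<^sub>C e))) has_sum cinner z (A x)) L"
        by (rule has_sum_cinner)
      moreover have "((\<lambda>e. cinner z (A (cinner e x *\<^sub>C e))) has_sum 0) L"
        by (rule has_sum_0) (simp add: bounded_clinear_scaleC[OF that(1)] cinner_algebra that(3))
      ultimately show ?thesis by (rule has_sum_unique)
    qed
    have "cinner z (t e f) = 0" if "e \<in> M" "f \<in> N" for e f
    proof -
      have "cinner (t e f) z = 0" using z that by blast
      then show ?thesis using cnj_cinner[of "t e f" z] by simp
    qed
    then have "cinner z (t e y) = 0" if "e \<in> M" for e y
      by (rule zero[OF bounded_clinear_tensor_right N]) (rule that)
    then have "cinner z (t x y) = 0" for x y
      by (rule zero[OF bounded_clinear_tensor_left M])
    then have "cinner v z = 0" if "v \<in> {t x y | x y. True}" for v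
      using that cnj_cinner[of z v] by force
    then show "z = 0"
      by (rule total_imp_zero[OF total])
  qed
qed

text \<open>\<open>z f\<close> is the slice of \<open>u\<close> along \<open>f\<close>. Grouping the
  Parseval sum over \<open>M \<times> N\<close> by \<open>f\<close> leaves the squared norms of the
  slices.\<close>

lemma Parseval_tensor:
  assumes M: "orthonormal_basis M" and N: "orthonormal_basis N"
    and z: "\<And>e f. e \<in> M \<Longrightarrow> f \<in> N \<Longrightarrow> cinner (t e f) u = cinner e (z f)"
  shows "((\<lambda>f. (norm (z f))\<^sup>2) has_sum (norm u)\<^sup>2) N"
proof -
  have "((\<lambda>v. (cmod (cinner v u))\<^sup>2) \<circ> case_prod t has_sum (norm u)\<^sup>2) (M \<times> N)"
    using Parseval_norm[OF orthonormal_basis_tensor(1)[OF M N]] has_sum_reindex[OF orthonormal_basis_tensor(2)[OF M N]]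
    by blast
  then have "((\<lambda>(f, e). (cmod (cinner (t e f) u))\<^sup>2) has_sum (norm u)\<^sup>2) (N \<times> M)"
    by (subst (asm) has_sum_swap) (simp add: o_def case_prod_unfold)
  then have "((\<lambda>(f, e). (cmod (cinner e (z f)))\<^sup>2) has_sum (norm u)\<^sup>2) (N \<times> M)"
    by (rule has_sum_cong[THEN iffD1, rotated]) (auto simp: z)
  then show ?thesis
    by (rule has_sum_SigmaD) (simp add: Parseval_norm[OF M])
qed

text \<open>The operator acts on every slice of \<open>u\<close> as \<open>S\<close>. By Parseval
  over the slices, a bound for \<open>S\<close> is also a bound on the span of the elementary
  tensors.\<close>

lemma exists_tensor_id:
  assumes S: "bounded_clinear S"
  shows "\<exists>B. bounded_clinear B \<and> (\<forall>x y. B (t x y) = t (S x) y)"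
proof -
  obtain M :: "'h set" where M: "orthonormal_basis M"
    using exists_orthonormal_basis by blast
  obtain N :: "'k set" where N: "orthonormal_basis N"
    using exists_orthonormal_basis by blast
  obtain K where K: "K > 0" "\<And>x. norm (S x) \<le> norm x * K"
    using bounded_linear.pos_bounded[OF bounded_clinear_bounded_linear[OF S]] by blast
  define G where "G = cspan {(t x y, t (S x) y) | x y. True}"
  have slice: "\<exists>z. \<forall>e. cinner (t e f) (fst p) = cinner e z \<and> cinner (t e f) (snd p) = cinner e (S z)"
    if "p \<in> G" for p f
    using that unfolding G_def
  proof (induction rule: cspan_induct)
    case zero
    show ?case by (rule exI[of _ 0]) (simp add: bounded_clinear_0[OF S])
  next
    case (add p q)
    then obtain z z' where "\<forall>e. cinner (t e f) (fst p) = cinner e z \<and> cinner (t e f) (snd p) = cinner e (S z)"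
      "\<forall>e. cinner (t e f) (fst q) = cinner e z' \<and> cinner (t e f) (snd q) = cinner e (S z')" by blast
    then show ?case
      by (intro exI[of _ "z + z'"]) (simp add: bounded_clinear_add[OF S] cinner_algebra)
  next
    case (scale c p)
    then obtain z where "\<forall>e. cinner (t e f) (fst p) = cinner e z \<and> cinner (t e f) (snd p) = cinner e (S z)" by blast
    then show ?case
      by (intro exI[of _ "c *\<^sub>C z"]) (simp add: bounded_clinear_scaleC[OF S] cinner_algebra)
  next
    case (base p)
    then obtain x y where "p = (t x y, t (S x) y)" by blast
    then show ?case
      by (intro exI[of _ "cinner f y *\<^sub>C x"])
        (simp add: bounded_clinear_scaleC[OF S] cinner_algebra cinner_tensor)
  qed
  have "\<exists>B. bounded_clinear B \<and> (\<forall>(u, w)\<in>G. B u = w)"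
  proof (rule bounded_clinear_extension)
    show "csubspace G" unfolding G_def by (rule cvs.subspace_span)
    then have "csubspace (Domain G)" by (rule csubspace_Domain)
    moreover have "(t x y, t (S x) y) \<in> G" for x y
      unfolding G_def by (rule cvs.span_base) blast
    then have "{t x y | x y. True} \<subseteq> Domain G"
      by blast
    ultimately have "cspan {t x y | x y. True} \<subseteq> Domain G"
      by (intro cvs.span_minimal)
    then have "closure (cspan {t x y | x y. True}) \<subseteq> closure (Domain G)"
      by (rule closure_mono)
    then show "closure (Domain G) = UNIV" using total by blast
    fix u w assume "(u, w) \<in> G"
    from slice[OF this] obtain z where z: "\<And>e f. cinner (t e f) u = cinner e (z f)"
        "\<And>e f. cinner (t e f) w = cinner e (S (z f))"
      by (simp; metis)
    have "(norm w)\<^sup>2 \<le> K\<^sup>2 * (norm u)\<^sup>2"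
    proof (rule has_sum_mono)
      show "((\<lambda>f. (norm (S (z f)))\<^sup>2) has_sum (norm w)\<^sup>2) N"
        by (rule Parseval_tensor[OF M N z(2)])
      show "((\<lambda>f. K\<^sup>2 * (norm (z f))\<^sup>2) has_sum K\<^sup>2 * (norm u)\<^sup>2) N"
        by (rule has_sum_cmult_right[OF Parseval_tensor[OF M N z(1)]])
      show "(norm (S (z f)))\<^sup>2 \<le> K\<^sup>2 * (norm (z f))\<^sup>2" for f
        using power_mono[OF K(2)[of "z f"], of 2] by (simp add: power_mult_distrib mult.commute)
    qed
    then show "norm w \<le> K * norm u"
      using K(1) by (auto intro: power2_le_imp_le simp: power_mult_distrib)
  qed
  then obtain B where "bounded_clinear B" and B: "\<And>u w. (u, w) \<in> G \<Longrightarrow> B u = w"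
    by fast
  moreover have "B (t x y) = t (S x) y" for x y
    by (rule B) (auto simp: G_def intro: cvs.span_base)
  ultimately show ?thesis by blast
qed

end

lemma hilbert_tensor_swap:
  assumes "hilbert_tensor t" shows "hilbert_tensor (\<lambda>y x. t x y)"
proof -
  have "{t x y | y x. True} = {t x y | x y. True}" by blast
  then show ?thesis
    using assms by (simp add: hilbert_tensor_def cbilinear_def mult.commute)
qed

context hilbert_tensor_product
begin

text \<open>Existence comes from \<open>(S \<otimes> 1) (1 \<otimes> T)\<close>, the second factor
  being obtained in the product with swapped arguments; totality of the elementary tensors gives the
  uniqueness that the definite description asks for.\<close>

lemma bounded_tensor:
  assumes S: "bounded_clinear S" and T: "bounded_clinear T"
  shows "bounded_clinear (bounded_tensor t S T)" and "bounded_tensor t S T (t x y) = t (S x) (T y)"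
proof -
  interpret swap: hilbert_tensor_product "\<lambda>y x. t x y"
    by unfold_locales (rule hilbert_tensor_swap[OF tensor])
  obtain A where A: "bounded_clinear A" "\<forall>x y. A (t x y) = t (S x) y"
    using exists_tensor_id[OF S] by blast
  obtain B where B: "bounded_clinear B" "\<forall>y x. B (t x y) = t x (T y)"
    using swap.exists_tensor_id[OF T] by blast
  have "bounded_clinear (bounded_tensor t S T) \<and> (\<forall>x y. bounded_tensor t S T (t x y) = t (S x) (T y))"
    unfolding bounded_tensor_def
  proof (rule theI[of _ "\<lambda>u. A (B u)"])
    show AB: "bounded_clinear (\<lambda>u. A (B u)) \<and> (\<forall>x y. A (B (t x y)) = t (S x) (T y))"
      using bounded_clinear_compose[OF A(1) B(1)] A(2) B(2) by simp
    fix C assume C: "bounded_clinear C \<and> (\<forall>x y. C (t x y) = t (S x) (T y))"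
    show "C = (\<lambda>u. A (B u))"
      by (rule bounded_clinear_eqI[OF _ _ total]) (use AB C in auto)
  qed
  then show "bounded_clinear (bounded_tensor t S T)" "bounded_tensor t S T (t x y) = t (S x) (T y)"
    by blast+
qed

lemma bounded_tensor_eqI:
  assumes "bounded_clinear A" "bounded_clinear B" "\<And>x y. A (t x y) = B (t x y)"
  shows "A = B"
  by (rule bounded_clinear_eqI[OF assms(1,2) total]) (use assms(3) in auto)

lemma bounded_tensor_adjoint:
  assumes S: "bounded_clinear S" "bounded_clinear S'" "\<And>x y. cinner (S x) y = cinner x (S' y)"
    and T: "bounded_clinear T" "bounded_clinear T'" "\<And>x y. cinner (T x) y = cinner x (T' y)"
  shows "cinner (bounded_tensor t S T u) v = cinner u (bounded_tensor t S' T' v)"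
proof -
  define A where "A = bounded_tensor t S T"
  define A' where "A' = bounded_tensor t S' T'"
  have A: "bounded_clinear A" "\<And>x y. A (t x y) = t (S x) (T y)"
    unfolding A_def by (rule bounded_tensor[OF S(1) T(1)])+
  have A': "bounded_clinear A'" "\<And>x y. A' (t x y) = t (S' x) (T' y)"
    unfolding A'_def by (rule bounded_tensor[OF S(2) T(2)])+
  have cont: "continuous_on UNIV A" "continuous_on UNIV A'"
    using A(1) A'(1) by (auto intro: linear_continuous_on bounded_clinear_bounded_linear)
  have 1: "cinner (A (t x y)) v = cinner (t x y) (A' v)" for x y v
  proof -
    have "v \<in> {v. cinner (A (t x y)) v = cinner (t x y) (A' v)}"
    proof (rule tensor_induct)
      show "csubspace {v. cinner (A (t x y)) v = cinner (t x y) (A' v)}"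
        using A'(1) by (simp add: csubspace_iff cinner_algebra bounded_clinear_0 bounded_clinear_add bounded_clinear_scaleC)
      show "closed {v. cinner (A (t x y)) v = cinner (t x y) (A' v)}"
        by (intro closed_Collect_eq continuous_intros cont)
    qed (simp add: A A' cinner_tensor S T)
    then show ?thesis by simp
  qed
  have "u \<in> {u. cinner (A u) v = cinner u (A' v)}"
  proof (rule tensor_induct)
    show "csubspace {u. cinner (A u) v = cinner u (A' v)}"
      using A(1) by (simp add: csubspace_iff cinner_algebra bounded_clinear_0 bounded_clinear_add bounded_clinear_scaleC)
    show "closed {u. cinner (A u) v = cinner u (A' v)}"
      by (intro closed_Collect_eq continuous_intros cont)
  qed (simp add: 1)
  then show ?thesis by (simp add: A_def A'_def)
qed

lemma bounded_tensor_unique: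
  assumes "bounded_clinear S" "bounded_clinear T" "bounded_clinear A" "\<And>x y. A (t x y) = t (S x) (T y)"
  shows "bounded_tensor t S T = A"
  by (rule bounded_tensor_eqI[OF bounded_tensor(1)[OF assms(1,2)] assms(3)])
    (simp only: assms(4) bounded_tensor(2)[OF assms(1,2)])

lemma bounded_tensor_comp:
  assumes S: "bounded_clinear S" "bounded_clinear S'" and T: "bounded_clinear T" "bounded_clinear T'"
  shows "bounded_tensor t S T \<circ> bounded_tensor t S' T' = bounded_tensor t (S \<circ> S') (T \<circ> T')"
proof (rule bounded_tensor_unique[symmetric])
  show "bounded_clinear (S \<circ> S')" "bounded_clinear (T \<circ> T')"
      "bounded_clinear (bounded_tensor t S T \<circ> bounded_tensor t S' T')"
    using bounded_clinear_compose[OF S] bounded_clinear_compose[OF T]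
      bounded_clinear_compose[OF bounded_tensor(1)[OF S(1) T(1)] bounded_tensor(1)[OF S(2) T(2)]]
    by (simp_all only: o_def)
  show "(bounded_tensor t S T \<circ> bounded_tensor t S' T') (t x y) = t ((S \<circ> S') x) ((T \<circ> T') y)" for x y
    by (simp only: o_apply bounded_tensor(2)[OF S(1) T(1)] bounded_tensor(2)[OF S(2) T(2)])
qed

lemma bounded_tensor_id: "bounded_tensor t id id = id"
  by (rule bounded_tensor_unique) (simp_all add: bounded_clinear_id)

lemma bounded_tensor_commute:
  assumes "bounded_clinear S" "bounded_clinear S'" "bounded_clinear T" "bounded_clinear T'"
    and "S \<circ> S' = S' \<circ> S" "T \<circ> T' = T' \<circ> T"
  shows "bounded_tensor t S T \<circ> bounded_tensor t S' T' = bounded_tensor t S' T' \<circ> bounded_tensor t S T"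
  using assms by (simp only: bounded_tensor_comp)

lemma self_adjoint_unitary_tensor:
  assumes S: "self_adjoint_unitary S" and T: "self_adjoint_unitary T"
  shows "self_adjoint_unitary (bounded_tensor t S T)"
proof -
  have S': "bounded_clinear S" "\<And>x y. cinner (S x) y = cinner x (S y)" "S \<circ> S = id"
    using S unfolding self_adjoint_unitary_def bounded_self_adjoint_def by blast+
  have T': "bounded_clinear T" "\<And>x y. cinner (T x) y = cinner x (T y)" "T \<circ> T = id"
    using T unfolding self_adjoint_unitary_def bounded_self_adjoint_def by blast+
  have "bounded_tensor t S T \<circ> bounded_tensor t S T = id"
    by (simp only: bounded_tensor_comp S' T' bounded_tensor_id)
  then show ?thesis
    unfolding self_adjoint_unitary_def bounded_self_adjoint_def
    using bounded_tensor(1)[OF S'(1) T'(1)] bounded_tensor_adjoint[OF S'(1,1,2) T'(1,1,2)] by blast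
qed

end

subsection \<open>The tensor product of two representations\<close>

locale representation_tensor_product = hilbert_tensor_product t
  for t :: "'h::complex_hilbert \<Rightarrow> 'k::complex_hilbert \<Rightarrow> 'l::complex_hilbert" +
  fixes tA :: "'a::complex_star_algebra \<Rightarrow> 'b::complex_star_algebra \<Rightarrow> 'c::complex_star_algebra"
    and \<pi>\<^sub>1 :: "'a \<Rightarrow> 'h \<Rightarrow> 'h" and \<pi>\<^sub>2 :: "'b \<Rightarrow> 'k \<Rightarrow> 'k"
  assumes algebra_tensor: "algebra_tensor tA"
    and \<pi>\<^sub>1: "faithful_star_representation \<pi>\<^sub>1" and \<pi>\<^sub>2: "faithful_star_representation \<pi>\<^sub>2"
begin

abbreviation \<pi> :: "'c \<Rightarrow> 'l \<Rightarrow> 'l" where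
  "\<pi> \<equiv> representation_tensor tA t \<pi>\<^sub>1 \<pi>\<^sub>2"

lemma bounded_\<pi>\<^sub>1: "bounded_clinear (\<pi>\<^sub>1 a)" and bounded_\<pi>\<^sub>2: "bounded_clinear (\<pi>\<^sub>2 b)"
  using \<pi>\<^sub>1 \<pi>\<^sub>2 by (simp_all add: faithful_star_representation_def)

lemma \<pi>\<^sub>1_simps: "\<pi>\<^sub>1 (a + a') x = \<pi>\<^sub>1 a x + \<pi>\<^sub>1 a' x" "\<pi>\<^sub>1 (c *\<^sub>C a) x = c *\<^sub>C \<pi>\<^sub>1 a x" "\<pi>\<^sub>1 0 x = 0"
    "\<pi>\<^sub>1 (a * a') x = \<pi>\<^sub>1 a (\<pi>\<^sub>1 a' x)" "\<pi>\<^sub>1 1 x = x" "cinner (\<pi>\<^sub>1 (star a) x) y = cinner x (\<pi>\<^sub>1 a y)"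
  using \<pi>\<^sub>1 clinear_0[of "\<lambda>a. \<pi>\<^sub>1 a x"] by (simp_all add: faithful_star_representation_def clinear_iff)

lemma \<pi>\<^sub>2_simps: "\<pi>\<^sub>2 (a + a') x = \<pi>\<^sub>2 a x + \<pi>\<^sub>2 a' x" "\<pi>\<^sub>2 (c *\<^sub>C a) x = c *\<^sub>C \<pi>\<^sub>2 a x" "\<pi>\<^sub>2 0 x = 0"
    "\<pi>\<^sub>2 (a * a') x = \<pi>\<^sub>2 a (\<pi>\<^sub>2 a' x)" "\<pi>\<^sub>2 1 x = x" "cinner (\<pi>\<^sub>2 (star a) x) y = cinner x (\<pi>\<^sub>2 a y)"
  using \<pi>\<^sub>2 clinear_0[of "\<lambda>a. \<pi>\<^sub>2 a x"] by (simp_all add: faithful_star_representation_def clinear_iff)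

lemma algebra_bilinear: "cbilinear tA"
  using algebra_tensor by (simp add: algebra_tensor_def)

lemmas algebra_tensor_simps = cbilinear_simps[OF algebra_bilinear]

lemma algebra_tensor_mult: "tA a b * tA a' b' = tA (a * a') (b * b')"
  and algebra_tensor_one: "tA 1 1 = 1"
  and algebra_tensor_star: "star (tA a b) = tA (star a) (star b)"
  and algebra_tensor_span: "cspan {tA a b | a b. True} = UNIV"
  and algebra_tensor_universal: "cbilinear \<phi> \<Longrightarrow> \<exists>f. clinear f \<and> (\<forall>a b. f (tA a b) = (\<phi> a b :: complex))"
  using algebra_tensor by (simp_all add: algebra_tensor_def)

lemma algebra_tensor_induct [case_names add scale base]:
  assumes "\<And>u v. P u \<Longrightarrow> P v \<Longrightarrow> P (u + v)" "\<And>c u. P u \<Longrightarrow> P (c *\<^sub>C u)" "\<And>a b. P (tA a b)"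
  shows "P u"
proof -
  have "u \<in> cspan {tA a b | a b. True}"
    using algebra_tensor_span by simp
  then show ?thesis
  proof (induction rule: cspan_induct)
    case zero
    show ?case using assms(3)[of 0 0] by (simp add: algebra_tensor_simps)
  qed (use assms in auto)
qed

lemma bounded_tensor_add_scale:
  "bounded_tensor t (\<pi>\<^sub>1 (a + a')) (\<pi>\<^sub>2 b) x = bounded_tensor t (\<pi>\<^sub>1 a) (\<pi>\<^sub>2 b) x + bounded_tensor t (\<pi>\<^sub>1 a') (\<pi>\<^sub>2 b) x"
  "bounded_tensor t (\<pi>\<^sub>1 a) (\<pi>\<^sub>2 (b + b')) x = bounded_tensor t (\<pi>\<^sub>1 a) (\<pi>\<^sub>2 b) x + bounded_tensor t (\<pi>\<^sub>1 a) (\<pi>\<^sub>2 b') x"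
  "bounded_tensor t (\<pi>\<^sub>1 (c *\<^sub>C a)) (\<pi>\<^sub>2 b) x = c *\<^sub>C bounded_tensor t (\<pi>\<^sub>1 a) (\<pi>\<^sub>2 b) x"
  "bounded_tensor t (\<pi>\<^sub>1 a) (\<pi>\<^sub>2 (c *\<^sub>C b)) x = c *\<^sub>C bounded_tensor t (\<pi>\<^sub>1 a) (\<pi>\<^sub>2 b) x"
proof -
  note bounded = bounded_\<pi>\<^sub>1 bounded_\<pi>\<^sub>2 bounded_tensor(1) bounded_clinear_plus bounded_clinear_scale
  note simps = bounded_tensor(2)[OF bounded_\<pi>\<^sub>1 bounded_\<pi>\<^sub>2] \<pi>\<^sub>1_simps \<pi>\<^sub>2_simps tensor_simps
  show "bounded_tensor t (\<pi>\<^sub>1 (a + a')) (\<pi>\<^sub>2 b) x = bounded_tensor t (\<pi>\<^sub>1 a) (\<pi>\<^sub>2 b) x + bounded_tensor t (\<pi>\<^sub>1 a') (\<pi>\<^sub>2 b) x"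
    by (rule fun_cong[OF bounded_tensor_unique[where A="\<lambda>x. _ x + _ x"]], (intro bounded)+) (simp only: simps)
  show "bounded_tensor t (\<pi>\<^sub>1 a) (\<pi>\<^sub>2 (b + b')) x = bounded_tensor t (\<pi>\<^sub>1 a) (\<pi>\<^sub>2 b) x + bounded_tensor t (\<pi>\<^sub>1 a) (\<pi>\<^sub>2 b') x"
    by (rule fun_cong[OF bounded_tensor_unique[where A="\<lambda>x. _ x + _ x"]], (intro bounded)+) (simp only: simps)
  show "bounded_tensor t (\<pi>\<^sub>1 (c *\<^sub>C a)) (\<pi>\<^sub>2 b) x = c *\<^sub>C bounded_tensor t (\<pi>\<^sub>1 a) (\<pi>\<^sub>2 b) x"
    by (rule fun_cong[OF bounded_tensor_unique[where A="\<lambda>x. c *\<^sub>C _ x"]], (intro bounded)+) (simp only: simps)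
  show "bounded_tensor t (\<pi>\<^sub>1 a) (\<pi>\<^sub>2 (c *\<^sub>C b)) x = c *\<^sub>C bounded_tensor t (\<pi>\<^sub>1 a) (\<pi>\<^sub>2 b) x"
    by (rule fun_cong[OF bounded_tensor_unique[where A="\<lambda>x. c *\<^sub>C _ x"]], (intro bounded)+) (simp only: simps)
qed

text \<open>The universal property in \<open>algebra_tensor\<close> concerns scalar-valued forms, so
  well-definedness is tested by inner products with each \<open>z\<close>: such a form factors
  through a linear \<open>f\<close>, and \<open>f 0 = 0\<close> makes every value over 0 orthogonal
  to \<open>z\<close>.\<close>

lemma exists_representation:
  "\<exists>\<rho> :: 'c \<Rightarrow> 'l \<Rightarrow> 'l. (\<forall>x. clinear (\<lambda>u. \<rho> u x)) \<and> (\<forall>a b. \<rho> (tA a b) = bounded_tensor t (\<pi>\<^sub>1 a) (\<pi>\<^sub>2 b))"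
proof -
  define G where "G x = cspan {(tA a b, bounded_tensor t (\<pi>\<^sub>1 a) (\<pi>\<^sub>2 b) x) | a b. True}" for x
  have sub: "csubspace (G x)" for x
    unfolding G_def by (rule cvs.subspace_span)
  have ex: "\<exists>w. (u, w) \<in> G x" for u x
  proof (induction u rule: algebra_tensor_induct)
    case (add u v)
    then show ?case using cvs.subspace_add[OF sub[of x]] by fastforce
  next
    case (scale c u)
    then show ?case using cvs.subspace_scale[OF sub[of x], of _ c] by fastforce
  next
    case (base a b)
    then show ?case unfolding G_def by (intro exI cvs.span_base) blast
  qed
  have zero: "w = 0" if "(0, w) \<in> G x" for x w
  proof (rule cinner_eqI)
    fix z
    have "cbilinear (\<lambda>a b. cinner z (bounded_tensor t (\<pi>\<^sub>1 a) (\<pi>\<^sub>2 b) x))"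
      by (simp add: cbilinear_iff bounded_tensor_add_scale cinner_algebra scaleC_complex_def)
    from algebra_tensor_universal[OF this] obtain f where f: "clinear f"
        "\<And>a b. f (tA a b) = cinner z (bounded_tensor t (\<pi>\<^sub>1 a) (\<pi>\<^sub>2 b) x)" by blast
    have "f (fst p) = cinner z (snd p)" if "p \<in> G x" for p
      using that unfolding G_def
      by (induction rule: cspan_induct)
        (auto simp: f clinear_0[OF f(1)] clinear_add[OF f(1)] clinear_scaleC[OF f(1)] cinner_algebra scaleC_complex_def)
    from this[OF that] show "cinner z w = cinner z 0"
      by (simp add: clinear_0[OF f(1)])
  qed
  have unique: "w = w'" if "(u, w) \<in> G x" "(u, w') \<in> G x" for u w w' x
    using zero[of "w - w'"] cvs.subspace_diff[OF sub that] by simp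
  obtain \<rho> where \<rho>: "\<And>u x. (u, \<rho> u x) \<in> G x"
    using ex by metis
  have "\<rho> (u + v) x = \<rho> u x + \<rho> v x" for u v x
    using unique[OF \<rho>] cvs.subspace_add[OF sub \<rho>[of u x] \<rho>[of v x]] by simp
  moreover have "\<rho> (c *\<^sub>C u) x = c *\<^sub>C \<rho> u x" for c u x
    using unique[OF \<rho>] cvs.subspace_scale[OF sub \<rho>[of u x], of c] by simp
  moreover have "\<rho> (tA a b) x = bounded_tensor t (\<pi>\<^sub>1 a) (\<pi>\<^sub>2 b) x" for a b x
    by (rule unique[OF \<rho>]) (auto simp: G_def intro!: cvs.span_base)
  ultimately show ?thesis
    by (intro exI[of _ \<rho>]) (auto simp: clinear_iff)
qed

lemma \<pi>_clinear: "clinear (\<lambda>u. \<pi> u x)" and \<pi>_tensor: "\<pi> (tA a b) = bounded_tensor t (\<pi>\<^sub>1 a) (\<pi>\<^sub>2 b)"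
proof -
  obtain \<rho> :: "'c \<Rightarrow> 'l \<Rightarrow> 'l" where \<rho>: "(\<forall>x. clinear (\<lambda>u. \<rho> u x)) \<and> (\<forall>a b. \<rho> (tA a b) = bounded_tensor t (\<pi>\<^sub>1 a) (\<pi>\<^sub>2 b))"
    using exists_representation by blast
  have "(\<forall>x. clinear (\<lambda>u. \<pi> u x)) \<and> (\<forall>a b. \<pi> (tA a b) = bounded_tensor t (\<pi>\<^sub>1 a) (\<pi>\<^sub>2 b))"
    unfolding representation_tensor_def
  proof (rule theI[of _ \<rho>], rule \<rho>)
    fix \<rho>' :: "'c \<Rightarrow> 'l \<Rightarrow> 'l"
    assume \<rho>': "(\<forall>x. clinear (\<lambda>u. \<rho>' u x)) \<and> (\<forall>a b. \<rho>' (tA a b) = bounded_tensor t (\<pi>\<^sub>1 a) (\<pi>\<^sub>2 b))"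
    have "\<rho>' u x = \<rho> u x" for u x
      by (induction u rule: algebra_tensor_induct) (use \<rho> \<rho>' in \<open>auto simp: clinear_iff\<close>)
    then show "\<rho>' = \<rho>" by blast
  qed
  then show "clinear (\<lambda>u. \<pi> u x)" "\<pi> (tA a b) = bounded_tensor t (\<pi>\<^sub>1 a) (\<pi>\<^sub>2 b)" by blast+
qed

lemma \<pi>_simps: "\<pi> (u + v) x = \<pi> u x + \<pi> v x" "\<pi> (c *\<^sub>C u) x = c *\<^sub>C \<pi> u x" "\<pi> 0 x = 0"
    "\<pi> (u - v) x = \<pi> u x - \<pi> v x"
  using clinear_add[OF \<pi>_clinear] clinear_scaleC[OF \<pi>_clinear] clinear_0[OF \<pi>_clinear]
    clinear_diff[OF \<pi>_clinear] by blast+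

lemma \<pi>_tensor_apply: "\<pi> (tA a b) (t x y) = t (\<pi>\<^sub>1 a x) (\<pi>\<^sub>2 b y)"
  by (simp add: \<pi>_tensor bounded_tensor bounded_\<pi>\<^sub>1 bounded_\<pi>\<^sub>2)

lemma bounded_\<pi>: "bounded_clinear (\<pi> u)"
proof (induction u rule: algebra_tensor_induct)
  case (add u v)
  then have "bounded_clinear (\<lambda>x. \<pi> u x + \<pi> v x)" by (rule bounded_clinear_plus)
  moreover have "\<pi> (u + v) = (\<lambda>x. \<pi> u x + \<pi> v x)" by (simp add: fun_eq_iff \<pi>_simps)
  ultimately show ?case by simp
next
  case (scale c u)
  then have "bounded_clinear (\<lambda>x. c *\<^sub>C \<pi> u x)" by (rule bounded_clinear_scale)
  moreover have "\<pi> (c *\<^sub>C u) = (\<lambda>x. c *\<^sub>C \<pi> u x)" by (simp add: fun_eq_iff \<pi>_simps)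
  ultimately show ?case by simp
qed (simp add: \<pi>_tensor bounded_tensor bounded_\<pi>\<^sub>1 bounded_\<pi>\<^sub>2)

lemma \<pi>_commute:
  assumes "bounded_clinear B" "\<And>a b. B \<circ> \<pi> (tA a b) = \<pi> (tA a b) \<circ> B"
  shows "B \<circ> \<pi> u = \<pi> u \<circ> B"
proof (induction u rule: algebra_tensor_induct)
  case (add u v)
  then show ?case by (simp add: fun_eq_iff \<pi>_simps bounded_clinear_add[OF assms(1)])
next
  case (scale c u)
  then show ?case by (simp add: fun_eq_iff \<pi>_simps bounded_clinear_scaleC[OF assms(1)])
qed (rule assms(2))

lemma \<pi>_mult: "\<pi> (u * v) = \<pi> u \<circ> \<pi> v"
proof (induction u rule: algebra_tensor_induct)
  case (add u u')
  then show ?case by (simp add: fun_eq_iff \<pi>_simps distrib_right)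
next
  case (scale c u)
  then show ?case by (simp add: fun_eq_iff \<pi>_simps mult_scaleC_left)
next
  case (base a b)
  show ?case
  proof (induction v rule: algebra_tensor_induct)
    case (add v v')
    then show ?case by (simp add: fun_eq_iff \<pi>_simps distrib_left bounded_clinear_add[OF bounded_\<pi>])
  next
    case (scale c v)
    then show ?case by (simp add: fun_eq_iff \<pi>_simps mult_scaleC_right bounded_clinear_scaleC[OF bounded_\<pi>])
  next
    case (base a' b')
    show ?case
      using \<pi>\<^sub>1 \<pi>\<^sub>2 unfolding faithful_star_representation_def
      by (simp only: algebra_tensor_mult \<pi>_tensor bounded_tensor_comp)
  qed
qed

lemma \<pi>_one: "\<pi> 1 = id"
proof (rule bounded_tensor_eqI)
  show "\<pi> 1 (t x y) = id (t x y)" for x y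
    unfolding algebra_tensor_one[symmetric] by (simp add: \<pi>_tensor_apply \<pi>\<^sub>1_simps \<pi>\<^sub>2_simps)
qed (rule bounded_\<pi> bounded_clinear_id)+

lemma \<pi>_star: "cinner (\<pi> (star u) x) y = cinner x (\<pi> u y)"
proof (induction u rule: algebra_tensor_induct)
  case (base a b)
  show ?case
    unfolding algebra_tensor_star \<pi>_tensor
    by (rule bounded_tensor_adjoint) (simp_all add: bounded_\<pi>\<^sub>1 bounded_\<pi>\<^sub>2 \<pi>\<^sub>1_simps \<pi>\<^sub>2_simps)
qed (simp_all add: star_add star_scaleC \<pi>_simps cinner_algebra)

text \<open>The slices \<open>\<langle>x', \<pi>\<^sub>1 (g b) x\<rangle>\<close> of a vanishing \<open>\<Sum>b. \<pi>\<^sub>1 (g b) \<otimes> \<pi>\<^sub>2 b\<close> are the coefficients of a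
  linear relation among the basis elements \<open>b\<close>.\<close>

lemma \<pi>_faithful:
  assumes "\<pi> u = (\<lambda>x. 0)" shows "u = 0"
proof -
  obtain Bs :: "'b set" where "Bs \<subseteq> UNIV" and indep: "\<not> cvs.dependent Bs" and span: "UNIV \<subseteq> cspan Bs"
    by (rule cvs.maximal_independent_subset)
  \<comment> \<open>Only the second components are taken from a basis. Letting \<open>g\<close>
    vanish off \<open>F\<close> allows two such expansions to be added over the union of their index
    sets.\<close>
  have "\<exists>F g. finite F \<and> F \<subseteq> Bs \<and> (\<forall>b. b \<notin> F \<longrightarrow> g b = 0) \<and> u = (\<Sum>b\<in>F. tA (g b) b)"
  proof (induction u rule: algebra_tensor_induct)
    case (add u v)
    then obtain F g F' g' where
      F: "finite F" "F \<subseteq> Bs" "\<And>b. b \<notin> F \<Longrightarrow> g b = 0" "u = (\<Sum>b\<in>F. tA (g b) b)" and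
      F': "finite F'" "F' \<subseteq> Bs" "\<And>b. b \<notin> F' \<Longrightarrow> g' b = 0" "v = (\<Sum>b\<in>F'. tA (g' b) b)"
      by blast
    have "u = (\<Sum>b\<in>F \<union> F'. tA (g b) b)" "v = (\<Sum>b\<in>F \<union> F'. tA (g' b) b)"
      unfolding F(4) F'(4)
      by (rule sum.mono_neutral_left; use F F' in \<open>auto simp: algebra_tensor_simps\<close>)+
    then show ?case
      using F F' by (intro exI[of _ "F \<union> F'"] exI[of _ "\<lambda>b. g b + g' b"])
        (auto simp: algebra_tensor_simps sum.distrib)
  next
    case (scale c u)
    then obtain F g where "finite F" "F \<subseteq> Bs" "\<And>b. b \<notin> F \<Longrightarrow> g b = 0" "u = (\<Sum>b\<in>F. tA (g b) b)" by blast
    then show ?case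
      by (intro exI[of _ F] exI[of _ "\<lambda>b. c *\<^sub>C g b"]) (auto simp: algebra_tensor_simps cvs.scale_sum_right)
  next
    case (base a b)
    obtain F r where F: "finite F" "F \<subseteq> Bs" "b = (\<Sum>\<beta>\<in>F. r \<beta> *\<^sub>C \<beta>)"
      using span unfolding cvs.span_explicit by blast
    have "tA a b = (\<Sum>\<beta>\<in>F. r \<beta> *\<^sub>C tA a \<beta>)"
      unfolding F(3) using clinear_sum[of "tA a" "\<lambda>\<beta>. r \<beta> *\<^sub>C \<beta>" F] algebra_bilinear
      by (simp add: cbilinear_def algebra_tensor_simps)
    then show ?case
      using F(1,2) by (intro exI[of _ F] exI[of _ "\<lambda>\<beta>. if \<beta> \<in> F then r \<beta> *\<^sub>C a else 0"])
        (auto simp: algebra_tensor_simps intro!: sum.cong)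
  qed
  then obtain F g where F: "finite F" "F \<subseteq> Bs" and u: "u = (\<Sum>b\<in>F. tA (g b) b)" by blast
  have "g b = 0" if "b \<in> F" for b
  proof -
    have "\<pi>\<^sub>1 (g b) x = \<pi>\<^sub>1 0 x" for x
    proof (rule cinner_eqI)
      fix x'
      define c where "c b = cinner x' (\<pi>\<^sub>1 (g b) x)" for b
      have "\<pi>\<^sub>2 (\<Sum>b\<in>F. c b *\<^sub>C b) y = \<pi>\<^sub>2 0 y" for y
      proof (rule cinner_eqI)
        fix y'
        have "cinner y' (\<pi>\<^sub>2 (\<Sum>b\<in>F. c b *\<^sub>C b) y) = (\<Sum>b\<in>F. c b * cinner y' (\<pi>\<^sub>2 b y))"
          using clinear_sum[of "\<lambda>b. \<pi>\<^sub>2 b y" "\<lambda>b. c b *\<^sub>C b" F] \<pi>\<^sub>2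
          by (simp add: faithful_star_representation_def \<pi>\<^sub>2_simps cinner_sum_right cinner_algebra)
        also have "\<dots> = cinner (t x' y') (\<pi> u (t x y))"
          unfolding u clinear_sum[OF \<pi>_clinear] by (simp add: cinner_sum_right \<pi>_tensor_apply cinner_tensor c_def)
        finally show "cinner y' (\<pi>\<^sub>2 (\<Sum>b\<in>F. c b *\<^sub>C b) y) = cinner y' (\<pi>\<^sub>2 0 y)"
          by (simp add: assms \<pi>\<^sub>2_simps)
      qed
      then have "(\<Sum>b\<in>F. c b *\<^sub>C b) = 0"
        using \<pi>\<^sub>2 unfolding faithful_star_representation_def by (meson ext injD)
      then have "c b = 0"
        using cvs.independentD[OF indep F] \<open>b \<in> F\<close> by blast
      then show "cinner x' (\<pi>\<^sub>1 (g b) x) = cinner x' (\<pi>\<^sub>1 0 x)"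
        by (simp add: c_def \<pi>\<^sub>1_simps)
    qed
    then show ?thesis
      using \<pi>\<^sub>1 unfolding faithful_star_representation_def by (meson ext injD)
  qed
  then show ?thesis
    unfolding u by (simp add: algebra_tensor_simps)
qed

lemma faithful_star_representation_tensor: "faithful_star_representation \<pi>"
  unfolding faithful_star_representation_def
proof (intro conjI allI)
  show "inj \<pi>"
  proof (rule injI)
    fix u v assume "\<pi> u = \<pi> v"
    then have "\<pi> (u - v) = (\<lambda>x. 0)" by (simp add: fun_eq_iff \<pi>_simps)
    then show "u = v" using \<pi>_faithful by fastforce
  qed
qed (rule bounded_\<pi> \<pi>_clinear \<pi>_mult \<pi>_one \<pi>_star)+

end

section \<open>Twisted sums of operators\<close>

lemma symmetric_op_cspan:
  fixes G :: "('h::complex_hilbert) unbounded_op"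
  assumes G: "symmetric_op G"
  shows "symmetric_op (cspan G)"
proof -
  have 1: "cinner (fst p) (snd q) = cinner (snd p) (fst q)" if "p \<in> G" "q \<in> cspan G" for p q
    using that(2)
  proof (induction rule: cspan_induct)
    case (base q)
    then show ?case
      using symmetric_opD[OF G, of "fst p" "snd p" "fst q" "snd q"] that(1) by simp
  qed (simp_all add: cinner_algebra)
  have "cinner (fst p) (snd q) = cinner (snd p) (fst q)" if "p \<in> cspan G" "q \<in> cspan G" for p q
    using that(1)
    by (induction rule: cspan_induct) (use 1 that(2) in \<open>simp_all add: cinner_algebra\<close>)
  then show ?thesis
    unfolding symmetric_op_def by fastforce
qed

lemma csubspace_op_plus:
  assumes S: "csubspace S" and T: "csubspace T" shows "csubspace (S \<oplus> T)"
  unfolding csubspace_iff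
proof (intro conjI ballI allI)
  show "0 \<in> S \<oplus> T"
    using cvs.subspace_0[OF S] cvs.subspace_0[OF T] by (force simp: op_plus_def zero_prod_def)
  fix p q assume "p \<in> S \<oplus> T" "q \<in> S \<oplus> T"
  then obtain x y z x' y' z' where p: "p = (x, y + z)" "(x, y) \<in> S" "(x, z) \<in> T"
      and q: "q = (x', y' + z')" "(x', y') \<in> S" "(x', z') \<in> T"
    unfolding op_plus_def by blast
  have "(x + x', y + y') \<in> S" "(x + x', z + z') \<in> T"
    using cvs.subspace_add[OF S p(2) q(2)] cvs.subspace_add[OF T p(3) q(3)] by simp_all
  then have "(x + x', (y + y') + (z + z')) \<in> S \<oplus> T"
    unfolding op_plus_def by blast
  then show "p + q \<in> S \<oplus> T"
    unfolding p(1) q(1) by (simp add: algebra_simps)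
next
  fix c p assume "p \<in> S \<oplus> T"
  then obtain x y z where p: "p = (x, y + z)" "(x, y) \<in> S" "(x, z) \<in> T"
    unfolding op_plus_def by blast
  have "(c *\<^sub>C x, c *\<^sub>C y) \<in> S" "(c *\<^sub>C x, c *\<^sub>C z) \<in> T"
    using cvs.subspace_scale[OF S p(2), of c] cvs.subspace_scale[OF T p(3), of c] by simp_all
  then have "(c *\<^sub>C x, c *\<^sub>C y + c *\<^sub>C z) \<in> S \<oplus> T"
    unfolding op_plus_def by blast
  then show "c *\<^sub>C p \<in> S \<oplus> T"
    unfolding p(1) by (simp add: scaleC_add_right)
qed

lemma symmetric_op_plus:
  assumes "symmetric_op S" "symmetric_op T" shows "symmetric_op (S \<oplus> T)"
proof -
  have "cinner x (y' + z') = cinner (y + z) x'"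
    if "(x, y) \<in> S" "(x, z) \<in> T" "(x', y') \<in> S" "(x', z') \<in> T" for x y z x' y' z'
    using symmetric_opD[OF assms(1) that(1,3)] symmetric_opD[OF assms(2) that(2,4)]
    by (simp add: cinner_algebra)
  then show ?thesis
    unfolding symmetric_op_def op_plus_def by blast
qed

lemma symmetric_op_graph: "bounded_self_adjoint U \<Longrightarrow> symmetric_op (graph U)"
  by (auto simp: symmetric_op_def graph_def bounded_self_adjoint_def)

lemma (in hilbert_tensor_product) symmetric_op_tensor:
  assumes "symmetric_op S" "symmetric_op T" shows "symmetric_op (S \<otimes>\<^bsub>t\<^esub> T)"
  unfolding op_tensor_def
  by (rule symmetric_op_cspan, unfold symmetric_op_def)
    (use symmetric_opD[OF assms(1)] symmetric_opD[OF assms(2)] in \<open>auto simp: cinner_tensor\<close>)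

lemma self_adjoint_unitaryD:
  assumes "self_adjoint_unitary U"
  shows "bounded_clinear U" "bounded_self_adjoint U" "cinner (U x) y = cinner x (U y)" "U (U x) = x"
  using assms unfolding self_adjoint_unitary_def bounded_self_adjoint_def by (auto dest: fun_cong[of _ _ x])

lemma essentially_self_adjoint_closure:
  assumes "essentially_self_adjoint T"
  shows "self_adjoint (closure T)" "symmetric_op (closure T)" "csubspace (closure T)"
    "closure (Domain T) = UNIV" "symmetric_op T"
proof -
  show "self_adjoint (closure T)" "closure (Domain T) = UNIV"
    using assms by (auto simp: essentially_self_adjoint_def)
  then show "symmetric_op (closure T)"
    by (intro self_adjoint_symmetric)
  then show "symmetric_op T"
    using closure_subset unfolding symmetric_op_def by blast
  show "csubspace (closure T)"
    using \<open>self_adjoint (closure T)\<close> by (simp add: self_adjoint_def is_operator_def)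
qed

text \<open>\<open>T U = c U T\<close>: the case \<open>c = 1\<close> is commutation and \<open>c = -1\<close> is anticommutation.\<close>

definition twists :: "complex \<Rightarrow> ('h::complex_hilbert \<Rightarrow> 'h) \<Rightarrow> 'h unbounded_op \<Rightarrow> bool" where
  "twists c U T \<longleftrightarrow> (\<forall>(x, y) \<in> T. (U x, c *\<^sub>C U y) \<in> T)"

lemma commutes_with_iff_twists: "commutes_with U T \<longleftrightarrow> twists 1 U T"
  by (simp add: commutes_with_def twists_def)

lemma anticommutes_with_iff_twists: "anticommutes_with U T \<longleftrightarrow> twists (-1) U T"
  by (simp add: anticommutes_with_def twists_def)

lemma twistsD: "twists c U T \<Longrightarrow> (x, y) \<in> T \<Longrightarrow> (U x, c *\<^sub>C U y) \<in> T"
  unfolding twists_def by blast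

section \<open>The twisted sum of two operators and its closure\<close>

locale tensor_sum = hilbert_tensor_product t
  for t :: "'h::complex_hilbert \<Rightarrow> 'k::complex_hilbert \<Rightarrow> 'l::complex_hilbert" +
  fixes A :: "'h unbounded_op" and B :: "'k unbounded_op" and \<alpha> :: "'k \<Rightarrow> 'k" and \<beta> :: "'h \<Rightarrow> 'h"
  assumes A: "essentially_self_adjoint A" and B: "essentially_self_adjoint B"
    and \<alpha>: "self_adjoint_unitary \<alpha>" and \<beta>: "self_adjoint_unitary \<beta>"
begin

definition S :: "'l unbounded_op" where
  "S = A \<otimes>\<^bsub>t\<^esub> graph \<alpha> \<oplus> graph \<beta> \<otimes>\<^bsub>t\<^esub> B"

text \<open>Built from the closures of \<open>A\<close> and \<open>B\<close>, since the eigenvectors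
  and their images under the twisting maps are known to lie only in the domains of the
  closures.\<close>

definition K :: "'l unbounded_op" where
  "K = {(t x y, t x' (\<alpha> y) + t (\<beta> x) y') | x x' y y'. (x, x') \<in> closure A \<and> (y, y') \<in> closure B}"

lemma subspace_S: "csubspace S"
  unfolding S_def op_tensor_def by (intro csubspace_op_plus cvs.subspace_span)

lemma subspace_closure_S: "csubspace (closure S)"
  by (rule csubspace_closure_prod[OF subspace_S])

lemma symmetric_S: "symmetric_op S"
  unfolding S_def
  by (intro symmetric_op_plus symmetric_op_tensor symmetric_op_graph self_adjoint_unitaryD(2)
      essentially_self_adjoint_closure(5) A B \<alpha> \<beta>)

lemma symmetric_closure_S: "symmetric_op (closure S)"
  by (rule symmetric_op_closure[OF symmetric_S])

lemma tensor_in_S: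
  assumes "(x, x') \<in> A" "(y, y') \<in> B"
  shows "(t x y, t x' (\<alpha> y) + t (\<beta> x) y') \<in> S"
proof -
  have "(t x y, t x' (\<alpha> y)) \<in> A \<otimes>\<^bsub>t\<^esub> graph \<alpha>"
    unfolding op_tensor_def by (rule cvs.span_base) (use assms in \<open>auto simp: graph_def\<close>)
  moreover have "(t x y, t (\<beta> x) y') \<in> graph \<beta> \<otimes>\<^bsub>t\<^esub> B"
    unfolding op_tensor_def by (rule cvs.span_base) (use assms in \<open>auto simp: graph_def\<close>)
  ultimately show ?thesis
    unfolding S_def op_plus_def by blast
qed

lemma K_subset: "K \<subseteq> closure S"
proof -
  have "(t x y, t x' (\<alpha> y) + t (\<beta> x) y') \<in> closure S"
    if "(x, x') \<in> closure A" "(y, y') \<in> closure B" for x x' y y'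
  proof -
    obtain f where f: "\<And>n. f n \<in> A" "f \<longlonglongrightarrow> (x, x')"
      using \<open>(x, x') \<in> closure A\<close> unfolding closure_sequential by blast
    obtain g where g: "\<And>n. g n \<in> B" "g \<longlonglongrightarrow> (y, y')"
      using \<open>(y, y') \<in> closure B\<close> unfolding closure_sequential by blast
    have \<alpha>\<beta>: "bounded_linear \<alpha>" "bounded_linear \<beta>"
      using \<alpha> \<beta> by (auto dest: self_adjoint_unitaryD(1) bounded_clinear_bounded_linear)
    note lim = tendsto_fst[OF f(2), simplified] tendsto_snd[OF f(2), simplified]
      tendsto_fst[OF g(2), simplified] tendsto_snd[OF g(2), simplified]
    have "(\<lambda>n. (t (fst (f n)) (fst (g n)),
        t (snd (f n)) (\<alpha> (fst (g n))) + t (\<beta> (fst (f n))) (snd (g n)))) \<longlonglongrightarrow>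
        (t x y, t x' (\<alpha> y) + t (\<beta> x) y')"
      by (intro tendsto_Pair tendsto_add bounded_bilinear.tendsto[OF bounded_bilinear_tensor]
          bounded_linear.tendsto[OF \<alpha>\<beta>(1)] bounded_linear.tendsto[OF \<alpha>\<beta>(2)] lim)
    then show ?thesis
      by (rule closureI_sequence[rotated]) (intro tensor_in_S; simp add: f g)
  qed
  then show ?thesis unfolding K_def by blast
qed

lemma K_I: "(x, x') \<in> closure A \<Longrightarrow> (y, y') \<in> closure B \<Longrightarrow> (t x y, t x' (\<alpha> y) + t (\<beta> x) y') \<in> K"
  unfolding K_def by blast

lemma cspan_K_subset: "closure (cspan K) \<subseteq> closure S"
  by (rule closure_minimal[OF cvs.span_minimal[OF K_subset subspace_closure_S] closed_closure])

lemma dense_domain: "closure (Domain S) = UNIV"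
proof -
  have "u \<in> closure (Domain S)" for u
  proof (rule tensor_induct)
    show "csubspace (closure (Domain S))"
      by (intro csubspace_closure csubspace_Domain subspace_S)
    fix x y
    have "x \<in> closure (Domain A)" "y \<in> closure (Domain B)"
      using essentially_self_adjoint_closure(4) A B by blast+
    then obtain f g where fg: "\<And>n. f n \<in> Domain A" "f \<longlonglongrightarrow> x" "\<And>n. g n \<in> Domain B" "g \<longlonglongrightarrow> y"
      unfolding closure_sequential by metis
    then have "(\<lambda>n. t (f n) (g n)) \<longlonglongrightarrow> t x y"
      by (intro bounded_bilinear.tendsto[OF bounded_bilinear_tensor])
    moreover have "t (f n) (g n) \<in> Domain S" for n
      using fg(1)[of n] fg(3)[of n] tensor_in_S by blast
    ultimately show "t x y \<in> closure (Domain S)"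
      by (intro closureI_sequence[of "\<lambda>n. t (f n) (g n)"])
  qed simp
  then show ?thesis by blast
qed

text \<open>With \<open>w\<close> the value at \<open>t x y\<close>, a second application gives four
  terms. Two of them add up to \<open>c + d\<close> times the tensor because \<open>\<alpha>\<close>
  and \<open>\<beta>\<close> are involutions; the other two are \<open>p\<close> and
  \<open>q\<close> times \<open>t (\<beta> x') (\<alpha> y')\<close> and cancel.\<close>

lemma square_on_tensor:
  assumes x: "(x, x') \<in> closure A" "(x', c *\<^sub>C x) \<in> closure A"
    and y: "(y, y') \<in> closure B" "(y', d *\<^sub>C y) \<in> closure B"
    and twist: "twists p \<beta> (closure A)" "twists q \<alpha> (closure B)" "p + q = 0"
  shows "\<exists>w. (t x y, w) \<in> cspan K \<and> (w, (c + d) *\<^sub>C t x y) \<in> cspan K"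
proof -
  have q: "q = - p" using twist(3) by (simp add: eq_neg_iff_add_eq_0 add.commute)
  have "(t x' (\<alpha> y), t (c *\<^sub>C x) (\<alpha> (\<alpha> y)) + t (\<beta> x') (q *\<^sub>C \<alpha> y')) \<in> cspan K"
    by (intro cvs.span_base K_I x twistsD[OF twist(2)] y)
  moreover have "(t (\<beta> x) y', t (p *\<^sub>C \<beta> x') (\<alpha> y') + t (\<beta> (\<beta> x)) (d *\<^sub>C y)) \<in> cspan K"
    by (intro cvs.span_base K_I y twistsD[OF twist(1)] x)
  ultimately have "(t x' (\<alpha> y), t (c *\<^sub>C x) (\<alpha> (\<alpha> y)) + t (\<beta> x') (q *\<^sub>C \<alpha> y')) +
      (t (\<beta> x) y', t (p *\<^sub>C \<beta> x') (\<alpha> y') + t (\<beta> (\<beta> x)) (d *\<^sub>C y)) \<in> cspan K"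
    by (rule cvs.span_add)
  then have "(t x' (\<alpha> y) + t (\<beta> x) y', (c + d) *\<^sub>C t x y) \<in> cspan K"
    by (simp add: self_adjoint_unitaryD[OF \<alpha>] self_adjoint_unitaryD[OF \<beta>] tensor_simps q scaleC_add_left)
  moreover have "(t x y, t x' (\<alpha> y) + t (\<beta> x) y') \<in> cspan K"
    by (intro cvs.span_base K_I x y)
  ultimately show ?thesis by blast
qed

end

lemma summable_on_product:
  fixes f :: "'a \<Rightarrow> real" and g :: "'b \<Rightarrow> real"
  assumes "f summable_on X" "g summable_on Y" "\<And>x. x \<in> X \<Longrightarrow> 0 \<le> f x" "\<And>y. y \<in> Y \<Longrightarrow> 0 \<le> g y"
  shows "(\<lambda>(x, y). f x * g y) summable_on X \<times> Y"
proof (rule summable_on_SigmaI)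
  show "((\<lambda>y. case (x, y) of (x, y) \<Rightarrow> f x * g y) has_sum f x * infsum g Y) Y" for x
    using has_sum_cmult_right[OF has_sum_infsum[OF assms(2)]] by simp
  show "(\<lambda>x. f x * infsum g Y) summable_on X"
    by (rule summable_on_cmult_left[OF assms(1)])
qed (use assms in auto)

text \<open>Diagonality is required of the squares alone, so that both operators of the data are
  covered with the same \<open>M\<close>, \<open>N\<close>, \<open>\<mu>\<close> and
  \<open>\<nu>\<close>.\<close>

locale diagonal_tensor_sum = tensor_sum t A B \<alpha> \<beta>
  for t :: "'h::complex_hilbert \<Rightarrow> 'k::complex_hilbert \<Rightarrow> 'l::complex_hilbert"
    and A :: "'h unbounded_op" and B :: "'k unbounded_op" and \<alpha> :: "'k \<Rightarrow> 'k" and \<beta> :: "'h \<Rightarrow> 'h" +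
  fixes M :: "'h set" and N :: "'k set" and \<mu> :: "'h \<Rightarrow> real" and \<nu> :: "'k \<Rightarrow> real" and p q :: complex
  assumes M: "orthonormal_basis M" and N: "orthonormal_basis N"
    and square_A: "e \<in> M \<Longrightarrow> (e, complex_of_real ((\<mu> e)\<^sup>2) *\<^sub>C e) \<in> closure A O closure A"
    and square_B: "f \<in> N \<Longrightarrow> (f, complex_of_real ((\<nu> f)\<^sup>2) *\<^sub>C f) \<in> closure B O closure B"
    and twist: "twists p \<beta> (closure A)" "twists q \<alpha> (closure B)" "p + q = 0"
begin

definition V :: "'l set" where "V = case_prod t ` (M \<times> N)"

text \<open>The eigenvalue of the square as a function of the vector: an elementary tensor in
  \<open>V\<close> determines its two basis factors.\<close>

definition \<kappa> :: "'l \<Rightarrow> real" where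
  "\<kappa> v = (case inv_into (M \<times> N) (case_prod t) v of (e, f) \<Rightarrow> (\<mu> e)\<^sup>2 + (\<nu> f)\<^sup>2)"

lemma basis_V: "orthonormal_basis V"
  unfolding V_def by (rule orthonormal_basis_tensor[OF M N])

lemma \<kappa>_tensor: "e \<in> M \<Longrightarrow> f \<in> N \<Longrightarrow> \<kappa> (t e f) = (\<mu> e)\<^sup>2 + (\<nu> f)\<^sup>2"
  using inv_into_f_f[OF orthonormal_basis_tensor(2)[OF M N], of "(e, f)"] by (simp add: \<kappa>_def)

text \<open>The closed span of \<open>K\<close> has a diagonal square and is therefore self-adjoint.
  The closure of \<open>S\<close> is a symmetric extension of it, hence equal to it. From here on,
  properties of the closure of \<open>S\<close> can be checked on \<open>K\<close>.\<close>

lemma closure_S_eq: "closure S = closure (cspan K)"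
  and diagonal_square: "diagonal_square (closure S) V \<kappa>"
proof -
  have square: "\<exists>w. (v, w) \<in> closure (cspan K) \<and> (w, complex_of_real (\<kappa> v) *\<^sub>C v) \<in> closure (cspan K)"
    if "v \<in> V" for v
  proof -
    obtain e f where ef: "e \<in> M" "f \<in> N" "v = t e f"
      using \<open>v \<in> V\<close> by (auto simp: V_def)
    obtain x' y' where "(e, x') \<in> closure A" "(x', complex_of_real ((\<mu> e)\<^sup>2) *\<^sub>C e) \<in> closure A"
        "(f, y') \<in> closure B" "(y', complex_of_real ((\<nu> f)\<^sup>2) *\<^sub>C f) \<in> closure B"
      using square_A[OF ef(1)] square_B[OF ef(2)] by blast
    from square_on_tensor[OF this twist] show ?thesis
      using closure_subset[of "cspan K"] ef by (auto simp: \<kappa>_tensor)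
  qed
  have sym: "symmetric_op (closure (cspan K))"
    using symmetric_closure_S cspan_K_subset unfolding symmetric_op_def by blast
  interpret K: diagonal_square "closure (cspan K)" V \<kappa>
  proof
    show "csubspace (closure (cspan K))"
      by (rule csubspace_closure_prod[OF cvs.subspace_span])
  qed (use sym basis_V square in auto)
  have "closure S \<subseteq> adjoint (closure (cspan K))"
  proof
    fix u assume u: "u \<in> closure S"
    obtain y z where "u = (y, z)" by fastforce
    moreover have "cinner y x' = cinner z x" if "(x, x') \<in> closure (cspan K)" for x x'
      using symmetric_opD[OF symmetric_closure_S] u that cspan_K_subset \<open>u = (y, z)\<close> by blast
    ultimately show "u \<in> adjoint (closure (cspan K))"
      unfolding adjoint_def by blast
  qed
  then show eq: "closure S = closure (cspan K)"
    using K.self_adjoint cspan_K_subset unfolding self_adjoint_def by blast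
  show "diagonal_square (closure S) V \<kappa>"
    unfolding eq by unfold_locales
qed

lemma essentially_self_adjoint_S: "essentially_self_adjoint S"
  unfolding essentially_self_adjoint_def is_operator_def
  using subspace_S symmetric_op_single_valued[OF symmetric_S] dense_domain
    diagonal_square.self_adjoint[OF diagonal_square] by blast

lemma heat_S:
  assumes "\<epsilon> > 0" "(\<lambda>e. exp (- \<epsilon> * (\<mu> e)\<^sup>2)) summable_on M" "(\<lambda>f. exp (- \<epsilon> * (\<nu> f)\<^sup>2)) summable_on N"
  shows "\<exists>B. is_functional_calculus (closure S) (\<lambda>s. exp (- \<epsilon> * s\<^sup>2)) B \<and> trace_class B"
proof (rule diagonal_square.trace_class_heat[OF diagonal_square assms(1)])
  have eq: "exp (- \<epsilon> * (\<mu> e)\<^sup>2) * exp (- \<epsilon> * (\<nu> f)\<^sup>2) = exp (- \<epsilon> * \<kappa> (t e f))" if "e \<in> M" "f \<in> N" for e f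
    using that by (simp add: \<kappa>_tensor exp_add[symmetric] algebra_simps)
  have "(\<lambda>(e, f). exp (- \<epsilon> * (\<mu> e)\<^sup>2) * exp (- \<epsilon> * (\<nu> f)\<^sup>2)) summable_on M \<times> N"
    by (rule summable_on_product[OF assms(2,3)]) auto
  then have "((\<lambda>v. exp (- \<epsilon> * \<kappa> v)) \<circ> case_prod t) summable_on M \<times> N"
    by (rule summable_on_cong[THEN iffD1, rotated]) (auto simp: eq[simplified])
  then show "(\<lambda>v. exp (- \<epsilon> * \<kappa> v)) summable_on V"
    unfolding V_def using summable_on_reindex[OF orthonormal_basis_tensor(2)[OF M N]] by blast
qed

text \<open>The pairs with the claimed property form a closed subspace, so those in \<open>K\<close>
  decide. \<open>C = 0\<close> gives commutation and anticommutation, and \<open>c = 1\<close> gives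
  bounded commutators.\<close>

lemma closure_S_extend:
  assumes U: "bounded_clinear U" and C: "bounded_clinear C"
    and K: "\<And>x y x' y'. (x, x') \<in> closure A \<Longrightarrow> (y, y') \<in> closure B \<Longrightarrow>
      (U (t x y), c *\<^sub>C U (t x' (\<alpha> y) + t (\<beta> x) y') + C (t x y)) \<in> closure S"
    and uw: "(u, w) \<in> closure S"
  shows "(U u, c *\<^sub>C U w + C u) \<in> closure S"
proof -
  define G where "G = {v. (U (fst v), c *\<^sub>C U (snd v) + C (fst v)) \<in> closure S}"
  have "csubspace G"
    unfolding csubspace_iff
  proof (intro conjI ballI allI)
    show "0 \<in> G"
      using cvs.subspace_0[OF subspace_closure_S] bounded_clinear_0[OF U] bounded_clinear_0[OF C]
      by (simp add: G_def zero_prod_def)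
    show "v + w \<in> G" if "v \<in> G" "w \<in> G" for v w
      using that cvs.subspace_add[OF subspace_closure_S]
      by (fastforce simp: G_def bounded_clinear_add[OF U] bounded_clinear_add[OF C] scaleC_add_right algebra_simps)
    show "d *\<^sub>C v \<in> G" if "v \<in> G" for d v
      using that cvs.subspace_scale[OF subspace_closure_S, of _ d]
      by (fastforce simp: G_def bounded_clinear_scaleC[OF U] bounded_clinear_scaleC[OF C] scaleC_add_right mult.commute)
  qed
  moreover have "closed G"
  proof -
    have "continuous_on UNIV U" "continuous_on UNIV C"
      using U C by (auto intro: linear_continuous_on bounded_clinear_bounded_linear)
    then have "continuous_on UNIV (\<lambda>v. (U (fst v), c *\<^sub>C U (snd v) + C (fst v)))"
      by (intro continuous_intros) (auto intro!: continuous_on_compose2[of UNIV U] continuous_on_compose2[of UNIV C] continuous_intros)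
    then have "closed ((\<lambda>v. (U (fst v), c *\<^sub>C U (snd v) + C (fst v))) -` closure S)"
      by (rule closed_vimage[OF closed_closure])
    then show ?thesis by (simp add: G_def vimage_def)
  qed
  moreover have "K \<subseteq> G"
    unfolding K_def G_def using K by auto
  ultimately have "closure (cspan K) \<subseteq> G"
    by (intro closure_minimal cvs.span_minimal)
  then show ?thesis
    using uw closure_S_eq unfolding G_def by auto
qed

end

context diagonal_tensor_sum
begin

lemma twists_closure_S:
  assumes U: "bounded_clinear U" "twists r U (closure A)" "U \<circ> \<beta> = \<beta> \<circ> U"
    and W: "bounded_clinear W" "twists r W (closure B)" "W \<circ> \<alpha> = \<alpha> \<circ> W"
  shows "twists r (bounded_tensor t U W) (closure S)"
proof -
  note UW = bounded_tensor[OF U(1) W(1)]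
  have "(bounded_tensor t U W u, r *\<^sub>C bounded_tensor t U W w + 0) \<in> closure S" if "(u, w) \<in> closure S" for u w
  proof (rule closure_S_extend[OF UW(1) bounded_clinear_zero _ that])
    fix x y x' y' assume x: "(x, x') \<in> closure A" and y: "(y, y') \<in> closure B"
    have "(t (U x) (W y), t (r *\<^sub>C U x') (\<alpha> (W y)) + t (\<beta> (U x)) (r *\<^sub>C W y')) \<in> closure S"
      using K_I[OF twistsD[OF U(2) x] twistsD[OF W(2) y]] K_subset by blast
    moreover have "\<alpha> (W y) = W (\<alpha> y)" "\<beta> (U x) = U (\<beta> x)"
      using fun_cong[OF W(3), of y] fun_cong[OF U(3), of x] by simp_all
    ultimately show "(bounded_tensor t U W (t x y), r *\<^sub>C bounded_tensor t U W (t x' (\<alpha> y) + t (\<beta> x) y') + 0) \<in> closure S"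
      by (simp add: UW bounded_clinear_add[OF UW(1)] tensor_simps scaleC_add_right)
  qed
  then show ?thesis unfolding twists_def by auto
qed

lemma bounded_commutator_closure_S:
  assumes U: "bounded_clinear U" "bounded_commutator (closure A) U" "U \<circ> \<beta> = \<beta> \<circ> U"
    and W: "bounded_clinear W" "bounded_commutator (closure B) W" "W \<circ> \<alpha> = \<alpha> \<circ> W"
  shows "bounded_commutator (closure S) (bounded_tensor t U W)"
proof -
  note UW = bounded_tensor[OF U(1) W(1)]
  obtain C\<^sub>1 where C\<^sub>1: "bounded_clinear C\<^sub>1" "\<And>x y. (x, y) \<in> closure A \<Longrightarrow> (U x, U y + C\<^sub>1 x) \<in> closure A"
    using U(2) unfolding bounded_commutator_def by blast
  obtain C\<^sub>2 where C\<^sub>2: "bounded_clinear C\<^sub>2" "\<And>x y. (x, y) \<in> closure B \<Longrightarrow> (W x, W y + C\<^sub>2 x) \<in> closure B"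
    using W(2) unfolding bounded_commutator_def by blast
  note \<alpha>W = bounded_clinear_compose[OF self_adjoint_unitaryD(1)[OF \<alpha>] W(1)]
  note \<beta>U = bounded_clinear_compose[OF self_adjoint_unitaryD(1)[OF \<beta>] U(1)]
  note tensors = bounded_tensor[OF C\<^sub>1(1) \<alpha>W] bounded_tensor[OF \<beta>U C\<^sub>2(1)]
  \<comment> \<open>Because \<open>U\<close> commutes with \<open>\<beta>\<close> and
    \<open>W\<close> with \<open>\<alpha>\<close>, the two summands of \<open>S\<close> contribute
    the commutators \<open>C\<^sub>1 \<otimes> \<alpha> W\<close> and
    \<open>\<beta> U \<otimes> C\<^sub>2\<close>.\<close>
  define C where "C = (\<lambda>u. bounded_tensor t C\<^sub>1 (\<lambda>y. \<alpha> (W y)) u + bounded_tensor t (\<lambda>x. \<beta> (U x)) C\<^sub>2 u)"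
  have C: "bounded_clinear C"
    unfolding C_def by (intro bounded_clinear_plus tensors)
  have "(bounded_tensor t U W u, 1 *\<^sub>C bounded_tensor t U W w + C u) \<in> closure S" if "(u, w) \<in> closure S" for u w
  proof (rule closure_S_extend[OF UW(1) C _ that])
    fix x y x' y' assume x: "(x, x') \<in> closure A" and y: "(y, y') \<in> closure B"
    have "(t (U x) (W y), t (U x' + C\<^sub>1 x) (\<alpha> (W y)) + t (\<beta> (U x)) (W y' + C\<^sub>2 y)) \<in> closure S"
      using K_I[OF C\<^sub>1(2)[OF x] C\<^sub>2(2)[OF y]] K_subset by blast
    moreover have "W (\<alpha> y) = \<alpha> (W y)" "U (\<beta> x) = \<beta> (U x)"
      using fun_cong[OF W(3), of y] fun_cong[OF U(3), of x] by simp_all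
    ultimately show "(bounded_tensor t U W (t x y), 1 *\<^sub>C bounded_tensor t U W (t x' (\<alpha> y) + t (\<beta> x) y') + C (t x y)) \<in> closure S"
      by (simp add: UW C_def tensors bounded_clinear_add[OF UW(1)] tensor_simps add_ac)
  qed
  then show ?thesis
    unfolding bounded_commutator_def using C by auto
qed

end

section \<open>Criteria for bounded commutators, anticommutation and separability\<close>

lemma bounded_commutator_add:
  assumes T: "csubspace T" and "bounded_commutator T U" "bounded_commutator T W"
  shows "bounded_commutator T (\<lambda>x. U x + W x)"
proof -
  obtain C where C: "bounded_clinear C" "\<And>x y. (x, y) \<in> T \<Longrightarrow> (U x, U y + C x) \<in> T"
    using assms(2) unfolding bounded_commutator_def by blast
  obtain C' where C': "bounded_clinear C'" "\<And>x y. (x, y) \<in> T \<Longrightarrow> (W x, W y + C' x) \<in> T"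
    using assms(3) unfolding bounded_commutator_def by blast
  have "(U x + W x, U y + W y + (C x + C' x)) \<in> T" if "(x, y) \<in> T" for x y
    using cvs.subspace_add[OF T C(2)[OF that] C'(2)[OF that]] by (simp add: algebra_simps)
  then show ?thesis
    unfolding bounded_commutator_def using bounded_clinear_plus[OF C(1) C'(1)] by blast
qed

lemma bounded_commutator_scale:
  assumes T: "csubspace T" and "bounded_commutator T U"
  shows "bounded_commutator T (\<lambda>x. c *\<^sub>C U x)"
proof -
  obtain C where C: "bounded_clinear C" "\<And>x y. (x, y) \<in> T \<Longrightarrow> (U x, U y + C x) \<in> T"
    using assms(2) unfolding bounded_commutator_def by blast
  have "(c *\<^sub>C U x, c *\<^sub>C U y + c *\<^sub>C C x) \<in> T" if "(x, y) \<in> T" for x y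
    using cvs.subspace_scale[OF T C(2)[OF that], of c] by (simp add: scaleC_add_right)
  then show ?thesis
    unfolding bounded_commutator_def using bounded_clinear_scale[OF C(1)] by blast
qed

text \<open>Tested against \<open>v\<close>, both products are moved by symmetry onto
  \<open>v\<close>, where they cancel. So the relation on an orthonormal basis implies it on the
  whole common domain of the products.\<close>

lemma anticommuteI:
  assumes V: "orthonormal_basis V" and sym: "symmetric_op S" "symmetric_op T"
    and core: "\<And>v. v \<in> V \<Longrightarrow> \<exists>w w' z. (v, w) \<in> S \<and> (w, z) \<in> T \<and> (v, w') \<in> T \<and> (w', - z) \<in> S"
  shows "anticommute S T"
proof -
  have "b + d = 0" if "(x, a) \<in> S" "(a, b) \<in> T" "(x, c) \<in> T" "(c, d) \<in> S" for x a b c d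
  proof (rule orthonormal_basis_eqI[OF V])
    fix v assume "v \<in> V"
    then obtain w w' z where v: "(v, w) \<in> S" "(w, z) \<in> T" "(v, w') \<in> T" "(w', - z) \<in> S"
      using core by blast
    have "cinner v b = - cinner z x"
      using symmetric_opD[OF sym(2) v(3) that(2)] symmetric_opD[OF sym(1) v(4) that(1)] by simp
    moreover have "cinner v d = cinner z x"
      using symmetric_opD[OF sym(1) v(1) that(4)] symmetric_opD[OF sym(2) v(2) that(3)] by simp
    ultimately show "cinner v (b + d) = cinner v 0"
      by (simp add: cinner_algebra)
  qed
  then show ?thesis
    unfolding anticommute_def op_plus_def by blast
qed

text \<open>The countable dense set consists of finite combinations, encoded as lists, with
  coefficients from a countable dense set of complex numbers.\<close>

lemma separable_space_total:
  assumes "countable S" "closure (cspan S) = (UNIV :: 'h::complex_hilbert set)"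
  shows "separable_space (euclidean :: 'h topology)"
proof -
  obtain Q :: "complex set" where Q: "countable Q" "\<And>X. open X \<Longrightarrow> X \<noteq> {} \<Longrightarrow> \<exists>q\<in>Q. q \<in> X"
    using countable_dense_exists by blast
  have dense: "k \<in> closure Q" for k
    unfolding closure_iff_nhds_not_empty using Q(2) by fastforce
  define comb where "comb l = sum_list (map (\<lambda>(q, v). q *\<^sub>C v) l)" for l :: "(complex \<times> 'h) list"
  define R where "R = comb ` lists (Q \<times> S)"
  have "countable R"
    unfolding R_def using Q(1) assms(1) by (intro countable_image countable_lists countable_SIGMA)
  have "x \<in> closure R" if "x \<in> cspan S" for x
    using that
  proof (induction rule: cvs.span_induct_alt)
    case base
    have "0 \<in> R"
      unfolding R_def by (rule image_eqI[of _ _ "[]"]) (simp_all add: comb_def)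
    then show ?case using closure_subset by blast
  next
    case (step k v y)
    obtain f where f: "\<And>n. f n \<in> Q" "f \<longlonglongrightarrow> k"
      using dense unfolding closure_sequential by metis
    obtain g where g: "\<And>n. g n \<in> R" "g \<longlonglongrightarrow> y"
      using step(2) unfolding closure_sequential by metis
    show ?case
    proof (rule closureI_sequence)
      show "(\<lambda>n. f n *\<^sub>C v + g n) \<longlonglongrightarrow> k *\<^sub>C v + y"
        by (intro tendsto_intros f g)
      fix n
      obtain l where l: "l \<in> lists (Q \<times> S)" "g n = comb l"
        using g(1)[of n] unfolding R_def by blast
      show "f n *\<^sub>C v + g n \<in> R"
        unfolding R_def by (rule image_eqI[of _ _ "(f n, v) # l"]) (use l f(1) step(1) in \<open>auto simp: comb_def\<close>)
    qed
  qed
  then have "closure (cspan S) \<subseteq> closure R"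
    by (intro closure_minimal) auto
  then have "closure R = UNIV"
    using assms(2) by blast
  then show ?thesis
    unfolding separable_space_def using \<open>countable R\<close>
    by (intro exI[of _ R]) (auto simp: euclidean_closure_of)
qed

section \<open>Products of spectral data\<close>

context N11_spectral_data
begin

lemma obtain_eigenbasis:
  obtains M \<mu> where "orthonormal_basis M" "\<And>e. e \<in> M \<Longrightarrow> (e, complex_of_real (\<mu> e) *\<^sub>C e) \<in> closure D"
    "\<And>\<epsilon>. \<epsilon> > 0 \<Longrightarrow> (\<lambda>e. exp (- \<epsilon> * (\<mu> e)\<^sup>2)) summable_on M"
proof (rule heat_trace_class_diagonal)
  show "self_adjoint (closure D)"
    using D_self_adjoint by (rule essentially_self_adjoint_closure)
  fix M \<mu> assume "diagonal_operator (closure D) M \<mu>"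
    and "\<And>\<epsilon>. \<epsilon> > 0 \<Longrightarrow> (\<lambda>e. exp (- \<epsilon> * (\<mu> e)\<^sup>2)) summable_on M"
  then show thesis
    by (intro that) (auto dest: diagonal_operator.basis diagonal_operator.eigen)
qed (use heat_trace_class in auto)

text \<open>Anticommutation speaks only about vectors at which both products are defined, so
  \<open>e' = D' e\<close> must first be placed in the domain of \<open>D\<close>. Equality of the
  squares does this: \<open>D'\<close> maps \<open>e'\<close> to \<open>r\<^sup>2 e\<close>, which
  it maps on to \<open>r\<^sup>2 e'\<close>, so \<open>e'\<close> is in the common domain of both
  squares.\<close>

lemma eigenvector_D':
  assumes e: "(e, complex_of_real r *\<^sub>C e) \<in> closure D"
  shows "\<exists>e'. (e, e') \<in> closure D' \<and> (e', complex_of_real (r\<^sup>2) *\<^sub>C e) \<in> closure D' \<and>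
    (e', - (complex_of_real r *\<^sub>C e')) \<in> closure D"
proof -
  note sub = essentially_self_adjoint_closure(3)[OF D_self_adjoint]
    essentially_self_adjoint_closure(3)[OF D'_self_adjoint]
  have "(complex_of_real r *\<^sub>C e, complex_of_real (r\<^sup>2) *\<^sub>C e) \<in> closure D"
    using cvs.subspace_scale[OF sub(1) e, of "complex_of_real r"] by (simp add: power2_eq_square)
  with e have "(e, complex_of_real (r\<^sup>2) *\<^sub>C e) \<in> closure D O closure D" by blast
  then obtain e' where e': "(e, e') \<in> closure D'" "(e', complex_of_real (r\<^sup>2) *\<^sub>C e) \<in> closure D'"
    unfolding squares by blast
  have "(complex_of_real (r\<^sup>2) *\<^sub>C e, complex_of_real (r\<^sup>2) *\<^sub>C e') \<in> closure D'"
    using cvs.subspace_scale[OF sub(2) e'(1), of "complex_of_real (r\<^sup>2)"] by simp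
  with e'(2) have "(e', complex_of_real (r\<^sup>2) *\<^sub>C e') \<in> closure D O closure D"
    unfolding squares by blast
  then obtain g where g: "(e', g) \<in> closure D" by blast
  have "(complex_of_real r *\<^sub>C e, complex_of_real r *\<^sub>C e') \<in> closure D'"
    using cvs.subspace_scale[OF sub(2) e'(1), of "complex_of_real r"] by simp
  with e e'(1) g have "(e, complex_of_real r *\<^sub>C e' + g) \<in> closure D O closure D' \<oplus> closure D' O closure D"
    unfolding op_plus_def by blast
  with D_D' have "complex_of_real r *\<^sub>C e' + g = 0"
    unfolding anticommute_def by blast
  then have "g = - (complex_of_real r *\<^sub>C e')"
    by (simp add: add_eq_0_iff2)
  with e' g show ?thesis by blast
qed

text \<open>What \<open>id\<close>, \<open>\<gamma>\<close> and \<open>st\<close> have in common as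
  twisting factors; with the signs \<open>p\<close> for \<open>D\<close> and \<open>p'\<close> for
  \<open>D'\<close> as parameters, all choices become instances of one lemma.\<close>

definition spectral_twist :: "complex \<Rightarrow> complex \<Rightarrow> ('h \<Rightarrow> 'h) \<Rightarrow> bool" where
  "spectral_twist p p' U \<longleftrightarrow> self_adjoint_unitary U \<and> (\<forall>a. U \<circ> \<pi> a = \<pi> a \<circ> U) \<and>
     U \<circ> \<gamma> = \<gamma> \<circ> U \<and> U \<circ> st = st \<circ> U \<and> twists p U (closure D) \<and> twists p' U (closure D')"

lemma spectral_twists:
  "spectral_twist 1 1 id" "spectral_twist (-1) (-1) \<gamma>" "spectral_twist (-1) 1 st"
proof -
  have "self_adjoint_unitary id"
    by (simp add: self_adjoint_unitary_def bounded_self_adjoint_def bounded_clinear_id)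
  then show "spectral_twist 1 1 id"
    by (simp add: spectral_twist_def twists_def)
  show "spectral_twist (-1) (-1) \<gamma>"
    using grading grading_algebra grading_D grading_D' star_grading
    by (simp add: spectral_twist_def anticommutes_with_iff_twists)
  show "spectral_twist (-1) 1 st"
    using star_unitary star_algebra star_D star_D' star_grading
    by (simp add: spectral_twist_def anticommutes_with_iff_twists commutes_with_iff_twists)
qed

end

locale N11_spectral_data_pair =
  D\<^sub>1: N11_spectral_data \<pi>\<^sub>1 D\<^sub>1 D\<^sub>1' \<gamma>\<^sub>1 st\<^sub>1 + D\<^sub>2: N11_spectral_data \<pi>\<^sub>2 D\<^sub>2 D\<^sub>2' \<gamma>\<^sub>2 st\<^sub>2 +
  representation_tensor_product t tA \<pi>\<^sub>1 \<pi>\<^sub>2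
  for \<pi>\<^sub>1 :: "'a::complex_star_algebra \<Rightarrow> 'h::complex_hilbert \<Rightarrow> 'h" and D\<^sub>1 D\<^sub>1' \<gamma>\<^sub>1 st\<^sub>1
    and \<pi>\<^sub>2 :: "'b::complex_star_algebra \<Rightarrow> 'k::complex_hilbert \<Rightarrow> 'k" and D\<^sub>2 D\<^sub>2' \<gamma>\<^sub>2 st\<^sub>2
    and tA :: "'a \<Rightarrow> 'b \<Rightarrow> 'c::complex_star_algebra" and t :: "'h \<Rightarrow> 'k \<Rightarrow> 'l::complex_hilbert"
begin

text \<open>The first two relations among the signs cancel the cross terms of the squares of the two operators,
  the last two those of their anticommutator.\<close>

lemma N11_spectral_data_tensor:
  assumes \<alpha>: "D\<^sub>2.spectral_twist a a' \<alpha>" and \<alpha>': "D\<^sub>2.spectral_twist b b' \<alpha>'"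
    and \<beta>: "D\<^sub>1.spectral_twist c c' \<beta>" and \<beta>': "D\<^sub>1.spectral_twist d d' \<beta>'"
    and commute: "\<alpha> \<circ> \<alpha>' = \<alpha>' \<circ> \<alpha>" "\<beta> \<circ> \<beta>' = \<beta>' \<circ> \<beta>"
    and signs: "a + c = 0" "b' + d' = 0" "a' + d = 0" "b + c' = 0"
  shows "N11_spectral_data \<pi>
    (D\<^sub>1 \<otimes>\<^bsub>t\<^esub> graph \<alpha> \<oplus> graph \<beta> \<otimes>\<^bsub>t\<^esub> D\<^sub>2) (D\<^sub>1' \<otimes>\<^bsub>t\<^esub> graph \<alpha>' \<oplus> graph \<beta>' \<otimes>\<^bsub>t\<^esub> D\<^sub>2')
    (bounded_tensor t \<gamma>\<^sub>1 \<gamma>\<^sub>2) (bounded_tensor t st\<^sub>1 st\<^sub>2)"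
proof -
  obtain M \<mu> where M: "orthonormal_basis M" and \<mu>: "\<And>e. e \<in> M \<Longrightarrow> (e, complex_of_real (\<mu> e) *\<^sub>C e) \<in> closure D\<^sub>1"
    and heat\<^sub>1: "\<And>\<epsilon>. \<epsilon> > 0 \<Longrightarrow> (\<lambda>e. exp (- \<epsilon> * (\<mu> e)\<^sup>2)) summable_on M"
    using D\<^sub>1.obtain_eigenbasis by blast
  obtain N \<nu> where N: "orthonormal_basis N" and \<nu>: "\<And>f. f \<in> N \<Longrightarrow> (f, complex_of_real (\<nu> f) *\<^sub>C f) \<in> closure D\<^sub>2"
    and heat\<^sub>2: "\<And>\<epsilon>. \<epsilon> > 0 \<Longrightarrow> (\<lambda>f. exp (- \<epsilon> * (\<nu> f)\<^sup>2)) summable_on N"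
    using D\<^sub>2.obtain_eigenbasis by blast
  note \<alpha>_twist = \<alpha>[unfolded D\<^sub>2.spectral_twist_def] and \<alpha>'_twist = \<alpha>'[unfolded D\<^sub>2.spectral_twist_def]
    and \<beta>_twist = \<beta>[unfolded D\<^sub>1.spectral_twist_def] and \<beta>'_twist = \<beta>'[unfolded D\<^sub>1.spectral_twist_def]
  note sub\<^sub>1 = essentially_self_adjoint_closure(3)[OF D\<^sub>1.D_self_adjoint]
  note sub\<^sub>2 = essentially_self_adjoint_closure(3)[OF D\<^sub>2.D_self_adjoint]
  interpret P: diagonal_tensor_sum t D\<^sub>1 D\<^sub>2 \<alpha> \<beta> M N \<mu> \<nu> c a
  proof
    show "(e, complex_of_real ((\<mu> e)\<^sup>2) *\<^sub>C e) \<in> closure D\<^sub>1 O closure D\<^sub>1" if "e \<in> M" for e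
      using D\<^sub>1.eigenvector_D'[OF \<mu>[OF that]] unfolding D\<^sub>1.squares by blast
    show "(f, complex_of_real ((\<nu> f)\<^sup>2) *\<^sub>C f) \<in> closure D\<^sub>2 O closure D\<^sub>2" if "f \<in> N" for f
      using D\<^sub>2.eigenvector_D'[OF \<nu>[OF that]] unfolding D\<^sub>2.squares by blast
  qed (use M N \<alpha>_twist \<beta>_twist D\<^sub>1.D_self_adjoint D\<^sub>2.D_self_adjoint signs in \<open>auto simp: add.commute\<close>)
  \<comment> \<open>The bases and eigenvalues are those of \<open>P\<close>, so \<open>V\<close> and
    \<open>\<kappa>\<close> are shared; the equality of the squares rests on this.\<close>
  interpret P': diagonal_tensor_sum t D\<^sub>1' D\<^sub>2' \<alpha>' \<beta>' M N \<mu> \<nu> d' b'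
  proof
    show "(e, complex_of_real ((\<mu> e)\<^sup>2) *\<^sub>C e) \<in> closure D\<^sub>1' O closure D\<^sub>1'" if "e \<in> M" for e
      using D\<^sub>1.eigenvector_D'[OF \<mu>[OF that]] by blast
    show "(f, complex_of_real ((\<nu> f)\<^sup>2) *\<^sub>C f) \<in> closure D\<^sub>2' O closure D\<^sub>2'" if "f \<in> N" for f
      using D\<^sub>2.eigenvector_D'[OF \<nu>[OF that]] by blast
  qed (use M N \<alpha>'_twist \<beta>'_twist D\<^sub>1.D'_self_adjoint D\<^sub>2.D'_self_adjoint signs in \<open>auto simp: add.commute\<close>)
  interpret Q: diagonal_square "closure P.S" P.V P.\<kappa>
    by (rule P.diagonal_square)
  interpret Q': diagonal_square "closure P'.S" P.V P.\<kappa>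
    by (rule P'.diagonal_square)
  have \<gamma>: "bounded_clinear \<gamma>\<^sub>1" "bounded_clinear \<gamma>\<^sub>2" and st: "bounded_clinear st\<^sub>1" "bounded_clinear st\<^sub>2"
    using D\<^sub>1.grading D\<^sub>2.grading D\<^sub>1.star_unitary D\<^sub>2.star_unitary by (auto dest: self_adjoint_unitaryD(1))
  have "N11_spectral_data \<pi> P.S P'.S (bounded_tensor t \<gamma>\<^sub>1 \<gamma>\<^sub>2) (bounded_tensor t st\<^sub>1 st\<^sub>2)"
  proof
    \<comment> \<open>A summable family of strictly positive reals has a countable index
      set.\<close>
    have "countable M" "countable N"
      using summable_countable_real[OF heat\<^sub>1[OF zero_less_one]] summable_countable_real[OF heat\<^sub>2[OF zero_less_one]]
      by simp_all
    then have "countable P.V"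
      unfolding P.V_def by (intro countable_image countable_SIGMA)
    then show "separable_space (euclidean :: 'l topology)"
      by (rule separable_space_total) (use P.basis_V in \<open>simp add: orthonormal_basis_def\<close>)
    show "faithful_star_representation \<pi>"
      by (rule faithful_star_representation_tensor)
    show "essentially_self_adjoint P.S" "essentially_self_adjoint P'.S"
      by (rule P.essentially_self_adjoint_S P'.essentially_self_adjoint_S)+
    show "closure P.S O closure P.S = closure P'.S O closure P'.S"
      by (simp add: set_eq_iff split_paired_All Q.square_iff Q'.square_iff del: relcomp.simps)
    show "anticommute (closure P.S) (closure P'.S)"
    proof (rule anticommuteI[OF P.basis_V Q.symmetric Q'.symmetric])
      fix v assume "v \<in> P.V"
      then obtain x y where xy: "x \<in> M" "y \<in> N" and v: "v = t x y"
        by (auto simp: P.V_def)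
      define x' y' where "x' = complex_of_real (\<mu> x) *\<^sub>C x" and "y' = complex_of_real (\<nu> y) *\<^sub>C y"
      obtain x'' where x'': "(x, x'') \<in> closure D\<^sub>1'" "(x'', - (complex_of_real (\<mu> x) *\<^sub>C x'')) \<in> closure D\<^sub>1"
        using D\<^sub>1.eigenvector_D'[OF \<mu>[OF xy(1)]] by blast
      obtain y'' where y'': "(y, y'') \<in> closure D\<^sub>2'" "(y'', - (complex_of_real (\<nu> y) *\<^sub>C y'')) \<in> closure D\<^sub>2"
        using D\<^sub>2.eigenvector_D'[OF \<nu>[OF xy(2)]] by blast
      define z u where "z = complex_of_real (\<mu> x) *\<^sub>C x''" and "u = complex_of_real (\<nu> y) *\<^sub>C y''"
      have x: "(x, x') \<in> closure D\<^sub>1" "(x', z) \<in> closure D\<^sub>1'" "(x'', - z) \<in> closure D\<^sub>1"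
        using \<mu>[OF xy(1)] x'' cvs.subspace_scale[OF essentially_self_adjoint_closure(3)[OF D\<^sub>1.D'_self_adjoint] x''(1)]
        by (simp_all add: x'_def z_def)
      have y: "(y, y') \<in> closure D\<^sub>2" "(y', u) \<in> closure D\<^sub>2'" "(y'', - u) \<in> closure D\<^sub>2"
        using \<nu>[OF xy(2)] y'' cvs.subspace_scale[OF essentially_self_adjoint_closure(3)[OF D\<^sub>2.D'_self_adjoint] y''(1)]
        by (simp_all add: y'_def u_def)
      have tw: "twists c \<beta> (closure D\<^sub>1)" "twists c' \<beta> (closure D\<^sub>1')" "twists d \<beta>' (closure D\<^sub>1)"
          "twists a \<alpha> (closure D\<^sub>2)" "twists a' \<alpha> (closure D\<^sub>2')" "twists b \<alpha>' (closure D\<^sub>2)"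
        using \<alpha>_twist \<alpha>'_twist \<beta>_twist \<beta>'_twist by blast+
      define w where "w = t x' (\<alpha> y) + t (\<beta> x) y'"
      define w' where "w' = t x'' (\<alpha>' y) + t (\<beta>' x) y''"
      \<comment> \<open>\<open>s\<close> is the value of the second operator at \<open>w\<close>. In
        the opposite order each of its four terms reappears with the opposite sign: those with
        \<open>z\<close> and \<open>u\<close> by anticommutation within a factor, the other two by
        \<open>d = - a'\<close> and \<open>b = - c'\<close>.\<close>
      define s where "s = (t z (\<alpha>' (\<alpha> y)) + t (\<beta>' x') (a' *\<^sub>C \<alpha> y'')) + (t (c' *\<^sub>C \<beta> x'') (\<alpha>' y') + t (\<beta>' (\<beta> x)) u)"
      have "(v, w) \<in> closure P.S" "(v, w') \<in> closure P'.S"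
        unfolding v w_def w'_def using P.K_I[OF x(1) y(1)] P.K_subset P'.K_I[OF x''(1) y''(1)] P'.K_subset by blast+
      moreover have "(w, s) \<in> closure P'.S"
      proof -
        have "(t x' (\<alpha> y), t z (\<alpha>' (\<alpha> y)) + t (\<beta>' x') (a' *\<^sub>C \<alpha> y'')) \<in> closure P'.S"
          using P'.K_I[OF x(2) twistsD[OF tw(5) y''(1)]] P'.K_subset by blast
        moreover have "(t (\<beta> x) y', t (c' *\<^sub>C \<beta> x'') (\<alpha>' y') + t (\<beta>' (\<beta> x)) u) \<in> closure P'.S"
          using P'.K_I[OF twistsD[OF tw(2) x''(1)] y(2)] P'.K_subset by blast
        ultimately show ?thesis
          using cvs.subspace_add[OF Q'.subspace] unfolding w_def s_def by fastforce
      qed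
      moreover have "(w', - s) \<in> closure P.S"
      proof -
        have "(t x'' (\<alpha>' y), t (- z) (\<alpha> (\<alpha>' y)) + t (\<beta> x'') (b *\<^sub>C \<alpha>' y')) \<in> closure P.S"
          using P.K_I[OF x(3) twistsD[OF tw(6) y(1)]] P.K_subset by blast
        moreover have "(t (\<beta>' x) y'', t (d *\<^sub>C \<beta>' x') (\<alpha> y'') + t (\<beta> (\<beta>' x)) (- u)) \<in> closure P.S"
          using P.K_I[OF twistsD[OF tw(3) x(1)] y(3)] P.K_subset by blast
        ultimately have "(w', (t (- z) (\<alpha> (\<alpha>' y)) + t (\<beta> x'') (b *\<^sub>C \<alpha>' y')) +
            (t (d *\<^sub>C \<beta>' x') (\<alpha> y'') + t (\<beta> (\<beta>' x)) (- u))) \<in> closure P.S"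
          using cvs.subspace_add[OF Q.subspace] unfolding w'_def by fastforce
        moreover have "\<alpha> (\<alpha>' y) = \<alpha>' (\<alpha> y)" "\<beta> (\<beta>' x) = \<beta>' (\<beta> x)"
          using fun_cong[OF commute(1), of y] fun_cong[OF commute(2), of x] by simp_all
        moreover have "d = - a'" "b = - c'"
          using signs by (simp_all add: eq_neg_iff_add_eq_0 add.commute)
        ultimately show ?thesis
          by (simp add: s_def tensor_simps algebra_simps)
      qed
      ultimately show "\<exists>w w' z. (v, w) \<in> closure P.S \<and> (w, z) \<in> closure P'.S \<and> (v, w') \<in> closure P'.S \<and> (w', - z) \<in> closure P.S"
        by blast
    qed
    show "bounded_commutator (closure P.S) (\<pi> u)" for u
    proof (induction u rule: algebra_tensor_induct)
      case (add u v)
      then show ?case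
        using bounded_commutator_add[OF Q.subspace] by (simp add: \<pi>_simps[abs_def])
    next
      case (scale c u)
      then show ?case
        using bounded_commutator_scale[OF Q.subspace] by (simp add: \<pi>_simps[abs_def])
    next
      case (base a b)
      show ?case
        unfolding \<pi>_tensor
        by (rule P.bounded_commutator_closure_S)
          (use bounded_\<pi>\<^sub>1 bounded_\<pi>\<^sub>2 D\<^sub>1.commutator_D D\<^sub>2.commutator_D \<alpha>_twist \<beta>_twist in auto)
    qed
    show "bounded_commutator (closure P'.S) (\<pi> u)" for u
    proof (induction u rule: algebra_tensor_induct)
      case (add u v)
      then show ?case
        using bounded_commutator_add[OF Q'.subspace] by (simp add: \<pi>_simps[abs_def])
    next
      case (scale c u)
      then show ?case
        using bounded_commutator_scale[OF Q'.subspace] by (simp add: \<pi>_simps[abs_def])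
    next
      case (base a b)
      show ?case
        unfolding \<pi>_tensor
        by (rule P'.bounded_commutator_closure_S)
          (use bounded_\<pi>\<^sub>1 bounded_\<pi>\<^sub>2 D\<^sub>1.commutator_D' D\<^sub>2.commutator_D' \<alpha>'_twist \<beta>'_twist in auto)
    qed
    show "\<exists>B. is_functional_calculus (closure P.S) (\<lambda>s. exp (- \<epsilon> * s\<^sup>2)) B \<and> trace_class B" if "\<epsilon> > 0" for \<epsilon>
      by (rule P.heat_S[OF that heat\<^sub>1[OF that] heat\<^sub>2[OF that]])
    show "self_adjoint_unitary (bounded_tensor t \<gamma>\<^sub>1 \<gamma>\<^sub>2)" "self_adjoint_unitary (bounded_tensor t st\<^sub>1 st\<^sub>2)"
      by (intro self_adjoint_unitary_tensor D\<^sub>1.grading D\<^sub>2.grading D\<^sub>1.star_unitary D\<^sub>2.star_unitary)+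
    show "bounded_tensor t \<gamma>\<^sub>1 \<gamma>\<^sub>2 \<circ> \<pi> u = \<pi> u \<circ> bounded_tensor t \<gamma>\<^sub>1 \<gamma>\<^sub>2" for u
      by (rule \<pi>_commute[OF bounded_tensor(1)[OF \<gamma>]], unfold \<pi>_tensor)
        (intro bounded_tensor_commute \<gamma> bounded_\<pi>\<^sub>1 bounded_\<pi>\<^sub>2 D\<^sub>1.grading_algebra D\<^sub>2.grading_algebra)
    show "bounded_tensor t st\<^sub>1 st\<^sub>2 \<circ> \<pi> u = \<pi> u \<circ> bounded_tensor t st\<^sub>1 st\<^sub>2" for u
      by (rule \<pi>_commute[OF bounded_tensor(1)[OF st]], unfold \<pi>_tensor)
        (intro bounded_tensor_commute st bounded_\<pi>\<^sub>1 bounded_\<pi>\<^sub>2 D\<^sub>1.star_algebra D\<^sub>2.star_algebra)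
    show "bounded_tensor t st\<^sub>1 st\<^sub>2 \<circ> bounded_tensor t \<gamma>\<^sub>1 \<gamma>\<^sub>2 = bounded_tensor t \<gamma>\<^sub>1 \<gamma>\<^sub>2 \<circ> bounded_tensor t st\<^sub>1 st\<^sub>2"
      by (intro bounded_tensor_commute st \<gamma> D\<^sub>1.star_grading D\<^sub>2.star_grading)
    note twists = D\<^sub>1.spectral_twists[unfolded D\<^sub>1.spectral_twist_def] D\<^sub>2.spectral_twists[unfolded D\<^sub>2.spectral_twist_def]
    show "anticommutes_with (bounded_tensor t \<gamma>\<^sub>1 \<gamma>\<^sub>2) (closure P.S)"
      unfolding anticommutes_with_iff_twists
      by (rule P.twists_closure_S) (use twists \<gamma> \<alpha>_twist \<beta>_twist in auto)
    show "anticommutes_with (bounded_tensor t \<gamma>\<^sub>1 \<gamma>\<^sub>2) (closure P'.S)"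
      unfolding anticommutes_with_iff_twists
      by (rule P'.twists_closure_S) (use twists \<gamma> \<alpha>'_twist \<beta>'_twist in auto)
    show "anticommutes_with (bounded_tensor t st\<^sub>1 st\<^sub>2) (closure P.S)"
      unfolding anticommutes_with_iff_twists
      by (rule P.twists_closure_S) (use twists st \<alpha>_twist \<beta>_twist in auto)
    show "commutes_with (bounded_tensor t st\<^sub>1 st\<^sub>2) (closure P'.S)"
      unfolding commutes_with_iff_twists
      by (rule P'.twists_closure_S) (use twists st \<alpha>'_twist \<beta>'_twist in auto)
  qed
  then show ?thesis
    unfolding P.S_def P'.S_def .
qed

end

theorem proposition2p14:
  fixes \<pi>\<^sub>1 :: "'a1::complex_star_algebra \<Rightarrow> 'h1::complex_hilbert \<Rightarrow> 'h1"
    and \<pi>\<^sub>2 :: "'a2::complex_star_algebra \<Rightarrow> 'h2::complex_hilbert \<Rightarrow> 'h2"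
    and D\<^sub>1 D\<^sub>1' :: "'h1 unbounded_op" and \<gamma>\<^sub>1 st\<^sub>1 :: "'h1 \<Rightarrow> 'h1"
    and D\<^sub>2 D\<^sub>2' :: "'h2 unbounded_op" and \<gamma>\<^sub>2 st\<^sub>2 :: "'h2 \<Rightarrow> 'h2"
    and tA :: "'a1 \<Rightarrow> 'a2 \<Rightarrow> 'a::complex_star_algebra"
    and t :: "'h1 \<Rightarrow> 'h2 \<Rightarrow> 'h::complex_hilbert"
  assumes "N11_spectral_data \<pi>\<^sub>1 D\<^sub>1 D\<^sub>1' \<gamma>\<^sub>1 st\<^sub>1"
    and "N11_spectral_data \<pi>\<^sub>2 D\<^sub>2 D\<^sub>2' \<gamma>\<^sub>2 st\<^sub>2"
    and "algebra_tensor tA"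
    and "hilbert_tensor t"
  shows "\<forall>(D, D') \<in>
    {(D\<^sub>1 \<otimes>\<^bsub>t\<^esub> graph id \<oplus> graph st\<^sub>1 \<otimes>\<^bsub>t\<^esub> D\<^sub>2, D\<^sub>1' \<otimes>\<^bsub>t\<^esub> graph st\<^sub>2 \<oplus> graph \<gamma>\<^sub>1 \<otimes>\<^bsub>t\<^esub> D\<^sub>2'),
     (D\<^sub>1 \<otimes>\<^bsub>t\<^esub> graph id \<oplus> graph st\<^sub>1 \<otimes>\<^bsub>t\<^esub> D\<^sub>2, D\<^sub>1' \<otimes>\<^bsub>t\<^esub> graph \<gamma>\<^sub>2 \<oplus> graph st\<^sub>1 \<otimes>\<^bsub>t\<^esub> D\<^sub>2'),
     (D\<^sub>1 \<otimes>\<^bsub>t\<^esub> graph st\<^sub>2 \<oplus> graph id \<otimes>\<^bsub>t\<^esub> D\<^sub>2, D\<^sub>1' \<otimes>\<^bsub>t\<^esub> graph \<gamma>\<^sub>2 \<oplus> graph st\<^sub>1 \<otimes>\<^bsub>t\<^esub> D\<^sub>2'),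
     (D\<^sub>1 \<otimes>\<^bsub>t\<^esub> graph st\<^sub>2 \<oplus> graph id \<otimes>\<^bsub>t\<^esub> D\<^sub>2, D\<^sub>1' \<otimes>\<^bsub>t\<^esub> graph st\<^sub>2 \<oplus> graph \<gamma>\<^sub>1 \<otimes>\<^bsub>t\<^esub> D\<^sub>2'),
     (D\<^sub>1 \<otimes>\<^bsub>t\<^esub> graph id \<oplus> graph \<gamma>\<^sub>1 \<otimes>\<^bsub>t\<^esub> D\<^sub>2, D\<^sub>1' \<otimes>\<^bsub>t\<^esub> graph id \<oplus> graph \<gamma>\<^sub>1 \<otimes>\<^bsub>t\<^esub> D\<^sub>2'),
     (D\<^sub>1 \<otimes>\<^bsub>t\<^esub> graph \<gamma>\<^sub>2 \<oplus> graph id \<otimes>\<^bsub>t\<^esub> D\<^sub>2, D\<^sub>1' \<otimes>\<^bsub>t\<^esub> graph \<gamma>\<^sub>2 \<oplus> graph id \<otimes>\<^bsub>t\<^esub> D\<^sub>2')}.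
    N11_spectral_data (representation_tensor tA t \<pi>\<^sub>1 \<pi>\<^sub>2) D D'
      (bounded_tensor t \<gamma>\<^sub>1 \<gamma>\<^sub>2) (bounded_tensor t st\<^sub>1 st\<^sub>2)"
proof -
  interpret N11_spectral_data_pair \<pi>\<^sub>1 D\<^sub>1 D\<^sub>1' \<gamma>\<^sub>1 st\<^sub>1 \<pi>\<^sub>2 D\<^sub>2 D\<^sub>2' \<gamma>\<^sub>2 st\<^sub>2 tA t
    by (intro N11_spectral_data_pair.intro representation_tensor_product.intro hilbert_tensor_product.intro
        representation_tensor_product_axioms.intro assms
        N11_spectral_data.representation[OF assms(1)] N11_spectral_data.representation[OF assms(2)])
  note twists = D\<^sub>1.spectral_twists D\<^sub>2.spectral_twists
  \<comment> \<open>Resolving the four twist premises with \<open>twists\<close> instantiates all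
    eight signs; what remains is arithmetic with 1 and -1 and the commutation of the gradings with
    the involutions.\<close>
  show ?thesis
    by (rule ballI, elim insertE emptyE; hypsubst; unfold prod.case;
        rule N11_spectral_data_tensor, (rule twists)+;
        simp add: D\<^sub>1.star_grading D\<^sub>2.star_grading)
qed

end
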